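(* Let $H$ be a Hopf algebra over a field $k$ and let $G=\mathrm{Aut}_{Hopf}(H)\times \mathrm{Aut}_{Hopf}(H)$ with multiplication $(\alpha,\beta)*(\gamma,\delta)=(\delta\alpha\delta^{-1}\gamma,\delta\beta)$. Let $\widehat{\mathcal{YD}(H)}$ be the disjoint union of the categories ${}_H\mathcal{YD}^H(\alpha,\beta)$, $(\alpha,\beta)\in G$, equipped with - the monoidal structure: for $M\in {}_H\mathcal{YD}^H(\alpha,\beta)$, $N\in {}_H\mathcal{YD}^H(\gamma,\delta)$, $M\otimes N\in {}_H\mathcal{YD}^H((\alpha,\beta)*(\gamma,\delta))$ with $h\cdot(m\otimes n)=h_2\cdot m\otimes h_1\cdot n$ and coaction $m\otimes n\mapsto m_{(0)}\otimes n_{(0)}\otimes\delta(m_{(1)})\,\delta\alpha\delta^{-1}(n_{(1)})$, with unit object $k$ (trivial action and coaction) in ${}_H\mathcal{YD}^H(id,id)$; - the conjugation $\psi:G\to \mathrm{aut}(\widehat{\mathcal{YD}(H)})$, $(\alpha,\beta)\mapsto\psi_{(\alpha,\beta)}$, where for $N\in {}_H\mathcal{YD}^H(\gamma,\delta)$ the object $\psi_{(\alpha,\beta)}(N)={}^{(\alpha,\beta)}N\in {}_H\mathcal{YD}^H((\alpha,\beta)*(\gamma,\delta)*(\alpha,\beta)^{-1})$ is the vector space $N$ with action $h\rightharpoonup n=\alpha^{-1}\beta(h)\cdot n$ and coaction $n\mapsto n_{(0)}\otimes\beta^{-1}\delta\alpha\delta^{-1}(n_{(1)})$, and $\psi_{(\alpha,\beta)}$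 is the identity on morphisms; - the family $c=\{c_{M,N}\}$, where for $M\in {}_H\mathcal{YD}^H(\alpha,\beta)$ and any object $N$, $c_{M,N}:M\otimes N\to{}^MN\otimes M$, $m\otimes n\mapsto\alpha^{-1}(m_{(1)})\cdot n\otimes m_{(0)}$, with ${}^MN={}^{(\alpha,\beta)}N$. Then $\widehat{\mathcal{YD}(H)}$ is a braided $T$-category over $G$.
   Context: $\mathrm{Aut}_{Hopf}(H)$ is the group of Hopf algebra automorphisms of $H$ under composition. In $G$ the unit is $(id,id)$ and $(\alpha,\beta)^{-1}=(\beta^{-1}\alpha^{-1}\beta,\beta^{-1})$. For $(\alpha,\beta)\in G$, an $(\alpha,\beta)$-Yetter-Drinfel'd module over $H$ is a vector space $M$ that is a left $H$-module (action $h\cdot m$) and a right $H$-comodule (coaction $m\mapsto m_{(0)}\otimes m_{(1)}$) such that $$h_1\cdot m_{(0)}\otimes\beta(h_2)m_{(1)}=(h_2\cdot m)_{(0)}\otimes(h_2\cdot m)_{(1)}\alpha(h_1)$$ for all $h\in H$, $m\in M$. ${}_H\mathcal{YD}^H(\alpha,\beta)$ is the category of these, with morphisms the $H$-linear $H$-colinear maps. In the disjoint union there are no morphisms between objects of different components. Crossed category over a group $G$: a strict monoidal category $\mathcal C$ (tensor products of vector spaces being treated as strictly associative and unital) which is the disjoint union of subcategories $\{\mathcal C_a\}_{a\in G}$ with $U\otimes V\in\mathcal C_{ab}$ for $U\in\mathcal C_a$, $V\in\mathcal C_b$, together with a group homomorphism $\varphi:G\to \mathrm{aut}(\mathcal C)$,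 $b\mapsto\varphi_b$ (conjugation), where $\mathrm{aut}(\mathcal C)$ is the group of invertible strict tensor functors $\mathcal C\to\mathcal C$, such that $\varphi_b(\mathcal C_a)=\mathcal C_{bab^{-1}}$. For $V\in\mathcal C_b$ one writes ${}^V(\cdot)={}^b(\cdot)=\varphi_b$. Braided $T$-category over $G$ (Turaev braided $G$-category): a crossed category $\mathcal C$ over $G$ with a family of isomorphisms $c_{U,V}:U\otimes V\to{}^UV\otimes U$ in $\mathcal C$, for all objects $U,V$, such that: (a) for all morphisms $f:U\to U'$ in $\mathcal C_a$ and $g:V\to V'$ in $\mathcal C_b$, $({}^ag\otimes f)\circ c_{U,V}=c_{U',V'}\circ(f\otimes g)$; (b) $c_{U\otimes V,W}=(c_{U,{}^VW}\otimes id_V)(id_U\otimes c_{V,W})$ and $c_{U,V\otimes W}=(id_{{}^UV}\otimes c_{U,W})(c_{U,V}\otimes id_W)$ for all objects $U,V,W$; (c) $\varphi_a(c_{U,V})=c_{{}^aU,{}^aV}$ for all objects $U,V$ and $a\in G$. *)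

theory Defs
  imports "HOL-Algebra.Module" "HOL-Algebra.Bij"
begin

section \<open>Vector spaces over a field and their tensor products\<close>

text \<open>
  A vector space over a field \<open>K\<close> is a module over \<open>K\<close> in the sense of HOL-Algebra.  All vector
  spaces have their carriers inside the following type, so that they form one universe that is
  closed under tensor products.  Every vector space with carrier in an arbitrary type \<open>'x\<close> has an
  isomorphic copy here, via \<open>Basic\<close>; \<open>Scalar\<close> is used for the unit object \<open>K\<close>; and
  \<open>Tensor [(m\<^sub>1, n\<^sub>1), \<dots>, (m\<^sub>r, n\<^sub>r)]\<close> is used for the tensor
  \<open>m\<^sub>1 \<otimes> n\<^sub>1 + \<dots> + m\<^sub>r \<otimes> n\<^sub>r\<close>.
\<close>

datatype ('k, 'x) vect =
    Basic 'x
  | Scalar (scalar: 'k)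
  | Tensor ("terms": "(('k, 'x) vect \<times> ('k, 'x) vect) list")

definition mod_hom where
  "mod_hom K M N = {f. f \<in> carrier M \<rightarrow> carrier N
     \<and> (\<forall>x\<in>carrier M. \<forall>y\<in>carrier M. f (x \<oplus>\<^bsub>M\<^esub> y) = f x \<oplus>\<^bsub>N\<^esub> f y)
     \<and> (\<forall>c\<in>carrier K. \<forall>x\<in>carrier M. f (c \<odot>\<^bsub>M\<^esub> x) = c \<odot>\<^bsub>N\<^esub> f x)}"

text \<open>
  \<open>M \<otimes> N\<close> is the quotient of the free commutative monoid on \<open>M \<times> N\<close> (here: lists of pairs,
  denoting formal sums) by the bilinearity relations.
\<close>

inductive tensor_eq for K M N where
  refl: "l \<in> lists (carrier M \<times> carrier N) \<Longrightarrow> tensor_eq K M N l l"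
| sym: "tensor_eq K M N l l' \<Longrightarrow> tensor_eq K M N l' l"
| trans: "tensor_eq K M N l l' \<Longrightarrow> tensor_eq K M N l' l'' \<Longrightarrow> tensor_eq K M N l l''"
| append: "tensor_eq K M N l l' \<Longrightarrow> tensor_eq K M N p p' \<Longrightarrow> tensor_eq K M N (l @ p) (l' @ p')"
| commute: "l \<in> lists (carrier M \<times> carrier N) \<Longrightarrow> p \<in> lists (carrier M \<times> carrier N)
    \<Longrightarrow> tensor_eq K M N (l @ p) (p @ l)"
| zero: "n \<in> carrier N \<Longrightarrow> tensor_eq K M N [(\<zero>\<^bsub>M\<^esub>, n)] []"
| add_left: "m \<in> carrier M \<Longrightarrow> m' \<in> carrier M \<Longrightarrow> n \<in> carrier N
    \<Longrightarrow> tensor_eq K M N [(m \<oplus>\<^bsub>M\<^esub> m', n)] [(m, n), (m', n)]"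
| add_right: "m \<in> carrier M \<Longrightarrow> n \<in> carrier N \<Longrightarrow> n' \<in> carrier N
    \<Longrightarrow> tensor_eq K M N [(m, n \<oplus>\<^bsub>N\<^esub> n')] [(m, n), (m, n')]"
| smult: "c \<in> carrier K \<Longrightarrow> m \<in> carrier M \<Longrightarrow> n \<in> carrier N
    \<Longrightarrow> tensor_eq K M N [(c \<odot>\<^bsub>M\<^esub> m, n)] [(m, c \<odot>\<^bsub>N\<^esub> n)]"

text \<open>
  The class of a formal sum is represented by one of its members, so the list \<open>terms t\<close> is always
  an expression of the tensor \<open>t\<close> as a sum of pure tensors.
\<close>

definition tclass where
  "tclass K M N l = Tensor (SOME l'. tensor_eq K M N l l')"

definition tpure where
  "tpure K M N m n = tclass K M N [(m, n)]"

text \<open>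
  The ring operations \<open>mult\<close> and \<open>one\<close> are those of the tensor product of algebras.  They are
  meaningful (and used) only if \<open>M\<close> and \<open>N\<close> are algebras, as in \<open>H \<otimes> H\<close>; a HOL-Algebra module
  carries these two record fields without any condition on them.
\<close>

definition tensor ::
  "('k, 'r) ring_scheme \<Rightarrow> ('k, ('k, 'x) vect, 'm) module_scheme
    \<Rightarrow> ('k, ('k, 'x) vect, 'n) module_scheme \<Rightarrow> ('k, ('k, 'x) vect) module" where
  "tensor K M N =
    \<lparr>carrier = tclass K M N ` lists (carrier M \<times> carrier N),
     mult = \<lambda>x y. tclass K M N [(a \<otimes>\<^bsub>M\<^esub> c, b \<otimes>\<^bsub>N\<^esub> d). (a, b) \<leftarrow> terms x, (c, d) \<leftarrow> terms y],
     one = tpure K M N \<one>\<^bsub>M\<^esub> \<one>\<^bsub>N\<^esub>,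
     zero = tclass K M N [],
     add = \<lambda>x y. tclass K M N (terms x @ terms y),
     smult = \<lambda>c x. tclass K M N [(c \<odot>\<^bsub>M\<^esub> m, n). (m, n) \<leftarrow> terms x]\<rparr>"

text \<open>
  For a bilinear \<open>f\<close> with values in \<open>P\<close>, \<open>tsum P t f\<close> is the value at \<open>t\<close> of the linear map that
  sends \<open>m \<otimes> n\<close> to \<open>f m n\<close>.  This also renders Sweedler notation: \<open>f h\<^sub>1 h\<^sub>2\<close> is
  \<open>tsum P (\<Delta> h) f\<close>, and \<open>f m\<^sub>(\<^sub>0\<^sub>) m\<^sub>(\<^sub>1\<^sub>)\<close> is \<open>tsum P (\<rho> m) f\<close>.
\<close>

definition tsum :: "('b, 'z) ring_scheme \<Rightarrow> ('k, 'x) vect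
    \<Rightarrow> (('k, 'x) vect \<Rightarrow> ('k, 'x) vect \<Rightarrow> 'b) \<Rightarrow> 'b" where
  "tsum P t f = foldr (\<lambda>(x, y) s. f x y \<oplus>\<^bsub>P\<^esub> s) (terms t) \<zero>\<^bsub>P\<^esub>"

definition tensor_map where
  "tensor_map K M N M' N' f g =
    (\<lambda>t\<in>carrier (tensor K M N). tsum (tensor K M' N') t (\<lambda>m n. tpure K M' N' (f m) (g n)))"

definition ground :: "('k, 'r) ring_scheme \<Rightarrow> ('k, ('k, 'x) vect) module" where
  "ground K =
    \<lparr>carrier = Scalar ` carrier K,
     mult = \<lambda>x y. Scalar (scalar x \<otimes>\<^bsub>K\<^esub> scalar y),
     one = Scalar \<one>\<^bsub>K\<^esub>,
     zero = Scalar \<zero>\<^bsub>K\<^esub>,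
     add = \<lambda>x y. Scalar (scalar x \<oplus>\<^bsub>K\<^esub> scalar y),
     smult = \<lambda>c x. Scalar (c \<otimes>\<^bsub>K\<^esub> scalar x)\<rparr>"


section \<open>Hopf algebras and their automorphisms\<close>

record ('k, 'x) hopf_alg = "('k, ('k, 'x) vect) module" +
  comult :: "('k, 'x) vect \<Rightarrow> ('k, 'x) vect"
  counit :: "('k, 'x) vect \<Rightarrow> 'k"
  antipode :: "('k, 'x) vect \<Rightarrow> ('k, 'x) vect"

locale hopf_algebra = module K H + H: ring H
  for K :: "('k, 'r) ring_scheme" and H :: "('k, 'x, 'h) hopf_alg_scheme" +
  assumes smult_mult_left: "\<lbrakk>c \<in> carrier K; x \<in> carrier H; y \<in> carrier H\<rbrakk>
      \<Longrightarrow> (c \<odot>\<^bsub>H\<^esub> x) \<otimes>\<^bsub>H\<^esub> y = c \<odot>\<^bsub>H\<^esub> (x \<otimes>\<^bsub>H\<^esub> y)"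
    and smult_mult_right: "\<lbrakk>c \<in> carrier K; x \<in> carrier H; y \<in> carrier H\<rbrakk>
      \<Longrightarrow> x \<otimes>\<^bsub>H\<^esub> (c \<odot>\<^bsub>H\<^esub> y) = c \<odot>\<^bsub>H\<^esub> (x \<otimes>\<^bsub>H\<^esub> y)"
    and comult_linear: "comult H \<in> mod_hom K H (tensor K H H)"
    and comult_ring_hom: "comult H \<in> ring_hom H (tensor K H H)"
    and counit_linear: "\<lbrakk>c \<in> carrier K; x \<in> carrier H\<rbrakk>
      \<Longrightarrow> counit H (c \<odot>\<^bsub>H\<^esub> x) = c \<otimes>\<^bsub>K\<^esub> counit H x"
    and counit_ring_hom: "counit H \<in> ring_hom H K"
    and coassoc: "h \<in> carrier H \<Longrightarrow>
      tsum (tensor K H (tensor K H H)) (comult H h) (\<lambda>x y.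
        tsum (tensor K H (tensor K H H)) (comult H x) (\<lambda>x1 x2.
          tpure K H (tensor K H H) x1 (tpure K H H x2 y)))
      = tsum (tensor K H (tensor K H H)) (comult H h) (\<lambda>x y.
          tpure K H (tensor K H H) x (comult H y))"
    and counit_left: "h \<in> carrier H \<Longrightarrow> tsum H (comult H h) (\<lambda>x y. counit H x \<odot>\<^bsub>H\<^esub> y) = h"
    and counit_right: "h \<in> carrier H \<Longrightarrow> tsum H (comult H h) (\<lambda>x y. counit H y \<odot>\<^bsub>H\<^esub> x) = h"
    and antipode_linear: "antipode H \<in> mod_hom K H H"
    and antipode_left: "h \<in> carrier H \<Longrightarrow>
      tsum H (comult H h) (\<lambda>x y. antipode H x \<otimes>\<^bsub>H\<^esub> y) = counit H h \<odot>\<^bsub>H\<^esub> \<one>\<^bsub>H\<^esub>"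
    and antipode_right: "h \<in> carrier H \<Longrightarrow>
      tsum H (comult H h) (\<lambda>x y. x \<otimes>\<^bsub>H\<^esub> antipode H y) = counit H h \<odot>\<^bsub>H\<^esub> \<one>\<^bsub>H\<^esub>"

type_synonym ('k, 'x) endo = "('k, 'x) vect \<Rightarrow> ('k, 'x) vect"

definition hopf_aut :: "('k, 'r) ring_scheme \<Rightarrow> ('k, 'x, 'h) hopf_alg_scheme
    \<Rightarrow> ('k, 'x) endo monoid" where
  "hopf_aut K H = BijGroup (carrier H)
    \<lparr>carrier := {\<alpha> \<in> Bij (carrier H) \<inter> ring_hom H H \<inter> mod_hom K H H.
       \<forall>h\<in>carrier H.
         comult H (\<alpha> h) = tsum (tensor K H H) (comult H h) (\<lambda>x y. tpure K H H (\<alpha> x) (\<alpha> y))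
       \<and> counit H (\<alpha> h) = counit H h
       \<and> antipode H (\<alpha> h) = \<alpha> (antipode H h)}\<rparr>"

text \<open>
  The group \<open>G\<close>, with \<open>(\<alpha>, \<beta>) * (\<gamma>, \<delta>) = (\<delta> \<alpha> \<delta>\<^sup>-\<^sup>1 \<gamma>, \<delta> \<beta>)\<close>.
\<close>

definition yd_group :: "('k, 'r) ring_scheme \<Rightarrow> ('k, 'x, 'h) hopf_alg_scheme
    \<Rightarrow> (('k, 'x) endo \<times> ('k, 'x) endo) monoid" where
  "yd_group K H = (let A = hopf_aut K H in
    \<lparr>carrier = carrier A \<times> carrier A,
     mult = \<lambda>(\<alpha>, \<beta>) (\<gamma>, \<delta>). (\<delta> \<otimes>\<^bsub>A\<^esub> \<alpha> \<otimes>\<^bsub>A\<^esub> inv\<^bsub>A\<^esub> \<delta> \<otimes>\<^bsub>A\<^esub> \<gamma>, \<delta> \<otimes>\<^bsub>A\<^esub> \<beta>),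
     one = (\<one>\<^bsub>A\<^esub>, \<one>\<^bsub>A\<^esub>)\<rparr>)"


section \<open>Braided T-categories\<close>

record ('o, 'a) category =
  Obj :: "'o set"
  Arr :: "'a set"
  Dom :: "'a \<Rightarrow> 'o"
  Cod :: "'a \<Rightarrow> 'o"
  Ident :: "'o \<Rightarrow> 'a"
  Comp :: "'a \<Rightarrow> 'a \<Rightarrow> 'a" (infixr \<open>\<cdot>\<index>\<close> 55)

definition Hom :: "('o, 'a, 'z) category_scheme \<Rightarrow> 'o \<Rightarrow> 'o \<Rightarrow> 'a set" where
  "Hom C X Y = {f \<in> Arr C. Dom C f = X \<and> Cod C f = Y}"

locale category =
  fixes C :: "('o, 'a, 'z) category_scheme" (structure)
  assumes Dom_in_Obj: "f \<in> Arr C \<Longrightarrow> Dom C f \<in> Obj C"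
    and Cod_in_Obj: "f \<in> Arr C \<Longrightarrow> Cod C f \<in> Obj C"
    and Ident_in_Hom: "X \<in> Obj C \<Longrightarrow> Ident C X \<in> Hom C X X"
    and Comp_in_Hom: "\<lbrakk>f \<in> Hom C X Y; g \<in> Hom C Y Z\<rbrakk> \<Longrightarrow> g \<cdot> f \<in> Hom C X Z"
    and Comp_Ident_left: "f \<in> Hom C X Y \<Longrightarrow> Ident C Y \<cdot> f = f"
    and Comp_Ident_right: "f \<in> Hom C X Y \<Longrightarrow> f \<cdot> Ident C X = f"
    and Comp_assoc: "\<lbrakk>f \<in> Hom C W X; g \<in> Hom C X Y; h \<in> Hom C Y Z\<rbrakk>
      \<Longrightarrow> (h \<cdot> g) \<cdot> f = h \<cdot> (g \<cdot> f)"

definition inverse_arrows :: "('o, 'a, 'z) category_scheme \<Rightarrow> 'a \<Rightarrow> 'a \<Rightarrow> bool" where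
  "inverse_arrows C f g \<longleftrightarrow> g \<in> Hom C (Cod C f) (Dom C f)
     \<and> g \<cdot>\<^bsub>C\<^esub> f = Ident C (Dom C f) \<and> f \<cdot>\<^bsub>C\<^esub> g = Ident C (Cod C f)"

definition Iso :: "('o, 'a, 'z) category_scheme \<Rightarrow> 'o \<Rightarrow> 'o \<Rightarrow> 'a set" where
  "Iso C X Y = {f \<in> Hom C X Y. \<exists>g. inverse_arrows C f g}"

definition Inv_arr :: "('o, 'a, 'z) category_scheme \<Rightarrow> 'a \<Rightarrow> 'a" where
  "Inv_arr C f = (THE g. inverse_arrows C f g)"

text \<open>
  Tensor products of vector spaces are associative and unital only up to the canonical
  isomorphisms.  Where the literature suppresses these and speaks of a strict monoidal category,
  they are kept here as part of the structure, and are inserted in every equation of morphisms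
  that needs them.  A strict monoidal category is the case in which they are identities.
\<close>

record ('o, 'a) monoidal_category = "('o, 'a) category" +
  TensO :: "'o \<Rightarrow> 'o \<Rightarrow> 'o" (infixr \<open>\<boxtimes>\<index>\<close> 65)
  TensA :: "'a \<Rightarrow> 'a \<Rightarrow> 'a" (infixr \<open>\<star>\<index>\<close> 65)
  UnitO :: "'o"
  Assoc :: "'o \<Rightarrow> 'o \<Rightarrow> 'o \<Rightarrow> 'a"
  LUnit :: "'o \<Rightarrow> 'a"
  RUnit :: "'o \<Rightarrow> 'a"

locale monoidal_category = category C
  for C :: "('o, 'a, 'z) monoidal_category_scheme" (structure) +
  assumes UnitO_in_Obj: "UnitO C \<in> Obj C"
    and TensO_in_Obj: "\<lbrakk>X \<in> Obj C; Y \<in> Obj C\<rbrakk> \<Longrightarrow> X \<boxtimes> Y \<in> Obj C"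
    and TensA_in_Hom: "\<lbrakk>f \<in> Hom C X X'; g \<in> Hom C Y Y'\<rbrakk> \<Longrightarrow> f \<star> g \<in> Hom C (X \<boxtimes> Y) (X' \<boxtimes> Y')"
    and TensA_Ident: "\<lbrakk>X \<in> Obj C; Y \<in> Obj C\<rbrakk> \<Longrightarrow> Ident C X \<star> Ident C Y = Ident C (X \<boxtimes> Y)"
    and TensA_Comp: "\<lbrakk>f \<in> Hom C X X'; f' \<in> Hom C X' X''; g \<in> Hom C Y Y'; g' \<in> Hom C Y' Y''\<rbrakk>
      \<Longrightarrow> (f' \<cdot> f) \<star> (g' \<cdot> g) = (f' \<star> g') \<cdot> (f \<star> g)"
    and Assoc_in_Iso: "\<lbrakk>X \<in> Obj C; Y \<in> Obj C; Z \<in> Obj C\<rbrakk>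
      \<Longrightarrow> Assoc C X Y Z \<in> Iso C ((X \<boxtimes> Y) \<boxtimes> Z) (X \<boxtimes> (Y \<boxtimes> Z))"
    and LUnit_in_Iso: "X \<in> Obj C \<Longrightarrow> LUnit C X \<in> Iso C (UnitO C \<boxtimes> X) X"
    and RUnit_in_Iso: "X \<in> Obj C \<Longrightarrow> RUnit C X \<in> Iso C (X \<boxtimes> UnitO C) X"
    and Assoc_natural: "\<lbrakk>f \<in> Hom C X X'; g \<in> Hom C Y Y'; h \<in> Hom C Z Z'\<rbrakk>
      \<Longrightarrow> Assoc C X' Y' Z' \<cdot> ((f \<star> g) \<star> h) = (f \<star> (g \<star> h)) \<cdot> Assoc C X Y Z"
    and LUnit_natural: "f \<in> Hom C X Y
      \<Longrightarrow> LUnit C Y \<cdot> (Ident C (UnitO C) \<star> f) = f \<cdot> LUnit C X"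
    and RUnit_natural: "f \<in> Hom C X Y
      \<Longrightarrow> RUnit C Y \<cdot> (f \<star> Ident C (UnitO C)) = f \<cdot> RUnit C X"
    and pentagon: "\<lbrakk>W \<in> Obj C; X \<in> Obj C; Y \<in> Obj C; Z \<in> Obj C\<rbrakk>
      \<Longrightarrow> (Ident C W \<star> Assoc C X Y Z) \<cdot> Assoc C W (X \<boxtimes> Y) Z \<cdot> (Assoc C W X Y \<star> Ident C Z)
        = Assoc C W X (Y \<boxtimes> Z) \<cdot> Assoc C (W \<boxtimes> X) Y Z"
    and triangle: "\<lbrakk>X \<in> Obj C; Y \<in> Obj C\<rbrakk>
      \<Longrightarrow> (Ident C X \<star> LUnit C Y) \<cdot> Assoc C X (UnitO C) Y = RUnit C X \<star> Ident C Y"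

text \<open>
  A functor is a pair of an object map and an arrow map.  Both are extensional, so that equality
  of functors is equality on objects and arrows of \<open>C\<close>.
\<close>

definition strict_tensor_functors ::
  "('o, 'a, 'z) monoidal_category_scheme \<Rightarrow> (('o \<Rightarrow> 'o) \<times> ('a \<Rightarrow> 'a)) set" where
  "strict_tensor_functors C = {(F, f).
      F \<in> Obj C \<rightarrow>\<^sub>E Obj C
    \<and> f \<in> extensional (Arr C)
    \<and> (\<forall>X\<in>Obj C. \<forall>Y\<in>Obj C. f ` Hom C X Y \<subseteq> Hom C (F X) (F Y))
    \<and> (\<forall>X\<in>Obj C. f (Ident C X) = Ident C (F X))
    \<and> (\<forall>g\<in>Arr C. \<forall>h\<in>Arr C. Dom C h = Cod C g \<longrightarrow> f (h \<cdot>\<^bsub>C\<^esub> g) = f h \<cdot>\<^bsub>C\<^esub> f g)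
    \<and> F (UnitO C) = UnitO C
    \<and> (\<forall>X\<in>Obj C. \<forall>Y\<in>Obj C. F (X \<boxtimes>\<^bsub>C\<^esub> Y) = F X \<boxtimes>\<^bsub>C\<^esub> F Y)
    \<and> (\<forall>g\<in>Arr C. \<forall>h\<in>Arr C. f (g \<star>\<^bsub>C\<^esub> h) = f g \<star>\<^bsub>C\<^esub> f h)
    \<and> (\<forall>X\<in>Obj C. \<forall>Y\<in>Obj C. \<forall>Z\<in>Obj C. f (Assoc C X Y Z) = Assoc C (F X) (F Y) (F Z))
    \<and> (\<forall>X\<in>Obj C. f (LUnit C X) = LUnit C (F X))
    \<and> (\<forall>X\<in>Obj C. f (RUnit C X) = RUnit C (F X))}"

definition tensor_aut ::
  "('o, 'a, 'z) monoidal_category_scheme \<Rightarrow> (('o \<Rightarrow> 'o) \<times> ('a \<Rightarrow> 'a)) monoid" where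
  "tensor_aut C = units_of
    \<lparr>carrier = strict_tensor_functors C,
     mult = \<lambda>(F, f) (F', f'). (compose (Obj C) F F', compose (Arr C) f f'),
     one = (\<lambda>X\<in>Obj C. X, \<lambda>f\<in>Arr C. f)\<rparr>"

text \<open>
  The subcategory \<open>C\<^sub>a\<close> has the object set \<open>Cmp a\<close> and all arrows of \<open>C\<close> between such objects.
\<close>

definition Cmp_arr :: "('o, 'a, 'z) category_scheme \<Rightarrow> ('g \<Rightarrow> 'o set) \<Rightarrow> 'g \<Rightarrow> 'a set" where
  "Cmp_arr C Cmp a = {f \<in> Arr C. Dom C f \<in> Cmp a \<and> Cod C f \<in> Cmp a}"

locale crossed_category = group G + monoidal_category C
  for G :: "('g, 'y) monoid_scheme" and C :: "('o, 'a, 'z) monoidal_category_scheme" +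
  fixes Cmp :: "'g \<Rightarrow> 'o set"
    and \<phi> :: "'g \<Rightarrow> ('o \<Rightarrow> 'o) \<times> ('a \<Rightarrow> 'a)"
  assumes Obj_Union: "Obj C = (\<Union>a\<in>carrier G. Cmp a)"
    and Cmp_disjoint: "\<lbrakk>a \<in> carrier G; b \<in> carrier G; a \<noteq> b\<rbrakk> \<Longrightarrow> Cmp a \<inter> Cmp b = {}"
    and Arr_Union: "Arr C = (\<Union>a\<in>carrier G. Cmp_arr C Cmp a)"
    and TensO_Cmp: "\<lbrakk>a \<in> carrier G; b \<in> carrier G; U \<in> Cmp a; V \<in> Cmp b\<rbrakk>
      \<Longrightarrow> U \<boxtimes>\<^bsub>C\<^esub> V \<in> Cmp (a \<otimes>\<^bsub>G\<^esub> b)"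
    and conj_hom: "\<phi> \<in> hom G (tensor_aut C)"
    and conj_Cmp: "\<lbrakk>a \<in> carrier G; b \<in> carrier G\<rbrakk>
      \<Longrightarrow> fst (\<phi> b) ` Cmp a = Cmp (b \<otimes>\<^bsub>G\<^esub> a \<otimes>\<^bsub>G\<^esub> inv\<^bsub>G\<^esub> b)"
    and conj_Cmp_arr: "\<lbrakk>a \<in> carrier G; b \<in> carrier G\<rbrakk>
      \<Longrightarrow> snd (\<phi> b) ` Cmp_arr C Cmp a = Cmp_arr C Cmp (b \<otimes>\<^bsub>G\<^esub> a \<otimes>\<^bsub>G\<^esub> inv\<^bsub>G\<^esub> b)"

locale braided_T_category = crossed_category G C Cmp \<phi>
  for G :: "('g, 'y) monoid_scheme" and C :: "('o, 'a, 'z) monoidal_category_scheme"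
    and Cmp \<phi> +
  fixes c :: "'o \<Rightarrow> 'o \<Rightarrow> 'a"
  assumes braiding_Iso: "\<lbrakk>a \<in> carrier G; U \<in> Cmp a; V \<in> Obj C\<rbrakk>
      \<Longrightarrow> c U V \<in> Iso C (U \<boxtimes>\<^bsub>C\<^esub> V) (fst (\<phi> a) V \<boxtimes>\<^bsub>C\<^esub> U)"
    and braiding_natural: "\<lbrakk>a \<in> carrier G; b \<in> carrier G; f \<in> Cmp_arr C Cmp a; g \<in> Cmp_arr C Cmp b;
        f \<in> Hom C U U'; g \<in> Hom C V V'\<rbrakk>
      \<Longrightarrow> (snd (\<phi> a) g \<star>\<^bsub>C\<^esub> f) \<cdot>\<^bsub>C\<^esub> c U V = c U' V' \<cdot>\<^bsub>C\<^esub> (f \<star>\<^bsub>C\<^esub> g)"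
    and braiding_tensor_left: "\<lbrakk>a \<in> carrier G; b \<in> carrier G; U \<in> Cmp a; V \<in> Cmp b; W \<in> Obj C\<rbrakk>
      \<Longrightarrow> c (U \<boxtimes>\<^bsub>C\<^esub> V) W
        = Assoc C (fst (\<phi> a) (fst (\<phi> b) W)) U V
          \<cdot>\<^bsub>C\<^esub> (c U (fst (\<phi> b) W) \<star>\<^bsub>C\<^esub> Ident C V)
          \<cdot>\<^bsub>C\<^esub> Inv_arr C (Assoc C U (fst (\<phi> b) W) V)
          \<cdot>\<^bsub>C\<^esub> (Ident C U \<star>\<^bsub>C\<^esub> c V W)
          \<cdot>\<^bsub>C\<^esub> Assoc C U V W"
    and braiding_tensor_right: "\<lbrakk>a \<in> carrier G; U \<in> Cmp a; V \<in> Obj C; W \<in> Obj C\<rbrakk>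
      \<Longrightarrow> c U (V \<boxtimes>\<^bsub>C\<^esub> W)
        = Inv_arr C (Assoc C (fst (\<phi> a) V) (fst (\<phi> a) W) U)
          \<cdot>\<^bsub>C\<^esub> (Ident C (fst (\<phi> a) V) \<star>\<^bsub>C\<^esub> c U W)
          \<cdot>\<^bsub>C\<^esub> Assoc C (fst (\<phi> a) V) U W
          \<cdot>\<^bsub>C\<^esub> (c U V \<star>\<^bsub>C\<^esub> Ident C W)
          \<cdot>\<^bsub>C\<^esub> Inv_arr C (Assoc C U V W)"
    and braiding_conj: "\<lbrakk>a \<in> carrier G; U \<in> Obj C; V \<in> Obj C\<rbrakk>
      \<Longrightarrow> snd (\<phi> a) (c U V) = c (fst (\<phi> a) U) (fst (\<phi> a) V)"

definition disjoint_union :: "'g set \<Rightarrow> ('g \<Rightarrow> ('o, 'a) category)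
    \<Rightarrow> ('g \<times> 'o, 'g \<times> 'a) category" where
  "disjoint_union I D =
    \<lparr>Obj = (SIGMA a:I. Obj (D a)),
     Arr = (SIGMA a:I. Arr (D a)),
     Dom = \<lambda>(a, f). (a, Dom (D a) f),
     Cod = \<lambda>(a, f). (a, Cod (D a) f),
     Ident = \<lambda>(a, X). (a, Ident (D a) X),
     Comp = \<lambda>(a, g) (_, f). (a, g \<cdot>\<^bsub>D a\<^esub> f)\<rparr>"


section \<open>Yetter-Drinfel'd modules\<close>

text \<open>
  Actions and coactions are extensional (undefined outside the carriers), so that two such
  structures on the same vector space are equal iff they agree on the carriers.
\<close>

record ('k, 'x) yd_mod = "('k, ('k, 'x) vect) module" +
  act :: "('k, 'x) vect \<Rightarrow> ('k, 'x) vect \<Rightarrow> ('k, 'x) vect"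
  coact :: "('k, 'x) vect \<Rightarrow> ('k, 'x) vect"

definition left_module ::
  "('k, 'r) ring_scheme \<Rightarrow> ('k, 'x, 'h) hopf_alg_scheme \<Rightarrow> ('k, 'x) yd_mod \<Rightarrow> bool" where
  "left_module K H M \<longleftrightarrow> module K M
    \<and> act M \<in> carrier H \<rightarrow>\<^sub>E (carrier M \<rightarrow>\<^sub>E carrier M)
    \<and> (\<forall>h\<in>carrier H. act M h \<in> mod_hom K M M)
    \<and> (\<forall>m\<in>carrier M. (\<lambda>h. act M h m) \<in> mod_hom K H M)
    \<and> (\<forall>m\<in>carrier M. act M \<one>\<^bsub>H\<^esub> m = m)
    \<and> (\<forall>g\<in>carrier H. \<forall>h\<in>carrier H. \<forall>m\<in>carrier M. act M (g \<otimes>\<^bsub>H\<^esub> h) m = act M g (act M h m))"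

definition right_comodule ::
  "('k, 'r) ring_scheme \<Rightarrow> ('k, 'x, 'h) hopf_alg_scheme \<Rightarrow> ('k, 'x) yd_mod \<Rightarrow> bool" where
  "right_comodule K H M \<longleftrightarrow> module K M
    \<and> coact M \<in> extensional (carrier M) \<inter> mod_hom K M (tensor K M H)
    \<and> (\<forall>m\<in>carrier M.
        tsum (tensor K M (tensor K H H)) (coact M m) (\<lambda>x y.
          tsum (tensor K M (tensor K H H)) (coact M x) (\<lambda>x0 x1.
            tpure K M (tensor K H H) x0 (tpure K H H x1 y)))
        = tsum (tensor K M (tensor K H H)) (coact M m) (\<lambda>x y.
            tpure K M (tensor K H H) x (comult H y)))
    \<and> (\<forall>m\<in>carrier M. tsum M (coact M m) (\<lambda>x y. counit H y \<odot>\<^bsub>M\<^esub> x) = m)"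

text \<open>
  \<open>h\<^sub>1 \<cdot> m\<^sub>(\<^sub>0\<^sub>) \<otimes> \<beta>(h\<^sub>2) m\<^sub>(\<^sub>1\<^sub>) = (h\<^sub>2 \<cdot> m)\<^sub>(\<^sub>0\<^sub>) \<otimes> (h\<^sub>2 \<cdot> m)\<^sub>(\<^sub>1\<^sub>) \<alpha>(h\<^sub>1)\<close>
\<close>

definition yd_module where
  "yd_module K H = (\<lambda>(\<alpha>, \<beta>) M. left_module K H M \<and> right_comodule K H M
    \<and> (\<forall>h\<in>carrier H. \<forall>m\<in>carrier M.
        tsum (tensor K M H) (comult H h) (\<lambda>h1 h2.
          tsum (tensor K M H) (coact M m) (\<lambda>m0 m1.
            tpure K M H (act M h1 m0) (\<beta> h2 \<otimes>\<^bsub>H\<^esub> m1)))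
        = tsum (tensor K M H) (comult H h) (\<lambda>h1 h2.
            tsum (tensor K M H) (coact M (act M h2 m)) (\<lambda>x0 x1.
              tpure K M H x0 (x1 \<otimes>\<^bsub>H\<^esub> \<alpha> h1)))))"

type_synonym ('k, 'x) yd_arr = "('k, 'x) yd_mod \<times> ('k, 'x) yd_mod \<times> ('k, 'x) endo"

definition yd_category :: "('k, 'r) ring_scheme \<Rightarrow> ('k, 'x, 'h) hopf_alg_scheme
    \<Rightarrow> ('k, 'x) endo \<times> ('k, 'x) endo \<Rightarrow> (('k, 'x) yd_mod, ('k, 'x) yd_arr) category" where
  "yd_category K H a =
    \<lparr>Obj = {M. yd_module K H a M},
     Arr = {(M, N, f). yd_module K H a M \<and> yd_module K H a N
       \<and> f \<in> extensional (carrier M) \<inter> mod_hom K M N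
       \<and> (\<forall>h\<in>carrier H. \<forall>m\<in>carrier M. f (act M h m) = act N h (f m))
       \<and> (\<forall>m\<in>carrier M.
           coact N (f m) = tsum (tensor K N H) (coact M m) (\<lambda>m0 m1. tpure K N H (f m0) m1))},
     Dom = \<lambda>(M, N, f). M,
     Cod = \<lambda>(M, N, f). N,
     Ident = \<lambda>M. (M, M, \<lambda>m\<in>carrier M. m),
     Comp = \<lambda>(_, P, g) (M, _, f). (M, P, compose (carrier M) g f)\<rparr>"

type_synonym ('k, 'x) yd_obj = "(('k, 'x) endo \<times> ('k, 'x) endo) \<times> ('k, 'x) yd_mod"

fun yd_tensor :: "('k, 'r) ring_scheme \<Rightarrow> ('k, 'x, 'h) hopf_alg_scheme
    \<Rightarrow> ('k, 'x) yd_obj \<Rightarrow> ('k, 'x) yd_obj \<Rightarrow> ('k, 'x) yd_obj" where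
  "yd_tensor K H ((\<alpha>, \<beta>), M) ((\<gamma>, \<delta>), N) =
    (let A = hopf_aut K H; T = tensor K M N in
      ((\<alpha>, \<beta>) \<otimes>\<^bsub>yd_group K H\<^esub> (\<gamma>, \<delta>),
       module.extend T (yd_mod.fields
         (\<lambda>h\<in>carrier H. \<lambda>t\<in>carrier T.
            tsum T t (\<lambda>m n. tsum T (comult H h) (\<lambda>h1 h2. tpure K M N (act M h2 m) (act N h1 n))))
         (\<lambda>t\<in>carrier T.
            tsum (tensor K T H) t (\<lambda>m n.
              tsum (tensor K T H) (coact M m) (\<lambda>m0 m1.
                tsum (tensor K T H) (coact N n) (\<lambda>n0 n1.
                  tpure K T H (tpure K M N m0 n0)
                    (\<delta> m1 \<otimes>\<^bsub>H\<^esub> (\<delta> \<otimes>\<^bsub>A\<^esub> \<alpha> \<otimes>\<^bsub>A\<^esub> inv\<^bsub>A\<^esub> \<delta>) n1))))))))"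

definition yd_unit :: "('k, 'r) ring_scheme \<Rightarrow> ('k, 'x, 'h) hopf_alg_scheme \<Rightarrow> ('k, 'x) yd_obj" where
  "yd_unit K H =
    (\<one>\<^bsub>yd_group K H\<^esub>,
     module.extend (ground K) (yd_mod.fields
       (\<lambda>h\<in>carrier H. \<lambda>x\<in>carrier (ground K). counit H h \<odot>\<^bsub>ground K\<^esub> x)
       (\<lambda>x\<in>carrier (ground K). tpure K (ground K) H x \<one>\<^bsub>H\<^esub>)))"

text \<open>
  The index of a morphism with source \<open>(a, M)\<close> and target \<open>(a, N)\<close> in the disjoint union is \<open>a\<close>,
  hence the common shape of the arrows below.
\<close>

definition yd_arrow where
  "yd_arrow X Y f = (fst X, (snd X, snd Y, restrict f (carrier (snd X))))"

definition yd_hat :: "('k, 'r) ring_scheme \<Rightarrow> ('k, 'x, 'h) hopf_alg_scheme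
    \<Rightarrow> (('k, 'x) yd_obj, (('k, 'x) endo \<times> ('k, 'x) endo) \<times> ('k, 'x) yd_arr) monoidal_category" where
  "yd_hat K H =
    category.extend (disjoint_union (carrier (yd_group K H)) (yd_category K H))
      (monoidal_category.fields
        (yd_tensor K H)
        (\<lambda>(a, M, M', f) (b, N, N', g).
           yd_arrow (yd_tensor K H (a, M) (b, N)) (yd_tensor K H (a, M') (b, N'))
             (tensor_map K M N M' N' f g))
        (yd_unit K H)
        (\<lambda>(a, M) (b, N) (c, P).
           yd_arrow (yd_tensor K H (yd_tensor K H (a, M) (b, N)) (c, P))
             (yd_tensor K H (a, M) (yd_tensor K H (b, N) (c, P)))
             (\<lambda>t. tsum (tensor K M (tensor K N P)) t (\<lambda>s p.
                tsum (tensor K M (tensor K N P)) s (\<lambda>m n.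
                  tpure K M (tensor K N P) m (tpure K N P n p)))))
        (\<lambda>(a, M). yd_arrow (yd_tensor K H (yd_unit K H) (a, M)) (a, M)
           (\<lambda>t. tsum M t (\<lambda>x m. scalar x \<odot>\<^bsub>M\<^esub> m)))
        (\<lambda>(a, M). yd_arrow (yd_tensor K H (a, M) (yd_unit K H)) (a, M)
           (\<lambda>t. tsum M t (\<lambda>m x. scalar x \<odot>\<^bsub>M\<^esub> m))))"

definition yd_component :: "('k, 'r) ring_scheme \<Rightarrow> ('k, 'x, 'h) hopf_alg_scheme
    \<Rightarrow> ('k, 'x) endo \<times> ('k, 'x) endo \<Rightarrow> ('k, 'x) yd_obj set" where
  "yd_component K H a = Pair a ` Obj (yd_category K H a)"

fun yd_conj_obj :: "('k, 'r) ring_scheme \<Rightarrow> ('k, 'x, 'h) hopf_alg_scheme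
    \<Rightarrow> ('k, 'x) endo \<times> ('k, 'x) endo \<Rightarrow> ('k, 'x) yd_obj \<Rightarrow> ('k, 'x) yd_obj" where
  "yd_conj_obj K H (\<alpha>, \<beta>) ((\<gamma>, \<delta>), N) =
    (let A = hopf_aut K H; G = yd_group K H in
      ((\<alpha>, \<beta>) \<otimes>\<^bsub>G\<^esub> (\<gamma>, \<delta>) \<otimes>\<^bsub>G\<^esub> inv\<^bsub>G\<^esub> (\<alpha>, \<beta>),
       N\<lparr>act := \<lambda>h\<in>carrier H. \<lambda>n\<in>carrier N. act N ((inv\<^bsub>A\<^esub> \<alpha> \<otimes>\<^bsub>A\<^esub> \<beta>) h) n,
         coact := \<lambda>n\<in>carrier N. tsum (tensor K N H) (coact N n) (\<lambda>n0 n1.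
           tpure K N H n0 ((inv\<^bsub>A\<^esub> \<beta> \<otimes>\<^bsub>A\<^esub> \<delta> \<otimes>\<^bsub>A\<^esub> \<alpha> \<otimes>\<^bsub>A\<^esub> inv\<^bsub>A\<^esub> \<delta>) n1))\<rparr>))"

definition yd_conj where
  "yd_conj K H a =
    (restrict (yd_conj_obj K H a) (Obj (yd_hat K H)),
     \<lambda>(b, N, N', f)\<in>Arr (yd_hat K H).
       yd_arrow (yd_conj_obj K H a (b, N)) (yd_conj_obj K H a (b, N')) f)"

fun yd_braiding where
  "yd_braiding K H ((\<alpha>, \<beta>), M) (b, N) =
    (let A = hopf_aut K H;
         X = yd_tensor K H ((\<alpha>, \<beta>), M) (b, N);
         Y = yd_tensor K H (yd_conj_obj K H (\<alpha>, \<beta>) (b, N)) ((\<alpha>, \<beta>), M) in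
      yd_arrow X Y (\<lambda>t.
        tsum (snd Y) t (\<lambda>m n. tsum (snd Y) (coact M m) (\<lambda>m0 m1.
          tpure K N M (act N ((inv\<^bsub>A\<^esub> \<alpha>) m1) n) m0))))"

end

theory Submission
  imports Defs
begin

text \<open>
  Linear maps out of a tensor product are determined by their values on pure tensors, so every
  axiom reduces to an identity between iterated Sweedler sums.  Such a sum may be pushed
  through linear maps, two of them may be interchanged, and coassociativity may be used under any
  multilinear expression.  The Yetter-Drinfel'd condition, stated for an arbitrary bilinear
  expression, is needed only for the tensor product object, for conjugation and for the linearity and colinearity of the
  braiding; the inverse of \<open>m \<otimes> n \<mapsto> \<alpha>\<inverse>(m\<^sub>1) \<cdot> n \<otimes> m\<^sub>0\<close> is
  \<open>n \<otimes> m \<mapsto> m\<^sub>0 \<otimes> \<alpha>\<inverse>(S(m\<^sub>1)) \<cdot> n\<close>.  Since the twists by automorphisms are determined by the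
  index in \<open>G\<close>, the equalities of objects required of a strict action reduce to equalities of
  words in the automorphism group.
\<close>

section \<open>Tensor products of modules\<close>

text \<open>\<open>tsum\<close> sums over a representative picked by choice, so it is meaningful
  only for bilinear summands. Hence every Sweedler step carries linearity side conditions; the facts
  about \<open>mod_hom\<close> are simplification rules so that these are discharged through nested
  sums.

  The twists of a conjugate are forced by the braiding. Let M, N have indices (\<alpha>, \<beta>),
  (\<gamma>, \<delta>), and let \<epsilon> = \<delta>\<alpha>\<delta>\<inverse> be the twist that M
  \<otimes> N puts on the coefficients of N. The Yetter-Drinfel'd condition for M produces
  \<alpha>\<inverse>(\<beta>(h) m1), so h must act on the conjugate of N through
  \<alpha>\<inverse>\<beta>. The coefficients of the conjugate are twisted again by \<beta> in its
  tensor product with M, and the outcome has to be \<epsilon>, hence \<beta>\<inverse>\<epsilon>.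

  Conjugation changes neither the space nor the function of an arrow: the tensor spaces on both
  sides of a strictness equation are built from the same lists, and only actions and coactions
  remain to be compared.\<close>

definition bilinear_map where
  "bilinear_map K M N P f \<longleftrightarrow> (\<forall>m\<in>carrier M. f m \<in> mod_hom K N P)
     \<and> (\<forall>n\<in>carrier N. (\<lambda>m. f m n) \<in> mod_hom K M P)"

text \<open>The asymmetry between the first argument and the other two matches A \<otimes> (B
  \<otimes> C), the shape of the space in which the coassociativity axioms are stated.\<close>

definition trilinear_map where
  "trilinear_map K A B C P f \<longleftrightarrow> (\<forall>a\<in>carrier A. bilinear_map K B C P (f a))
     \<and> (\<forall>b\<in>carrier B. \<forall>c\<in>carrier C. (\<lambda>a. f a b c) \<in> mod_hom K A P)"

text \<open>The summation of \<open>tsum\<close> detached from the choice of a representative, hence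
  open to induction over the list.\<close>

definition lsum where
  "lsum P f l = foldr (\<lambda>(x, y) s. f x y \<oplus>\<^bsub>P\<^esub> s) l \<zero>\<^bsub>P\<^esub>"

section \<open>Linear and bilinear maps\<close>

lemma mod_homI:
  assumes "\<And>x. x \<in> carrier M \<Longrightarrow> f x \<in> carrier N"
    and "\<And>x y. \<lbrakk>x \<in> carrier M; y \<in> carrier M\<rbrakk> \<Longrightarrow> f (x \<oplus>\<^bsub>M\<^esub> y) = f x \<oplus>\<^bsub>N\<^esub> f y"
    and "\<And>c x. \<lbrakk>c \<in> carrier K; x \<in> carrier M\<rbrakk> \<Longrightarrow> f (c \<odot>\<^bsub>M\<^esub> x) = c \<odot>\<^bsub>N\<^esub> f x"
  shows "f \<in> mod_hom K M N"
  using assms by (auto simp: mod_hom_def)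

lemma mod_hom_closed: "\<lbrakk>f \<in> mod_hom K M N; x \<in> carrier M\<rbrakk> \<Longrightarrow> f x \<in> carrier N"
  by (auto simp: mod_hom_def)

lemma mod_hom_add:
  "\<lbrakk>f \<in> mod_hom K M N; x \<in> carrier M; y \<in> carrier M\<rbrakk> \<Longrightarrow> f (x \<oplus>\<^bsub>M\<^esub> y) = f x \<oplus>\<^bsub>N\<^esub> f y"
  by (auto simp: mod_hom_def)

lemma mod_hom_smult:
  "\<lbrakk>f \<in> mod_hom K M N; c \<in> carrier K; x \<in> carrier M\<rbrakk> \<Longrightarrow> f (c \<odot>\<^bsub>M\<^esub> x) = c \<odot>\<^bsub>N\<^esub> f x"
  by (auto simp: mod_hom_def)

lemma module_abelian_group: "module K M \<Longrightarrow> abelian_group M"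
  by (rule module.axioms)

lemma module_cring: "module K M \<Longrightarrow> cring K"
  by (rule module.axioms)

lemma module_add_closed [simp]:
  "\<lbrakk>module K M; x \<in> carrier M; y \<in> carrier M\<rbrakk> \<Longrightarrow> x \<oplus>\<^bsub>M\<^esub> y \<in> carrier M"
  by (meson abelian_group_def abelian_monoid.a_closed module_abelian_group)

lemma module_zero_closed [simp]: "module K M \<Longrightarrow> \<zero>\<^bsub>M\<^esub> \<in> carrier M"
  by (meson abelian_group_def abelian_monoid.zero_closed module_abelian_group)

lemma module_smult_closed [simp]:
  "\<lbrakk>module K M; c \<in> carrier K; x \<in> carrier M\<rbrakk> \<Longrightarrow> c \<odot>\<^bsub>M\<^esub> x \<in> carrier M"
  by (rule module.smult_closed)

lemma module_smult_zero_left: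
  "\<lbrakk>module K M; x \<in> carrier M\<rbrakk> \<Longrightarrow> \<zero>\<^bsub>K\<^esub> \<odot>\<^bsub>M\<^esub> x = \<zero>\<^bsub>M\<^esub>"
  by (rule module.smult_l_null)

lemma cring_zero_closed: "cring K \<Longrightarrow> \<zero>\<^bsub>K\<^esub> \<in> carrier K"
  by (simp add: cring.cring_simprules)

text \<open>Homogeneity is enough: zero is the multiple of itself by the scalar zero.\<close>

lemma mod_hom_zero:
  assumes "module K M" "module K N" "f \<in> mod_hom K M N"
  shows "f \<zero>\<^bsub>M\<^esub> = \<zero>\<^bsub>N\<^esub>"
proof -
  have z: "\<zero>\<^bsub>K\<^esub> \<in> carrier K"
    using assms(1) by (simp add: cring_zero_closed module_cring)
  have "f (\<zero>\<^bsub>K\<^esub> \<odot>\<^bsub>M\<^esub> \<zero>\<^bsub>M\<^esub>) = \<zero>\<^bsub>K\<^esub> \<odot>\<^bsub>N\<^esub> f \<zero>\<^bsub>M\<^esub>"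
    by (rule mod_hom_smult) (use assms z in auto)
  then show ?thesis
    using assms by (simp add: module_smult_zero_left mod_hom_closed)
qed

lemma bilinear_mapI:
  assumes "\<And>m. m \<in> carrier M \<Longrightarrow> f m \<in> mod_hom K N P"
    and "\<And>n. n \<in> carrier N \<Longrightarrow> (\<lambda>m. f m n) \<in> mod_hom K M P"
  shows "bilinear_map K M N P f"
  using assms by (auto simp: bilinear_map_def)

lemma bilinear_mapD:
  assumes "bilinear_map K M N P f"
  shows "m \<in> carrier M \<Longrightarrow> f m \<in> mod_hom K N P"
    and "n \<in> carrier N \<Longrightarrow> (\<lambda>m. f m n) \<in> mod_hom K M P"
  using assms by (auto simp: bilinear_map_def)

lemma bilinear_map_closed:
  "\<lbrakk>bilinear_map K M N P f; m \<in> carrier M; n \<in> carrier N\<rbrakk> \<Longrightarrow> f m n \<in> carrier P"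
  by (meson bilinear_mapD(1) mod_hom_closed)

section \<open>Finite sums indexed by lists of pairs\<close>

lemma lsum_simps [simp]:
  "lsum P f [] = \<zero>\<^bsub>P\<^esub>" "lsum P f ((x, y) # l) = f x y \<oplus>\<^bsub>P\<^esub> lsum P f l"
  by (simp_all add: lsum_def)

lemma tsum_lsum: "tsum P t f = lsum P f (terms t)"
  by (simp add: tsum_def lsum_def)

lemma lsum_closed:
  "\<lbrakk>module K P; \<And>x y. (x, y) \<in> set l \<Longrightarrow> f x y \<in> carrier P\<rbrakk> \<Longrightarrow> lsum P f l \<in> carrier P"
  by (induction l) auto

lemma lsum_append:
  assumes "module K P" "\<And>x y. (x, y) \<in> set l \<union> set l' \<Longrightarrow> f x y \<in> carrier P"
  shows "lsum P f (l @ l') = lsum P f l \<oplus>\<^bsub>P\<^esub> lsum P f l'"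
proof -
  interpret P: abelian_group P using assms(1) by (rule module_abelian_group)
  show ?thesis
    using assms(2)
  proof (induction l)
    case Nil
    have "lsum P f l' \<in> carrier P"
      by (rule lsum_closed[OF assms(1)]) (use Nil in auto)
    then show ?case by simp
  next
    case (Cons xy l)
    obtain x y where xy: "xy = (x, y)" by force
    have "lsum P f l' \<in> carrier P" "lsum P f l \<in> carrier P" "f x y \<in> carrier P"
      using Cons.prems xy by (auto intro!: lsum_closed[OF assms(1)])
    moreover have "lsum P f (l @ l') = lsum P f l \<oplus>\<^bsub>P\<^esub> lsum P f l'"
      by (rule Cons.IH) (use Cons.prems in auto)
    ultimately show ?case
      by (simp add: xy P.a_assoc)
  qed
qed

lemma lsum_add:
  assumes "module K P" "\<And>x y. (x, y) \<in> set l \<Longrightarrow> f x y \<in> carrier P"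
    "\<And>x y. (x, y) \<in> set l \<Longrightarrow> g x y \<in> carrier P"
  shows "lsum P (\<lambda>x y. f x y \<oplus>\<^bsub>P\<^esub> g x y) l = lsum P f l \<oplus>\<^bsub>P\<^esub> lsum P g l"
proof -
  interpret P: abelian_group P using assms(1) by (rule module_abelian_group)
  show ?thesis
    using assms(2-3)
  proof (induction l)
    case Nil
    then show ?case by simp
  next
    case (Cons xy l)
    obtain x y where xy: "xy = (x, y)" by force
    have "lsum P f l \<in> carrier P" "lsum P g l \<in> carrier P" "f x y \<in> carrier P" "g x y \<in> carrier P"
      using Cons.prems xy by (auto intro!: lsum_closed[OF assms(1)])
    then show ?case
      using Cons by (simp add: xy P.a_ac)
  qed
qed

lemma lsum_mod_hom:
  assumes "module K M" "module K P" "g \<in> mod_hom K M P"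
    "\<And>x y. (x, y) \<in> set l \<Longrightarrow> f x y \<in> carrier M"
  shows "g (lsum M f l) = lsum P (\<lambda>x y. g (f x y)) l"
  using assms(4)
proof (induction l)
  case Nil
  then show ?case using assms by (simp add: mod_hom_zero)
next
  case (Cons xy l)
  obtain x y where xy: "xy = (x, y)" by force
  have "lsum M f l \<in> carrier M" "f x y \<in> carrier M"
    using Cons.prems xy by (auto intro!: lsum_closed[OF assms(1)])
  then show ?case
    using Cons by (simp add: xy mod_hom_add[OF assms(3)])
qed

lemma lsum_cong:
  "\<lbrakk>\<And>x y. (x, y) \<in> set l \<Longrightarrow> f x y = g x y\<rbrakk> \<Longrightarrow> lsum P f l = lsum P g l"
  by (induction l) auto

lemma lsum_zero:
  "module K P \<Longrightarrow> lsum P (\<lambda>_ _. \<zero>\<^bsub>P\<^esub>) l = \<zero>\<^bsub>P\<^esub>"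
proof (induction l)
  case (Cons xy l)
  then interpret P: abelian_group P by (simp add: module_abelian_group)
  show ?case using Cons by (cases xy) simp
qed simp

text \<open>Finite Fubini by induction over the outer list; additivity of \<open>lsum\<close> in the
  summand handles the inner one.\<close>

lemma lsum_swap:
  assumes "module K P"
    "\<And>x y u v. \<lbrakk>(x, y) \<in> set l; (u, v) \<in> set l'\<rbrakk> \<Longrightarrow> f x y u v \<in> carrier P"
  shows "lsum P (\<lambda>x y. lsum P (f x y) l') l = lsum P (\<lambda>u v. lsum P (\<lambda>x y. f x y u v) l) l'"
  using assms(2)
proof (induction l)
  case Nil
  then show ?case using assms(1) by (simp add: lsum_zero)
next
  case (Cons xy l)
  obtain x y where xy: "xy = (x, y)" by force
  have "lsum P (\<lambda>u v. f x y u v \<oplus>\<^bsub>P\<^esub> lsum P (\<lambda>x y. f x y u v) l) l'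
      = lsum P (f x y) l' \<oplus>\<^bsub>P\<^esub> lsum P (\<lambda>u v. lsum P (\<lambda>x y. f x y u v) l) l'"
    by (rule lsum_add[OF assms(1)]) (use Cons.prems xy in \<open>auto intro!: lsum_closed[OF assms(1)]\<close>)
  with Cons show ?case by (simp add: xy)
qed

section \<open>Formal sums modulo the bilinearity relations\<close>

lemma tensor_eq_lists:
  assumes "tensor_eq K M N l l'" "module K M" "module K N"
  shows "l \<in> lists (carrier M \<times> carrier N) \<and> l' \<in> lists (carrier M \<times> carrier N)"
  using assms by (induction) auto

text \<open>The universal property at the level of formal sums. The relations \<open>zero\<close>,
  \<open>add_left\<close>, \<open>add_right\<close> and \<open>smult\<close> are respected because f
  is bilinear, \<open>append\<close> and \<open>commute\<close> because its values lie in an abelian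
  group.\<close>

lemma lsum_tensor_eq:
  assumes "tensor_eq K M N l l'" "module K M" "module K N" "module K P" "bilinear_map K M N P f"
  shows "lsum P f l = lsum P f l'"
  using assms(1)
proof (induction)
  case (append l l' p p')
  have "lsum P f (l @ p) = lsum P f l \<oplus>\<^bsub>P\<^esub> lsum P f p"
    "lsum P f (l' @ p') = lsum P f l' \<oplus>\<^bsub>P\<^esub> lsum P f p'"
    by (rule lsum_append[OF assms(4)];
        use append.hyps[THEN tensor_eq_lists[OF _ assms(2,3)]] bilinear_map_closed[OF assms(5)] in auto)+
  then show ?case using append by simp
next
  case (commute l p)
  interpret P: abelian_group P using assms(4) by (rule module_abelian_group)
  have c: "f x y \<in> carrier P" if "(x, y) \<in> set l \<union> set p" for x y
    using commute bilinear_map_closed[OF assms(5)] that by auto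
  have "lsum P f l \<in> carrier P" "lsum P f p \<in> carrier P"
    by (rule lsum_closed[OF assms(4)]; use c in auto)+
  moreover have "lsum P f (l @ p) = lsum P f l \<oplus>\<^bsub>P\<^esub> lsum P f p"
    "lsum P f (p @ l) = lsum P f p \<oplus>\<^bsub>P\<^esub> lsum P f l"
    by (rule lsum_append[OF assms(4)]; use c in auto)+
  ultimately show ?case by (simp add: P.a_ac)
next
  case (zero n)
  interpret P: abelian_group P using assms(4) by (rule module_abelian_group)
  show ?case using mod_hom_zero[OF assms(2,4) bilinear_mapD(2)[OF assms(5) zero]] by simp
next
  case (add_left m m' n)
  interpret P: abelian_group P using assms(4) by (rule module_abelian_group)
  show ?case using mod_hom_add[OF bilinear_mapD(2)[OF assms(5)]] add_left
      bilinear_map_closed[OF assms(5)] by (simp add: P.a_ac)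
next
  case (add_right m n n')
  interpret P: abelian_group P using assms(4) by (rule module_abelian_group)
  show ?case using mod_hom_add[OF bilinear_mapD(1)[OF assms(5)]] add_right
      bilinear_map_closed[OF assms(5)] by (simp add: P.a_ac)
next
  case (smult c m n)
  then show ?case using mod_hom_smult[OF bilinear_mapD(1)[OF assms(5)]] 
     mod_hom_smult[OF bilinear_mapD(2)[OF assms(5)]] by simp
qed auto

text \<open>Reflexivity supplies the witness that the choice in \<open>tclass\<close> needs.\<close>

lemma tensor_eq_terms:
  assumes "l \<in> lists (carrier M \<times> carrier N)"
  shows "tensor_eq K M N l (terms (tclass K M N l))"
  unfolding tclass_def vect.sel by (rule someI, rule tensor_eq.refl[OF assms])

text \<open>Symmetry and transitivity make the two equivalence classes equal as predicates, and from
  equal predicates the choice operator picks the same representative.\<close>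

lemma tclass_eq:
  assumes "tensor_eq K M N l l'"
  shows "tclass K M N l = tclass K M N l'"
proof -
  have "tensor_eq K M N l = tensor_eq K M N l'"
    using tensor_eq.trans[OF assms] tensor_eq.trans[OF tensor_eq.sym[OF assms]] by blast
  then show ?thesis by (simp add: tclass_def)
qed

lemma tensor_cases:
  assumes "t \<in> carrier (tensor K M N)"
  obtains l where "l \<in> lists (carrier M \<times> carrier N)" "t = tclass K M N l"
  using assms by (auto simp: tensor_def)

lemma tclass_terms:
  assumes "t \<in> carrier (tensor K M N)"
  shows "tclass K M N (terms t) = t"
  using assms by (auto simp: tensor_def intro!: tclass_eq[symmetric] tensor_eq_terms)

lemma terms_lists:
  assumes "t \<in> carrier (tensor K M N)" "module K M" "module K N"
  shows "terms t \<in> lists (carrier M \<times> carrier N)"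
proof -
  obtain l where "l \<in> lists (carrier M \<times> carrier N)" "t = tclass K M N l"
    using assms(1) by (rule tensor_cases)
  with tensor_eq_lists[OF tensor_eq_terms[OF this(1)] assms(2,3)] show ?thesis by simp
qed

lemma terms_carrier:
  assumes "(x, y) \<in> set (terms t)" "t \<in> carrier (tensor K M N)" "module K M" "module K N"
  shows "x \<in> carrier M" "y \<in> carrier N"
  using terms_lists[OF assms(2-4)] assms(1) by auto

text \<open>The chosen terms are equivalent to the given list, and bilinear sums respect the
  equivalence; from here on any convenient representative may be summed.\<close>

lemma lsum_terms_tclass:
  assumes "l \<in> lists (carrier M \<times> carrier N)" "module K M" "module K N" "module K P"
    "bilinear_map K M N P f"
  shows "lsum P f (terms (tclass K M N l)) = lsum P f l"
  by (rule lsum_tensor_eq[OF tensor_eq_terms[OF assms(1)] assms(2-5), symmetric])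

section \<open>Operations on classes, computed on representatives\<close>

lemma tclass_closed: "l \<in> lists (carrier M \<times> carrier N) \<Longrightarrow> tclass K M N l \<in> carrier (tensor K M N)"
  by (auto simp: tensor_def)

lemma zero_tensor: "\<zero>\<^bsub>tensor K M N\<^esub> = tclass K M N []"
  by (simp add: tensor_def)

text \<open>The addition in \<open>tensor\<close> concatenates the chosen terms; since concatenation
  is a congruence, arbitrary representatives give the same class.\<close>

lemma add_tclass:
  assumes "l \<in> lists (carrier M \<times> carrier N)" "l' \<in> lists (carrier M \<times> carrier N)"
  shows "tclass K M N l \<oplus>\<^bsub>tensor K M N\<^esub> tclass K M N l' = tclass K M N (l @ l')"
  by (simp add: tensor_def, rule tclass_eq[symmetric])
    (intro tensor_eq.append tensor_eq_terms assms)

lemma map_smult_lists: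
  assumes "l \<in> lists (carrier M \<times> carrier N)" "module K M" "c \<in> carrier K"
  shows "map (\<lambda>(m, n). (c \<odot>\<^bsub>M\<^esub> m, n)) l \<in> lists (carrier M \<times> carrier N)"
  using assms by (induction l) auto

lemma tensor_eq_map_smult:
  assumes "tensor_eq K M N l l'" "module K M" "module K N" "c \<in> carrier K"
  shows "tensor_eq K M N (map (\<lambda>(m, n). (c \<odot>\<^bsub>M\<^esub> m, n)) l) (map (\<lambda>(m, n). (c \<odot>\<^bsub>M\<^esub> m, n)) l')"
proof -
  note closed = map_smult_lists[OF _ assms(2,4)]
  show ?thesis
    using assms(1)
  proof (induction)
    case (refl l)
    then show ?case by (intro tensor_eq.refl closed)
  next
    case (sym l l')
    show ?case by (rule tensor_eq.sym[OF sym.IH])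
  next
    case (trans l l' l'')
    then show ?case by (blast intro: tensor_eq.trans)
  next
    case (append l l' p p')
    then show ?case by (simp add: tensor_eq.append)
  next
    case (commute l p)
    then show ?case unfolding map_append by (intro tensor_eq.commute closed)
  next
    case (zero n)
    then show ?case using assms by (simp add: module.smult_r_null tensor_eq.zero)
  next
    case (add_left m m' n)
    then show ?case using assms by (simp add: module.smult_r_distr tensor_eq.add_left)
  next
    case (add_right m n n')
    then show ?case using assms by (simp add: tensor_eq.add_right)
  next
    case (smult d m n)
    interpret K: cring K using assms(2) by (rule module_cring)
    \<comment> \<open>Commutativity of K lets c pass the scalar that is being moved across the
      tensor sign.\<close>
    have "c \<odot>\<^bsub>M\<^esub> (d \<odot>\<^bsub>M\<^esub> m) = d \<odot>\<^bsub>M\<^esub> (c \<odot>\<^bsub>M\<^esub> m)"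
      using smult assms by (metis K.m_comm module.smult_assoc1)
    then show ?case using smult assms by (simp add: tensor_eq.smult)
  qed
qed

lemma smult_tclass:
  assumes "l \<in> lists (carrier M \<times> carrier N)" "module K M" "module K N" "c \<in> carrier K"
  shows "c \<odot>\<^bsub>tensor K M N\<^esub> tclass K M N l = tclass K M N (map (\<lambda>(m, n). (c \<odot>\<^bsub>M\<^esub> m, n)) l)"
  by (simp add: tensor_def, rule tclass_eq[symmetric])
    (intro tensor_eq_map_smult tensor_eq_terms assms)

lemma tpure_closed [simp]:
  "\<lbrakk>m \<in> carrier M; n \<in> carrier N\<rbrakk> \<Longrightarrow> tpure K M N m n \<in> carrier (tensor K M N)"
  by (simp add: tpure_def tclass_closed)

lemma tclass_Cons:
  assumes "(m, n) # l \<in> lists (carrier M \<times> carrier N)"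
  shows "tclass K M N ((m, n) # l) = tpure K M N m n \<oplus>\<^bsub>tensor K M N\<^esub> tclass K M N l"
  using assms by (simp add: tpure_def add_tclass)

section \<open>The module structure of the tensor product\<close>

lemma tensor_abelian_monoid:
  assumes "module K M" "module K N"
  shows "abelian_monoid (tensor K M N)"
proof (rule abelian_monoidI)
  fix x y z
  assume "x \<in> carrier (tensor K M N)"
  then obtain l where l: "l \<in> lists (carrier M \<times> carrier N)" "x = tclass K M N l"
    by (rule tensor_cases)
  then show "\<zero>\<^bsub>tensor K M N\<^esub> \<oplus>\<^bsub>tensor K M N\<^esub> x = x"
    by (simp add: zero_tensor add_tclass)
  assume "y \<in> carrier (tensor K M N)"
  then obtain l' where l': "l' \<in> lists (carrier M \<times> carrier N)" "y = tclass K M N l'"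
    by (rule tensor_cases)
  show "x \<oplus>\<^bsub>tensor K M N\<^esub> y \<in> carrier (tensor K M N)"
    unfolding l l' add_tclass[OF l(1) l'(1)] by (rule tclass_closed) (use l l' in simp)
  show "x \<oplus>\<^bsub>tensor K M N\<^esub> y = y \<oplus>\<^bsub>tensor K M N\<^esub> x"
    unfolding l l' add_tclass[OF l(1) l'(1)] add_tclass[OF l'(1) l(1)]
    by (rule tclass_eq, rule tensor_eq.commute[OF l(1) l'(1)])
  assume "z \<in> carrier (tensor K M N)"
  then obtain l'' where l'': "l'' \<in> lists (carrier M \<times> carrier N)" "z = tclass K M N l''"
    by (rule tensor_cases)
  have "l @ l' \<in> lists (carrier M \<times> carrier N)" "l' @ l'' \<in> lists (carrier M \<times> carrier N)"
    using l l' l'' by simp_all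
  then show "x \<oplus>\<^bsub>tensor K M N\<^esub> y \<oplus>\<^bsub>tensor K M N\<^esub> z
      = x \<oplus>\<^bsub>tensor K M N\<^esub> (y \<oplus>\<^bsub>tensor K M N\<^esub> z)"
    using l l' l'' by (simp only: add_tclass append_assoc)
qed (simp add: zero_tensor tclass_closed)

text \<open>Replaces induction over representing lists by induction over sums of pure tensors, which
  does not mention the representative.\<close>

lemma tensor_induct [consumes 1, case_names zero add]:
  assumes "t \<in> carrier (tensor K M N)"
    and zero: "P \<zero>\<^bsub>tensor K M N\<^esub>"
    and add: "\<And>m n t. \<lbrakk>m \<in> carrier M; n \<in> carrier N; t \<in> carrier (tensor K M N); P t\<rbrakk>
      \<Longrightarrow> P (tpure K M N m n \<oplus>\<^bsub>tensor K M N\<^esub> t)"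
  shows "P t"
proof -
  obtain l where l: "l \<in> lists (carrier M \<times> carrier N)" "t = tclass K M N l"
    using assms(1) by (rule tensor_cases)
  have "P (tclass K M N l)"
    using l(1)
  proof (induction l rule: list.induct)
    case Nil
    show ?case using zero by (simp add: zero_tensor)
  next
    case (Cons mn l)
    then have "fst mn \<in> carrier M" "snd mn \<in> carrier N" "l \<in> lists (carrier M \<times> carrier N)" by auto
    then show ?case
      using Cons add[of "fst mn" "snd mn" "tclass K M N l"] tclass_Cons[of "fst mn" "snd mn" l M N K]
      by (simp add: tclass_closed del: lists_eq_set)
  qed
  with l(2) show ?thesis by simp
qed

lemma tensor_smult_closed:
  assumes "module K M" "module K N" "c \<in> carrier K" "x \<in> carrier (tensor K M N)"
  shows "c \<odot>\<^bsub>tensor K M N\<^esub> x \<in> carrier (tensor K M N)"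
  using assms(4)
  by (elim tensor_cases) (use assms(1-3) in \<open>simp add: smult_tclass tclass_closed map_smult_lists del: lists_eq_set\<close>)

lemma tensor_smult_zero:
  "\<lbrakk>module K M; module K N; c \<in> carrier K\<rbrakk> \<Longrightarrow> c \<odot>\<^bsub>tensor K M N\<^esub> \<zero>\<^bsub>tensor K M N\<^esub> = \<zero>\<^bsub>tensor K M N\<^esub>"
  by (simp add: zero_tensor smult_tclass)

text \<open>Supplies the induction step for scalar multiples before distributivity is known;
  combined with \<open>tensor_induct\<close> it yields the scalar axioms.\<close>

lemma tensor_smult_add_pure:
  assumes "module K M" "module K N" "c \<in> carrier K" "m \<in> carrier M" "n \<in> carrier N" "t \<in> carrier (tensor K M N)"
  shows "c \<odot>\<^bsub>tensor K M N\<^esub> (tpure K M N m n \<oplus>\<^bsub>tensor K M N\<^esub> t)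
    = tpure K M N (c \<odot>\<^bsub>M\<^esub> m) n \<oplus>\<^bsub>tensor K M N\<^esub> c \<odot>\<^bsub>tensor K M N\<^esub> t"
proof -
  obtain l where l: "l \<in> lists (carrier M \<times> carrier N)" "t = tclass K M N l"
    using assms(6) by (rule tensor_cases)
  have c: "(m, n) # l \<in> lists (carrier M \<times> carrier N)"
    "(c \<odot>\<^bsub>M\<^esub> m, n) # map (\<lambda>(m, n). (c \<odot>\<^bsub>M\<^esub> m, n)) l \<in> lists (carrier M \<times> carrier N)"
    using assms l(1) map_smult_lists[OF l(1) assms(1,3)] by auto
  show ?thesis
    using assms(1-3) l smult_tclass[OF c(1) assms(1-3)]
    by (simp add: tclass_Cons[OF c(1)] tclass_Cons[OF c(2)] smult_tclass del: lists_eq_set)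
qed

lemma tpure_add_left:
  assumes "m \<in> carrier M" "m' \<in> carrier M" "n \<in> carrier N"
  shows "tpure K M N (m \<oplus>\<^bsub>M\<^esub> m') n = tpure K M N m n \<oplus>\<^bsub>tensor K M N\<^esub> tpure K M N m' n"
  using tclass_eq[OF tensor_eq.add_left[OF assms]] assms by (simp add: tpure_def add_tclass)

lemma tpure_zero_left: "n \<in> carrier N \<Longrightarrow> tpure K M N \<zero>\<^bsub>M\<^esub> n = \<zero>\<^bsub>tensor K M N\<^esub>"
  by (simp add: tpure_def zero_tensor tclass_eq tensor_eq.zero)

lemma tensor_module [simp]:
  assumes mods: "module K M" "module K N"
  shows "module K (tensor K M N)"
proof -
  let ?T = "tensor K M N"
  interpret T: abelian_monoid ?T using mods by (rule tensor_abelian_monoid)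
  interpret M: module K M by (rule mods)
  note [simp] = tensor_smult_closed[OF mods] tensor_smult_zero[OF mods] tensor_smult_add_pure[OF mods]
  have dist: "(c \<oplus>\<^bsub>K\<^esub> d) \<odot>\<^bsub>?T\<^esub> t = c \<odot>\<^bsub>?T\<^esub> t \<oplus>\<^bsub>?T\<^esub> d \<odot>\<^bsub>?T\<^esub> t"
    if "t \<in> carrier ?T" and c: "c \<in> carrier K" "d \<in> carrier K" for c d t
    using that(1)
    by (induction rule: tensor_induct) (use c in \<open>simp_all add: M.smult_l_distr tpure_add_left T.a_assoc T.a_lcomm\<close>)
  have z: "\<zero>\<^bsub>K\<^esub> \<odot>\<^bsub>?T\<^esub> t = \<zero>\<^bsub>?T\<^esub>" if "t \<in> carrier ?T" for t
    using that by (induction rule: tensor_induct) (simp_all add: tpure_zero_left)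
  have one: "\<one>\<^bsub>K\<^esub> \<odot>\<^bsub>?T\<^esub> t = t" if "t \<in> carrier ?T" for t
    using that by (induction rule: tensor_induct) simp_all
  have "abelian_group ?T"
  proof (rule abelian_groupI)
    show "\<exists>y\<in>carrier ?T. y \<oplus>\<^bsub>?T\<^esub> x = \<zero>\<^bsub>?T\<^esub>" if x: "x \<in> carrier ?T" for x
    proof (rule bexI)
      \<comment> \<open>Formal sums have no negatives of their own. The multiple by -1 serves,
        because distributivity over scalars and the vanishing of zero multiples are already
        available.\<close>
      have "(\<ominus>\<^bsub>K\<^esub> \<one>\<^bsub>K\<^esub> \<oplus>\<^bsub>K\<^esub> \<one>\<^bsub>K\<^esub>) \<odot>\<^bsub>?T\<^esub> x = \<zero>\<^bsub>?T\<^esub>"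
        using x by (simp add: M.R.l_neg z)
      then show "(\<ominus>\<^bsub>K\<^esub> \<one>\<^bsub>K\<^esub>) \<odot>\<^bsub>?T\<^esub> x \<oplus>\<^bsub>?T\<^esub> x = \<zero>\<^bsub>?T\<^esub>"
        using x by (subst (asm) dist) (simp_all add: one)
    qed (use x in simp)
  qed (auto simp: T.a_assoc intro: T.a_comm)
  then show ?thesis
  proof (rule moduleI[OF M.R.is_cring])
    fix c d x y assume c: "c \<in> carrier K" and x: "x \<in> carrier ?T"
    show "c \<odot>\<^bsub>?T\<^esub> (x \<oplus>\<^bsub>?T\<^esub> y) = c \<odot>\<^bsub>?T\<^esub> x \<oplus>\<^bsub>?T\<^esub> c \<odot>\<^bsub>?T\<^esub> y" if y: "y \<in> carrier ?T"
      using x by (induction rule: tensor_induct) (use c y in \<open>simp_all add: T.a_assoc\<close>)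
    show "(c \<otimes>\<^bsub>K\<^esub> d) \<odot>\<^bsub>?T\<^esub> x = c \<odot>\<^bsub>?T\<^esub> (d \<odot>\<^bsub>?T\<^esub> x)" if d: "d \<in> carrier K"
      using x by (induction rule: tensor_induct) (use c d in \<open>simp_all add: M.smult_assoc1\<close>)
  qed (simp_all add: dist one)
qed

section \<open>Sums over tensors and linearity\<close>

text \<open>As a congruence rule it tells the simplifier that the summation variables occur among
  the terms of the tensor. The closure rules for terms then place them in the carriers, which
  discharges most side conditions.\<close>

lemma tsum_cong [cong]:
  "\<lbrakk>P = P'; t = t'; \<And>x y. (x, y) \<in> set (terms t') \<Longrightarrow> f x y = g x y\<rbrakk> \<Longrightarrow> tsum P t f = tsum P' t' g"
  unfolding tsum_lsum by (auto intro: lsum_cong)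

lemma tsum_closed [simp]:
  "\<lbrakk>module K P; \<And>x y. (x, y) \<in> set (terms t) \<Longrightarrow> f x y \<in> carrier P\<rbrakk> \<Longrightarrow> tsum P t f \<in> carrier P"
  by (simp add: tsum_lsum lsum_closed)

lemma tsum_swap:
  assumes "module K P"
    "\<And>x y u v. \<lbrakk>(x, y) \<in> set (terms t); (u, v) \<in> set (terms s)\<rbrakk> \<Longrightarrow> f x y u v \<in> carrier P"
  shows "tsum P t (\<lambda>x y. tsum P s (f x y)) = tsum P s (\<lambda>u v. tsum P t (\<lambda>x y. f x y u v))"
  unfolding tsum_lsum by (rule lsum_swap) (use assms in auto)

lemma mod_hom_tsum:
  assumes "g \<in> mod_hom K M P" "module K M" "module K P"
    "\<And>x y. (x, y) \<in> set (terms t) \<Longrightarrow> f x y \<in> carrier M"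
  shows "g (tsum M t f) = tsum P t (\<lambda>x y. g (f x y))"
  using assms by (simp add: tsum_lsum lsum_mod_hom[where K = K])

text \<open>Linearity in a parameter of the summand. Its companion \<open>tsum_arg_mod_hom\<close>
  treats a parameter of the tensor itself; between them, linearity of nested Sweedler sums becomes a
  matter of simplification.\<close>

lemma tsum_body_mod_hom [simp]:
  assumes "module K P" "module K X" "\<And>u v. (u, v) \<in> set (terms t) \<Longrightarrow> (\<lambda>x. f x u v) \<in> mod_hom K X P"
  shows "(\<lambda>x. tsum P t (f x)) \<in> mod_hom K X P"
proof (rule mod_homI)
  note cl = mod_hom_closed[OF assms(3)]
  show "tsum P t (f x) \<in> carrier P" if "x \<in> carrier X" for x
    using assms(1) that by (auto intro!: tsum_closed cl)
  show "tsum P t (f (x \<oplus>\<^bsub>X\<^esub> y)) = tsum P t (f x) \<oplus>\<^bsub>P\<^esub> tsum P t (f y)"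
    if "x \<in> carrier X" "y \<in> carrier X" for x y
  proof -
    have "tsum P t (f (x \<oplus>\<^bsub>X\<^esub> y)) = tsum P t (\<lambda>u v. f x u v \<oplus>\<^bsub>P\<^esub> f y u v)"
      using mod_hom_add[OF assms(3)] that by (intro tsum_cong) auto
    also have "\<dots> = tsum P t (f x) \<oplus>\<^bsub>P\<^esub> tsum P t (f y)"
      unfolding tsum_lsum by (rule lsum_add[OF assms(1)]) (use that in \<open>auto intro: cl\<close>)
    finally show ?thesis .
  qed
  show "tsum P t (f (c \<odot>\<^bsub>X\<^esub> x)) = c \<odot>\<^bsub>P\<^esub> tsum P t (f x)"
    if c: "c \<in> carrier K" and x: "x \<in> carrier X" for c x
  proof -
    have "tsum P t (f (c \<odot>\<^bsub>X\<^esub> x)) = tsum P t (\<lambda>u v. c \<odot>\<^bsub>P\<^esub> f x u v)"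
      using mod_hom_smult[OF assms(3)] c x by (intro tsum_cong) auto
    also have "\<dots> = c \<odot>\<^bsub>P\<^esub> tsum P t (f x)"
    proof (rule mod_hom_tsum[symmetric])
      interpret P: module K P by (rule assms)
      show "(\<lambda>p. c \<odot>\<^bsub>P\<^esub> p) \<in> mod_hom K P P"
        by (rule mod_homI) (use c in \<open>simp_all add: P.smult_r_distr, metis P.R.m_comm P.smult_assoc1\<close>)
    qed (use assms x in \<open>auto intro: cl\<close>)
    finally show ?thesis .
  qed
qed

text \<open>The chosen terms of a pure tensor need not be the single pair (m, n), but a bilinear
  summand cannot tell the difference.\<close>

lemma tsum_tpure:
  assumes "bilinear_map K M N P f" "m \<in> carrier M" "n \<in> carrier N" "module K M" "module K N" "module K P"
  shows "tsum P (tpure K M N m n) f = f m n"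
proof -
  interpret P: abelian_group P using assms by (simp add: module_abelian_group)
  show ?thesis
    using assms bilinear_map_closed[OF assms(1-3)] by (simp add: tsum_lsum tpure_def lsum_terms_tclass)
qed

lemma lsum_tpure:
  "l \<in> lists (carrier M \<times> carrier N) \<Longrightarrow> lsum (tensor K M N) (tpure K M N) l = tclass K M N l"
proof (induction l rule: list.induct)
  case Nil
  show ?case by (simp add: zero_tensor)
next
  case (Cons mn l)
  then show ?case by (cases mn) (simp add: tclass_Cons)
qed

lemma tsum_tpure_id:
  assumes "t \<in> carrier (tensor K M N)" "module K M" "module K N"
  shows "tsum (tensor K M N) t (tpure K M N) = t"
  unfolding tsum_lsum lsum_tpure[OF terms_lists[OF assms]] by (rule tclass_terms[OF assms(1)])

text \<open>Expand t into its chosen pure tensors and pull both maps under the sum.\<close>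

lemma tensor_hom_eqI:
  assumes "f \<in> mod_hom K (tensor K M N) P" "g \<in> mod_hom K (tensor K M N) P"
    and t: "t \<in> carrier (tensor K M N)" and mods: "module K M" "module K N" "module K P"
    and eq: "\<And>m n. \<lbrakk>m \<in> carrier M; n \<in> carrier N\<rbrakk> \<Longrightarrow> f (tpure K M N m n) = g (tpure K M N m n)"
  shows "f t = g t"
proof -
  have "f t = tsum P t (\<lambda>m n. f (tpure K M N m n))"
    using mod_hom_tsum[OF assms(1), of t "tpure K M N"] tsum_tpure_id[OF t mods(1,2)]
      terms_carrier[OF _ t mods(1,2)] mods by simp
  also have "\<dots> = tsum P t (\<lambda>m n. g (tpure K M N m n))"
    by (intro tsum_cong eq) (use terms_carrier[OF _ t mods(1,2)] in auto)
  also have "\<dots> = g t"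
    using mod_hom_tsum[OF assms(2), of t "tpure K M N"] tsum_tpure_id[OF t mods(1,2)]
      terms_carrier[OF _ t mods(1,2)] mods by simp
  finally show ?thesis .
qed

lemma tpure_bilinear:
  assumes "module K M" "module K N"
  shows "bilinear_map K M N (tensor K M N) (tpure K M N)"
proof -
  interpret T: module K "tensor K M N" using assms by simp
  have sm: "tpure K M N (c \<odot>\<^bsub>M\<^esub> m) n = c \<odot>\<^bsub>tensor K M N\<^esub> tpure K M N m n"
    if "c \<in> carrier K" "m \<in> carrier M" "n \<in> carrier N" for c m n
    using that assms by (simp add: tpure_def smult_tclass)
  have eqs: "tpure K M N m n = tclass K M N l" if "tensor_eq K M N [(m, n)] l" for m n l
    using tclass_eq[OF that] by (simp add: tpure_def)
  show ?thesis
  proof (rule bilinear_mapI; rule mod_homI)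
    show "tpure K M N m (n \<oplus>\<^bsub>N\<^esub> n') = tpure K M N m n \<oplus>\<^bsub>tensor K M N\<^esub> tpure K M N m n'"
      if "m \<in> carrier M" "n \<in> carrier N" "n' \<in> carrier N" for m n n'
      using eqs[OF tensor_eq.add_right[OF that]] that by (simp add: tpure_def add_tclass)
    show "tpure K M N (m \<oplus>\<^bsub>M\<^esub> m') n = tpure K M N m n \<oplus>\<^bsub>tensor K M N\<^esub> tpure K M N m' n"
      if "n \<in> carrier N" "m \<in> carrier M" "m' \<in> carrier M" for m m' n
      by (rule tpure_add_left) (use that in auto)
    show "tpure K M N m (c \<odot>\<^bsub>N\<^esub> n) = c \<odot>\<^bsub>tensor K M N\<^esub> tpure K M N m n"
      if "m \<in> carrier M" "c \<in> carrier K" "n \<in> carrier N" for m c n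
    proof -
      \<comment> \<open>Scalars act on the left factor by definition; the balancing relation carries
        them to the right one.\<close>
      have "tpure K M N (c \<odot>\<^bsub>M\<^esub> m) n = tpure K M N m (c \<odot>\<^bsub>N\<^esub> n)"
        using eqs[OF tensor_eq.smult[OF that(2,1,3)]] by (simp add: tpure_def)
      with sm that show ?thesis by simp
    qed
  qed (simp_all add: sm)
qed

lemma mod_hom_compose:
  "\<lbrakk>g \<in> mod_hom K N P; f \<in> mod_hom K M N\<rbrakk> \<Longrightarrow> (\<lambda>x. g (f x)) \<in> mod_hom K M P"
  by (auto simp: mod_hom_def Pi_iff)

lemma mod_hom_id [simp]: "(\<lambda>x. x) \<in> mod_hom K M M"
  by (simp add: mod_hom_def)

lemma tpure_mod_hom_right [simp]:
  assumes "module K M" "module K N" "m \<in> carrier M"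
  shows "tpure K M N m \<in> mod_hom K N (tensor K M N)"
    and "f \<in> mod_hom K X N \<Longrightarrow> (\<lambda>x. tpure K M N m (f x)) \<in> mod_hom K X (tensor K M N)"
  using bilinear_mapD(1)[OF tpure_bilinear[OF assms(1,2)] assms(3)] by (auto intro: mod_hom_compose)

lemma tpure_mod_hom_left [simp]:
  assumes "module K M" "module K N" "n \<in> carrier N" "f \<in> mod_hom K X M"
  shows "(\<lambda>x. tpure K M N (f x) n) \<in> mod_hom K X (tensor K M N)"
  using mod_hom_compose[OF bilinear_mapD(2)[OF tpure_bilinear[OF assms(1,2)] assms(3)] assms(4)] .

text \<open>\<open>terms\<close> is not additive: the terms of a sum are merely equivalent to the
  concatenated terms. \<open>lsum_terms_tclass\<close> absorbs the difference, and likewise for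
  scalar multiples.\<close>

lemma tsum_mod_hom:
  assumes b: "bilinear_map K M N P f" and mods: "module K M" "module K N" "module K P"
  shows "(\<lambda>t. tsum P t f) \<in> mod_hom K (tensor K M N) P"
proof (rule mod_homI)
  let ?T = "tensor K M N"
  note cl = bilinear_map_closed[OF b]
  interpret P: module K P by (rule mods)
  show "tsum P t f \<in> carrier P" if "t \<in> carrier ?T" for t
    using terms_carrier[OF _ that mods(1,2)] mods by (auto intro!: tsum_closed cl)
  show "tsum P (t \<oplus>\<^bsub>?T\<^esub> s) f = tsum P t f \<oplus>\<^bsub>P\<^esub> tsum P s f"
    if t: "t \<in> carrier ?T" and s: "s \<in> carrier ?T" for t s
  proof -
    note l = terms_lists[OF t mods(1,2)] terms_lists[OF s mods(1,2)]
    have "t \<oplus>\<^bsub>?T\<^esub> s = tclass K M N (terms t @ terms s)"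
      using add_tclass[OF l, of K] by (simp add: tclass_terms[OF t] tclass_terms[OF s])
    then have "tsum P (t \<oplus>\<^bsub>?T\<^esub> s) f = lsum P f (terms t @ terms s)"
      using l by (simp add: tsum_lsum lsum_terms_tclass[OF _ mods b])
    also have "\<dots> = tsum P t f \<oplus>\<^bsub>P\<^esub> tsum P s f"
      unfolding tsum_lsum by (rule lsum_append[OF mods(3)]) (use l in \<open>auto intro!: cl\<close>)
    finally show ?thesis .
  qed
  show "tsum P (c \<odot>\<^bsub>?T\<^esub> t) f = c \<odot>\<^bsub>P\<^esub> tsum P t f"
    if c: "c \<in> carrier K" and t: "t \<in> carrier ?T" for c t
  proof -
    note l = terms_lists[OF t mods(1,2)]
    have "tsum P (c \<odot>\<^bsub>?T\<^esub> t) f = lsum P f (map (\<lambda>(m, n). (c \<odot>\<^bsub>M\<^esub> m, n)) (terms t))"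
      using smult_tclass[OF l mods(1,2) c] lsum_terms_tclass[OF map_smult_lists[OF l mods(1) c] mods b]
      by (simp add: tsum_lsum tclass_terms[OF t])
    also have "\<dots> = lsum P (\<lambda>m n. f (c \<odot>\<^bsub>M\<^esub> m) n) (terms t)"
      by (simp add: lsum_def foldr_map comp_def case_prod_unfold)
    also have "\<dots> = lsum P (\<lambda>m n. c \<odot>\<^bsub>P\<^esub> f m n) (terms t)"
      using l mod_hom_smult[OF bilinear_mapD(2)[OF b]] c by (intro lsum_cong) auto
    also have "\<dots> = c \<odot>\<^bsub>P\<^esub> tsum P t f"
      unfolding tsum_lsum
    proof (rule lsum_mod_hom[symmetric])
      show "(\<lambda>p. c \<odot>\<^bsub>P\<^esub> p) \<in> mod_hom K P P"
        by (rule mod_homI) (use c in \<open>simp_all add: P.smult_r_distr, metis P.R.m_comm P.smult_assoc1\<close>)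
    qed (use l mods in \<open>auto intro!: cl\<close>)
    finally show ?thesis .
  qed
qed

lemma tsum_arg_mod_hom:
  assumes "g \<in> mod_hom K X (tensor K M N)" "bilinear_map K M N P f"
    "module K M" "module K N" "module K P"
  shows "(\<lambda>x. tsum P (g x) f) \<in> mod_hom K X P"
  using mod_hom_compose[OF tsum_mod_hom[OF assms(2-5)] assms(1)] .

text \<open>Flattens one Sweedler expression substituted into another; with
  \<open>tsum_tpure\<close> it evaluates a bilinear expression at a sum of pure tensors.\<close>

lemma tsum_tsum:
  assumes "bilinear_map K M N P f" "module K M" "module K N" "module K P"
    "\<And>x y. (x, y) \<in> set (terms t) \<Longrightarrow> g x y \<in> carrier (tensor K M N)"
  shows "tsum P (tsum (tensor K M N) t g) f = tsum P t (\<lambda>x y. tsum P (g x y) f)"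
  by (rule mod_hom_tsum[OF tsum_mod_hom[OF assms(1-4)]]) (use assms in auto)

text \<open>Factors a trilinear expression through A \<otimes> (B \<otimes> C), so that an equation
  in that space can be read under the expression.\<close>

lemma bilinear_map_trilinear:
  assumes "trilinear_map K A B C P f" "module K A" "module K B" "module K C" "module K P"
  shows "bilinear_map K A (tensor K B C) P (\<lambda>a s. tsum P s (f a))"
proof (rule bilinear_mapI)
  show "(\<lambda>s. tsum P s (f a)) \<in> mod_hom K (tensor K B C) P" if "a \<in> carrier A" for a
    using assms that by (auto simp: trilinear_map_def intro: tsum_mod_hom)
  show "(\<lambda>a. tsum P s (f a)) \<in> mod_hom K A P" if s: "s \<in> carrier (tensor K B C)" for s
    using assms terms_carrier[OF _ s assms(3,4)]
    by (auto simp: trilinear_map_def intro!: tsum_body_mod_hom)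
qed

text \<open>
  Objects with an action and a coaction are records extending a module, and the tensor product
  depends only on that module: this lets the simplifier discard the additional fields.
\<close>

definition same_module where
  "same_module M M' \<longleftrightarrow> carrier M = carrier M' \<and> (\<otimes>\<^bsub>M\<^esub>) = (\<otimes>\<^bsub>M'\<^esub>) \<and> \<one>\<^bsub>M\<^esub> = \<one>\<^bsub>M'\<^esub>
     \<and> \<zero>\<^bsub>M\<^esub> = \<zero>\<^bsub>M'\<^esub> \<and> (\<oplus>\<^bsub>M\<^esub>) = (\<oplus>\<^bsub>M'\<^esub>) \<and> (\<odot>\<^bsub>M\<^esub>) = (\<odot>\<^bsub>M'\<^esub>)"

lemma same_module_refl [simp]: "same_module M M"
  by (simp add: same_module_def)

lemma same_module_sym: "same_module M M' \<Longrightarrow> same_module M' M"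
  by (simp add: same_module_def)

lemma tensor_eq_same:
  assumes "tensor_eq K M N l l'" "same_module M M'" "same_module N N'"
  shows "tensor_eq K M' N' l l'"
  using assms(1)
proof induction
  case (sym l l')
  show ?case by (rule tensor_eq.sym[OF sym.IH])
next
  case (trans l l' l'')
  show ?case by (rule tensor_eq.trans[OF trans.IH])
qed (use assms(2,3) in \<open>auto simp: same_module_def intro: tensor_eq.intros\<close>)

lemma tclass_same:
  assumes "same_module M M'" "same_module N N'"
  shows "tclass K M N = tclass K M' N'"
proof -
  have "tensor_eq K M N = tensor_eq K M' N'"
    by (intro ext iffI; erule tensor_eq_same; simp add: assms same_module_sym)
  then show ?thesis by (simp add: tclass_def fun_eq_iff)
qed

lemma tensor_same:
  assumes "same_module M M'" "same_module N N'"
  shows "tensor K M N = tensor K M' N'" "tpure K M N = tpure K M' N'"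
  using assms tclass_same[OF assms, of K]
  by (simp_all add: tensor_def tpure_def same_module_def fun_eq_iff)

lemma mod_hom_same:
  assumes "same_module M M'" "same_module N N'"
  shows "mod_hom K M N = mod_hom K M' N'"
  using assms by (simp add: mod_hom_def same_module_def)

lemma tsum_same: "same_module M M' \<Longrightarrow> tsum M t f = tsum M' t f"
  by (simp add: tsum_def same_module_def)

lemma bilinear_map_same:
  assumes "same_module M M'" "same_module N N'" "same_module P P'"
  shows "bilinear_map K M N P = bilinear_map K M' N' P'"
  using assms(1,2)
  unfolding bilinear_map_def fun_eq_iff mod_hom_same[OF assms(2,3)] mod_hom_same[OF assms(1,3)]
  by (simp add: same_module_def)

text \<open>The two records may have different types, so they cannot be equated and the module
  axioms are transported one by one.\<close>

lemma module_same:
  assumes "same_module M M'" "module K M"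
  shows "module K M'"
proof -
  interpret M: module K M by (rule assms)
  note eqs = assms(1)[unfolded same_module_def, THEN conjunct1, symmetric]
    assms(1)[unfolded same_module_def, THEN conjunct2, THEN conjunct2, THEN conjunct2, THEN conjunct1, symmetric]
    assms(1)[unfolded same_module_def, THEN conjunct2, THEN conjunct2, THEN conjunct2, THEN conjunct2, THEN conjunct1, symmetric]
    assms(1)[unfolded same_module_def, THEN conjunct2, THEN conjunct2, THEN conjunct2, THEN conjunct2, THEN conjunct2, symmetric]
  have "abelian_group M'"
  proof (rule abelian_groupI)
    show "\<exists>y\<in>carrier M'. y \<oplus>\<^bsub>M'\<^esub> x = \<zero>\<^bsub>M'\<^esub>" if "x \<in> carrier M'" for x
      using that by (intro bexI[of _ "\<ominus>\<^bsub>M\<^esub> x"]) (simp_all add: eqs M.M.l_neg)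
  qed (auto simp: eqs M.M.a_ac)
  then show ?thesis
    by (rule moduleI[OF M.R.is_cring])
      (auto simp: eqs M.smult_l_distr M.smult_r_distr M.smult_assoc1)
qed

section \<open>Sweedler calculus in a Hopf algebra\<close>

lemma trilinear_map_closed:
  "\<lbrakk>trilinear_map K A B C P f; a \<in> carrier A; b \<in> carrier B; c \<in> carrier C\<rbrakk> \<Longrightarrow> f a b c \<in> carrier P"
  by (auto simp: trilinear_map_def intro: bilinear_map_closed)

lemma lsum_map: "lsum P f (map (\<lambda>(x, y). (g x y, h x y)) l) = lsum P (\<lambda>x y. f (g x y) (h x y)) l"
  by (induction l) auto

text \<open>Reads the list comprehension that defines the product in \<open>tensor\<close> as a
  double sum.\<close>

lemma lsum_product:
  assumes P: "module K P"
    and "\<And>a b c d. \<lbrakk>(a, b) \<in> set l; (c, d) \<in> set l'\<rbrakk> \<Longrightarrow> f (p a b c d) (q a b c d) \<in> carrier P"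
  shows "lsum P f [(p a b c d, q a b c d). (a, b) \<leftarrow> l, (c, d) \<leftarrow> l']
    = lsum P (\<lambda>a b. lsum P (\<lambda>c d. f (p a b c d) (q a b c d)) l') l"
  using assms(2)
proof (induction l)
  case (Cons ab l)
  obtain a b where ab: "ab = (a, b)" by force
  have IH: "lsum P f [(p a b c d, q a b c d). (a, b) \<leftarrow> l, (c, d) \<leftarrow> l']
    = lsum P (\<lambda>a b. lsum P (\<lambda>c d. f (p a b c d) (q a b c d)) l') l"
    by (rule Cons.IH) (use Cons.prems in auto)
  have "lsum P f (map (\<lambda>(c, d). (p a b c d, q a b c d)) l' @ [(p a b c d, q a b c d). (a, b) \<leftarrow> l, (c, d) \<leftarrow> l'])
    = lsum P f (map (\<lambda>(c, d). (p a b c d, q a b c d)) l')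
      \<oplus>\<^bsub>P\<^esub> lsum P f [(p a b c d, q a b c d). (a, b) \<leftarrow> l, (c, d) \<leftarrow> l']"
    by (rule lsum_append[OF P]) (use Cons.prems ab in auto)
  then show ?case using IH by (simp add: ab lsum_map)
qed simp

context hopf_algebra
begin

abbreviation "A \<equiv> hopf_aut K H"
abbreviation "HH \<equiv> tensor K H H"

section \<open>Linearity of the structure maps of H\<close>

lemma H_module [simp]: "module K H" ..

lemmas tsum_carrier [simp] = tsum_closed[where K = K]

lemma comult_closed [simp]: "h \<in> carrier H \<Longrightarrow> comult H h \<in> carrier HH"
  using comult_linear by (rule mod_hom_closed)

lemma comult_terms [simp]:
  "\<lbrakk>(x, y) \<in> set (terms (comult H h)); h \<in> carrier H\<rbrakk> \<Longrightarrow> x \<in> carrier H"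
  "\<lbrakk>(x, y) \<in> set (terms (comult H h)); h \<in> carrier H\<rbrakk> \<Longrightarrow> y \<in> carrier H"
  by (meson terms_carrier comult_closed H_module)+

lemma antipode_closed [simp]: "h \<in> carrier H \<Longrightarrow> antipode H h \<in> carrier H"
  using antipode_linear by (rule mod_hom_closed)

lemma antipode_mod_hom [simp]:
  "antipode H \<in> mod_hom K H H"
  "f \<in> mod_hom K X H \<Longrightarrow> (\<lambda>x. antipode H (f x)) \<in> mod_hom K X H"
  using antipode_linear mod_hom_compose by auto

lemma counit_closed [simp]: "h \<in> carrier H \<Longrightarrow> counit H h \<in> carrier K"
  using counit_ring_hom by (rule ring_hom_closed)

lemma counit_mult [simp]:
  "\<lbrakk>g \<in> carrier H; h \<in> carrier H\<rbrakk> \<Longrightarrow> counit H (g \<otimes>\<^bsub>H\<^esub> h) = counit H g \<otimes>\<^bsub>K\<^esub> counit H h"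
  using counit_ring_hom by (rule ring_hom_mult)

lemma counit_one [simp]: "counit H \<one>\<^bsub>H\<^esub> = \<one>\<^bsub>K\<^esub>"
  using counit_ring_hom by (rule ring_hom_one)

lemma mult_mod_hom [simp]:
  "h \<in> carrier H \<Longrightarrow> (\<otimes>\<^bsub>H\<^esub>) h \<in> mod_hom K H H"
  "\<lbrakk>h \<in> carrier H; f \<in> mod_hom K X H\<rbrakk> \<Longrightarrow> (\<lambda>x. h \<otimes>\<^bsub>H\<^esub> f x) \<in> mod_hom K X H"
  "\<lbrakk>h \<in> carrier H; f \<in> mod_hom K X H\<rbrakk> \<Longrightarrow> (\<lambda>x. f x \<otimes>\<^bsub>H\<^esub> h) \<in> mod_hom K X H"
proof -
  show l: "(\<otimes>\<^bsub>H\<^esub>) h \<in> mod_hom K H H" if "h \<in> carrier H" for h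
    using that by (intro mod_homI) (auto simp: H.r_distr smult_mult_right)
  have r: "(\<lambda>x. x \<otimes>\<^bsub>H\<^esub> h) \<in> mod_hom K H H" if "h \<in> carrier H" for h
    using that by (intro mod_homI) (auto simp: H.l_distr smult_mult_left)
  show "\<lbrakk>h \<in> carrier H; f \<in> mod_hom K X H\<rbrakk> \<Longrightarrow> (\<lambda>x. h \<otimes>\<^bsub>H\<^esub> f x) \<in> mod_hom K X H"
    "\<lbrakk>h \<in> carrier H; f \<in> mod_hom K X H\<rbrakk> \<Longrightarrow> (\<lambda>x. f x \<otimes>\<^bsub>H\<^esub> h) \<in> mod_hom K X H"
    using mod_hom_compose[OF l] mod_hom_compose[OF r] by auto
qed

lemma smult_mod_hom [simp]:
  assumes "module K M"
  shows "c \<in> carrier K \<Longrightarrow> f \<in> mod_hom K X M \<Longrightarrow> (\<lambda>x. c \<odot>\<^bsub>M\<^esub> f x) \<in> mod_hom K X M"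
proof -
  interpret M: module K M by (rule assms)
  show "c \<in> carrier K \<Longrightarrow> f \<in> mod_hom K X M \<Longrightarrow> (\<lambda>x. c \<odot>\<^bsub>M\<^esub> f x) \<in> mod_hom K X M"
    by (intro mod_homI) (auto simp: mod_hom_closed mod_hom_add mod_hom_smult M.smult_r_distr,
        metis R.m_comm M.smult_assoc1 mod_hom_closed)
qed

lemma counit_smult_mod_hom [simp]:
  assumes "module K M" "m \<in> carrier M" "f \<in> mod_hom K X H"
  shows "(\<lambda>x. counit H (f x) \<odot>\<^bsub>M\<^esub> m) \<in> mod_hom K X M"
proof -
  interpret M: module K M by (rule assms)
  show ?thesis
    using assms(2,3) ring_hom_add[OF counit_ring_hom]
    by (intro mod_homI)
      (auto simp: mod_hom_closed mod_hom_add mod_hom_smult M.smult_l_distr counit_linear M.smult_assoc1)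
qed

lemma tsum_comult_mod_hom [simp]:
  assumes "bilinear_map K H H P f" "module K P"
  shows "(\<lambda>x. tsum P (comult H x) f) \<in> mod_hom K H P"
    and "g \<in> mod_hom K X H \<Longrightarrow> (\<lambda>x. tsum P (comult H (g x)) f) \<in> mod_hom K X P"
  using assms mod_hom_compose[OF comult_linear]
  by (auto intro!: tsum_arg_mod_hom[where M = H and N = H] comult_linear)

text \<open>Multiplicativity of the comultiplication in Sweedler form: the product in H \<otimes> H
  is computed on representatives, and the bilinear f forgets which ones were used.\<close>

lemma comult_mult:
  assumes "bilinear_map K H H P f" "module K P" "g \<in> carrier H" "h \<in> carrier H"
  shows "tsum P (comult H (g \<otimes>\<^bsub>H\<^esub> h)) f
    = tsum P (comult H g) (\<lambda>a b. tsum P (comult H h) (\<lambda>c d. f (a \<otimes>\<^bsub>H\<^esub> c) (b \<otimes>\<^bsub>H\<^esub> d)))"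
proof -
  let ?l = "[(a \<otimes>\<^bsub>H\<^esub> c, b \<otimes>\<^bsub>H\<^esub> d). (a, b) \<leftarrow> terms (comult H g), (c, d) \<leftarrow> terms (comult H h)]"
  have l: "?l \<in> lists (carrier H \<times> carrier H)"
    using comult_terms assms(3,4) by fastforce
  have "comult H (g \<otimes>\<^bsub>H\<^esub> h) = tclass K H H ?l"
    using ring_hom_mult[OF comult_ring_hom assms(3,4)] by (simp add: tensor_def)
  then have "tsum P (comult H (g \<otimes>\<^bsub>H\<^esub> h)) f = lsum P f ?l"
    using l by (simp add: tsum_lsum lsum_terms_tclass[OF _ _ _ assms(2,1)])
  also have "\<dots> = tsum P (comult H g) (\<lambda>a b. tsum P (comult H h) (\<lambda>c d. f (a \<otimes>\<^bsub>H\<^esub> c) (b \<otimes>\<^bsub>H\<^esub> d)))"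
    unfolding tsum_lsum
    by (rule lsum_product[OF assms(2)]) (use assms(3,4) in \<open>auto intro!: bilinear_map_closed[OF assms(1)]\<close>)
  finally show ?thesis .
qed

lemma comult_one: "comult H \<one>\<^bsub>H\<^esub> = tpure K H H \<one>\<^bsub>H\<^esub> \<one>\<^bsub>H\<^esub>"
  using ring_hom_one[OF comult_ring_hom] by (simp add: tensor_def)

lemma tsum_comult_one:
  assumes "bilinear_map K H H P f" "module K P"
  shows "tsum P (comult H \<one>\<^bsub>H\<^esub>) f = f \<one>\<^bsub>H\<^esub> \<one>\<^bsub>H\<^esub>"
  using assms by (simp add: comult_one tsum_tpure)

text \<open>The linear map on H \<otimes> (H \<otimes> H) induced by f is applied to both sides of
  the coassociativity axiom.\<close>

lemma comult_coassoc:
  assumes f: "trilinear_map K H H H P f" and P: "module K P" and h: "h \<in> carrier H"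
  shows "tsum P (comult H h) (\<lambda>x y. tsum P (comult H x) (\<lambda>x1 x2. f x1 x2 y))
    = tsum P (comult H h) (\<lambda>x y. tsum P (comult H y) (f x))"
proof -
  let ?T = "tensor K H HH"
  let ?g = "\<lambda>t. tsum P t (\<lambda>a s. tsum P s (f a))"
  note b = bilinear_map_trilinear[OF f H_module H_module H_module P]
  have bf: "bilinear_map K H H P (f a)" if "a \<in> carrier H" for a
    using f that by (simp add: trilinear_map_def)
  have "?g (tsum ?T (comult H h) (\<lambda>x y. tsum ?T (comult H x) (\<lambda>x1 x2. tpure K H HH x1 (tpure K H H x2 y))))
    = ?g (tsum ?T (comult H h) (\<lambda>x y. tpure K H HH x (comult H y)))"
    using coassoc[OF h] by simp
  then show ?thesis
    using h P by (simp add: tsum_tsum[OF b] tsum_tpure[OF b] tsum_tpure[OF bf])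
qed

section \<open>Counit and antipode axioms under a linear map\<close>

lemma counit_left_mod_hom:
  assumes "F \<in> mod_hom K H P" "module K P" "h \<in> carrier H"
  shows "tsum P (comult H h) (\<lambda>x y. counit H x \<odot>\<^bsub>P\<^esub> F y) = F h"
proof -
  have "F (tsum H (comult H h) (\<lambda>x y. counit H x \<odot>\<^bsub>H\<^esub> y)) = F h"
    using counit_left[OF assms(3)] by simp
  then show ?thesis
    using assms by (simp add: mod_hom_tsum[OF assms(1)] mod_hom_smult[OF assms(1)])
qed

lemma counit_right_mod_hom:
  assumes "F \<in> mod_hom K H P" "module K P" "h \<in> carrier H"
  shows "tsum P (comult H h) (\<lambda>x y. counit H y \<odot>\<^bsub>P\<^esub> F x) = F h"
proof -
  have "F (tsum H (comult H h) (\<lambda>x y. counit H y \<odot>\<^bsub>H\<^esub> x)) = F h"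
    using counit_right[OF assms(3)] by simp
  then show ?thesis
    using assms by (simp add: mod_hom_tsum[OF assms(1)] mod_hom_smult[OF assms(1)])
qed

lemma antipode_left_mod_hom:
  assumes "F \<in> mod_hom K H P" "module K P" "h \<in> carrier H"
  shows "tsum P (comult H h) (\<lambda>x y. F (antipode H x \<otimes>\<^bsub>H\<^esub> y)) = counit H h \<odot>\<^bsub>P\<^esub> F \<one>\<^bsub>H\<^esub>"
proof -
  have "F (tsum H (comult H h) (\<lambda>x y. antipode H x \<otimes>\<^bsub>H\<^esub> y)) = F (counit H h \<odot>\<^bsub>H\<^esub> \<one>\<^bsub>H\<^esub>)"
    using antipode_left[OF assms(3)] by simp
  then show ?thesis
    using assms by (simp add: mod_hom_tsum[OF assms(1)] mod_hom_smult[OF assms(1)])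
qed

lemma antipode_right_mod_hom:
  assumes "F \<in> mod_hom K H P" "module K P" "h \<in> carrier H"
  shows "tsum P (comult H h) (\<lambda>x y. F (x \<otimes>\<^bsub>H\<^esub> antipode H y)) = counit H h \<odot>\<^bsub>P\<^esub> F \<one>\<^bsub>H\<^esub>"
proof -
  have "F (tsum H (comult H h) (\<lambda>x y. x \<otimes>\<^bsub>H\<^esub> antipode H y)) = F (counit H h \<odot>\<^bsub>H\<^esub> \<one>\<^bsub>H\<^esub>)"
    using antipode_right[OF assms(3)] by simp
  then show ?thesis
    using assms by (simp add: mod_hom_tsum[OF assms(1)] mod_hom_smult[OF assms(1)])
qed

section \<open>The group of Hopf automorphisms\<close>

lemma aut_carrier:
  "\<alpha> \<in> carrier A \<longleftrightarrow> \<alpha> \<in> Bij (carrier H) \<and> \<alpha> \<in> ring_hom H H \<and> \<alpha> \<in> mod_hom K H H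
    \<and> (\<forall>h\<in>carrier H. comult H (\<alpha> h) = tsum HH (comult H h) (\<lambda>x y. tpure K H H (\<alpha> x) (\<alpha> y))
       \<and> counit H (\<alpha> h) = counit H h \<and> antipode H (\<alpha> h) = \<alpha> (antipode H h))"
  by (auto simp: hopf_aut_def)

lemma aut_rules:
  assumes "\<alpha> \<in> carrier A"
  shows "x \<in> carrier H \<Longrightarrow> \<alpha> x \<in> carrier H"
    and "\<alpha> \<in> mod_hom K H H"
    and "f \<in> mod_hom K X H \<Longrightarrow> (\<lambda>x. \<alpha> (f x)) \<in> mod_hom K X H"
    and "\<lbrakk>x \<in> carrier H; y \<in> carrier H\<rbrakk> \<Longrightarrow> \<alpha> (x \<otimes>\<^bsub>H\<^esub> y) = \<alpha> x \<otimes>\<^bsub>H\<^esub> \<alpha> y"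
    and "\<alpha> \<one>\<^bsub>H\<^esub> = \<one>\<^bsub>H\<^esub>"
    and "x \<in> carrier H \<Longrightarrow> counit H (\<alpha> x) = counit H x"
    and "x \<in> carrier H \<Longrightarrow> antipode H (\<alpha> x) = \<alpha> (antipode H x)"
  using assms mod_hom_compose
  by (auto simp: aut_carrier ring_hom_mult ring_hom_one mod_hom_closed)

lemma comult_aut:
  assumes a: "\<alpha> \<in> carrier A" and "x \<in> carrier H" "module K P" and b: "bilinear_map K H H P f"
  shows "tsum P (comult H (\<alpha> x)) f = tsum P (comult H x) (\<lambda>x y. f (\<alpha> x) (\<alpha> y))"
proof -
  note [simp] = aut_rules[OF a]
  have "comult H (\<alpha> x) = tsum HH (comult H x) (\<lambda>x y. tpure K H H (\<alpha> x) (\<alpha> y))"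
    using a assms(2) by (simp add: aut_carrier)
  then show ?thesis
    using assms by (simp add: tsum_tsum[OF b] tsum_tpure[OF b])
qed

lemma aut_mult_apply:
  assumes "\<alpha> \<in> carrier A" "\<beta> \<in> carrier A" "h \<in> carrier H"
  shows "(\<alpha> \<otimes>\<^bsub>A\<^esub> \<beta>) h = \<alpha> (\<beta> h)"
  using assms by (simp add: hopf_aut_def BijGroup_def compose_def)

lemma aut_one_apply: "h \<in> carrier H \<Longrightarrow> \<one>\<^bsub>A\<^esub> h = h"
  by (simp add: hopf_aut_def BijGroup_def)

text \<open>For the inverse map, additivity, homogeneity, multiplicativity and the antipode
  condition are checked after applying the injective \<alpha>. The condition on the
  comultiplication, an identity in H \<otimes> H, needs an argument of its own.\<close>

lemma aut_subgroup: "subgroup (carrier A) (BijGroup (carrier H))"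
proof (rule subgroup.intro)
  show "carrier A \<subseteq> carrier (BijGroup (carrier H))"
    by (auto simp: aut_carrier BijGroup_def)
  show "\<one>\<^bsub>BijGroup (carrier H)\<^esub> \<in> carrier A"
    by (auto simp: aut_carrier BijGroup_def id_Bij ring_hom_def mod_hom_def tsum_tpure_id
        cong: restrict_cong)
next
  fix \<alpha> \<beta> assume a: "\<alpha> \<in> carrier A" and b: "\<beta> \<in> carrier A"
  note [simp] = aut_rules[OF a] aut_rules[OF b]
  have bij: "\<alpha> \<in> Bij (carrier H)" "\<beta> \<in> Bij (carrier H)"
    using a b by (auto simp: aut_carrier)
  have eq: "\<alpha> \<otimes>\<^bsub>BijGroup (carrier H)\<^esub> \<beta> = compose (carrier H) \<alpha> \<beta>"
    using bij by (simp add: BijGroup_def)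
  have "comult H (\<alpha> (\<beta> h)) = tsum HH (comult H h) (\<lambda>x y. tpure K H H (\<alpha> (\<beta> x)) (\<alpha> (\<beta> y)))"
    if h: "h \<in> carrier H" for h
  proof -
    have "comult H (\<alpha> (\<beta> h)) = tsum HH (comult H (\<beta> h)) (\<lambda>x y. tpure K H H (\<alpha> x) (\<alpha> y))"
      using a h by (simp add: aut_carrier)
    also have "\<dots> = tsum HH (comult H h) (\<lambda>x y. tpure K H H (\<alpha> (\<beta> x)) (\<alpha> (\<beta> y)))"
      using h by (intro comult_aut[OF b]) (auto intro!: bilinear_mapI)
    finally show ?thesis .
  qed
  moreover have "compose (carrier H) \<alpha> \<beta> \<in> ring_hom H H" "compose (carrier H) \<alpha> \<beta> \<in> mod_hom K H H"
    using a b by (auto simp: aut_carrier ring_hom_def mod_hom_def compose_def Pi_iff)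
  ultimately show "\<alpha> \<otimes>\<^bsub>BijGroup (carrier H)\<^esub> \<beta> \<in> carrier A"
    unfolding eq using bij by (simp add: aut_carrier compose_Bij) (simp add: compose_def)
next
  fix \<alpha> assume a: "\<alpha> \<in> carrier A"
  note [simp] = aut_rules[OF a]
  have bij: "\<alpha> \<in> Bij (carrier H)"
    using a by (auto simp: aut_carrier)
  \<comment> \<open>Restricted to the carrier because members of \<open>Bij\<close> are
    extensional.\<close>
  define \<beta> where "\<beta> = restrict (inv_into (carrier H) \<alpha>) (carrier H)"
  have \<beta>: "inv\<^bsub>BijGroup (carrier H)\<^esub> \<alpha> = \<beta>"
    using bij by (simp add: \<beta>_def inv_BijGroup restrict_def)
  have bb: "bij_betw \<alpha> (carrier H) (carrier H)" using bij by (simp add: Bij_def)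
  have cl [simp]: "\<beta> h \<in> carrier H" and i1 [simp]: "\<alpha> (\<beta> h) = h" and i2 [simp]: "\<beta> (\<alpha> h) = h"
    if "h \<in> carrier H" for h
    using that bb by (auto simp: \<beta>_def bij_betw_def inv_into_into f_inv_into_f)
  have inj: "x = y" if "\<alpha> x = \<alpha> y" "x \<in> carrier H" "y \<in> carrier H" for x y
    using that i2 by metis
  have l: "\<beta> \<in> mod_hom K H H"
  proof (rule mod_homI)
    show "\<beta> (x \<oplus>\<^bsub>H\<^esub> y) = \<beta> x \<oplus>\<^bsub>H\<^esub> \<beta> y" if "x \<in> carrier H" "y \<in> carrier H" for x y
      by (rule inj) (use that in \<open>simp_all add: mod_hom_add[OF aut_rules(2)[OF a]]\<close>)
    show "\<beta> (c \<odot>\<^bsub>H\<^esub> x) = c \<odot>\<^bsub>H\<^esub> \<beta> x" if "c \<in> carrier K" "x \<in> carrier H" for c x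
      by (rule inj) (use that in \<open>simp_all add: mod_hom_smult[OF aut_rules(2)[OF a]]\<close>)
  qed simp
  have r: "\<beta> \<in> ring_hom H H"
  proof (rule ring_hom_memI)
    show "\<beta> (x \<otimes>\<^bsub>H\<^esub> y) = \<beta> x \<otimes>\<^bsub>H\<^esub> \<beta> y" if "x \<in> carrier H" "y \<in> carrier H" for x y
      by (rule inj) (use that in simp_all)
    show "\<beta> \<one>\<^bsub>H\<^esub> = \<one>\<^bsub>H\<^esub>" by (rule inj) simp_all
  qed (simp_all add: mod_hom_add[OF l])
  have "comult H (\<beta> h) = tsum HH (comult H h) (\<lambda>x y. tpure K H H (\<beta> x) (\<beta> y))"
    if h: "h \<in> carrier H" for h
  proof -
    have [simp]: "(\<lambda>x. \<beta> (f x)) \<in> mod_hom K X H" if "f \<in> mod_hom K X H" for f and X :: "('k, 'a, 'b) module_scheme"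
      using mod_hom_compose[OF l that] .
    \<comment> \<open>Replace h by \<alpha>(\<beta> h). As \<alpha> is a coalgebra map, the legs
      become \<beta>(\<alpha> x) and \<beta>(\<alpha> y), where the two maps cancel.\<close>
    have "tsum HH (comult H h) (\<lambda>x y. tpure K H H (\<beta> x) (\<beta> y))
        = tsum HH (comult H (\<alpha> (\<beta> h))) (\<lambda>x y. tpure K H H (\<beta> x) (\<beta> y))"
      using h by simp
    also have "\<dots> = tsum HH (comult H (\<beta> h)) (\<lambda>x y. tpure K H H (\<beta> (\<alpha> x)) (\<beta> (\<alpha> y)))"
      using h l by (intro comult_aut[OF a]) (auto intro!: bilinear_mapI)
    also have "\<dots> = comult H (\<beta> h)"
      using h by (simp add: tsum_tpure_id)
    finally show ?thesis ..
  qed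
  moreover have "counit H (\<beta> h) = counit H h" if "h \<in> carrier H" for h
    using that aut_rules(6)[OF a, of "\<beta> h"] by simp
  moreover have "antipode H (\<beta> h) = \<beta> (antipode H h)" if "h \<in> carrier H" for h
    by (rule inj) (use that in \<open>simp_all flip: aut_rules(7)[OF a]\<close>)
  ultimately show "inv\<^bsub>BijGroup (carrier H)\<^esub> \<alpha> \<in> carrier A"
    using l r bij by (simp add: \<beta> aut_carrier) (simp add: \<beta>_def restrict_inv_into_Bij)
qed

lemma aut_group: "group A"
  using subgroup.subgroup_is_group[OF aut_subgroup group_BijGroup]
  by (simp add: hopf_aut_def)

lemma aut_inv_apply:
  assumes "\<alpha> \<in> carrier A" "h \<in> carrier H"
  shows "(inv\<^bsub>A\<^esub> \<alpha>) (\<alpha> h) = h" "\<alpha> ((inv\<^bsub>A\<^esub> \<alpha>) h) = h"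
proof -
  interpret A: group A by (rule aut_group)
  show "(inv\<^bsub>A\<^esub> \<alpha>) (\<alpha> h) = h" "\<alpha> ((inv\<^bsub>A\<^esub> \<alpha>) h) = h"
    by (metis A.inv_closed A.l_inv A.r_inv assms aut_mult_apply aut_one_apply)+
qed

section \<open>Modules, comodules and the tensor product object\<close>

lemmas module_carrier [simp] =
  module_add_closed[where K = K] module_zero_closed[where K = K] module_smult_closed[where K = K]

lemma left_module_module [simp]: "left_module K H M \<Longrightarrow> module K M"
  unfolding left_module_def by blast

lemma act_closed [simp]:
  "\<lbrakk>left_module K H M; h \<in> carrier H; m \<in> carrier M\<rbrakk> \<Longrightarrow> act M h m \<in> carrier M"
  unfolding left_module_def by blast

lemma act_mod_hom [simp]:
  "\<lbrakk>left_module K H M; h \<in> carrier H\<rbrakk> \<Longrightarrow> act M h \<in> mod_hom K M M"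
  "\<lbrakk>left_module K H M; h \<in> carrier H; f \<in> mod_hom K X M\<rbrakk> \<Longrightarrow> (\<lambda>x. act M h (f x)) \<in> mod_hom K X M"
  "\<lbrakk>left_module K H M; m \<in> carrier M; g \<in> mod_hom K X H\<rbrakk> \<Longrightarrow> (\<lambda>x. act M (g x) m) \<in> mod_hom K X M"
  unfolding left_module_def using mod_hom_compose[of "\<lambda>h. act M h m"] mod_hom_compose[of "act M h"]
  by blast+

lemma act_one: "\<lbrakk>left_module K H M; m \<in> carrier M\<rbrakk> \<Longrightarrow> act M \<one>\<^bsub>H\<^esub> m = m"
  unfolding left_module_def by blast

lemma act_mult:
  "\<lbrakk>left_module K H M; g \<in> carrier H; h \<in> carrier H; m \<in> carrier M\<rbrakk>
    \<Longrightarrow> act M (g \<otimes>\<^bsub>H\<^esub> h) m = act M g (act M h m)"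
  unfolding left_module_def by blast

lemma right_comodule_module [simp]: "right_comodule K H M \<Longrightarrow> module K M"
  unfolding right_comodule_def by blast

lemma coact_mod_hom [simp]: "right_comodule K H M \<Longrightarrow> coact M \<in> mod_hom K M (tensor K M H)"
  unfolding right_comodule_def by blast

lemma coact_closed [simp]:
  "\<lbrakk>right_comodule K H M; m \<in> carrier M\<rbrakk> \<Longrightarrow> coact M m \<in> carrier (tensor K M H)"
  by (rule mod_hom_closed[OF coact_mod_hom])

lemma coact_terms [simp]:
  "\<lbrakk>(x, y) \<in> set (terms (coact M m)); right_comodule K H M; m \<in> carrier M\<rbrakk> \<Longrightarrow> x \<in> carrier M"
  "\<lbrakk>(x, y) \<in> set (terms (coact M m)); right_comodule K H M; m \<in> carrier M\<rbrakk> \<Longrightarrow> y \<in> carrier H"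
  by (meson terms_carrier coact_closed H_module right_comodule_module)+

lemma tsum_coact_mod_hom [simp]:
  assumes "right_comodule K H M" "bilinear_map K M H P f" "module K P"
  shows "(\<lambda>x. tsum P (coact M x) f) \<in> mod_hom K M P"
    and "g \<in> mod_hom K X M \<Longrightarrow> (\<lambda>x. tsum P (coact M (g x)) f) \<in> mod_hom K X P"
  using assms mod_hom_compose[OF coact_mod_hom]
  by (auto intro!: tsum_arg_mod_hom[where M = M and N = H])

text \<open>As for the comultiplication, the linear map on M \<otimes> (H \<otimes> H) induced by f
  is applied to both sides of the comodule axiom.\<close>

lemma coact_coassoc:
  assumes M: "right_comodule K H M" and f: "trilinear_map K M H H P f"
    and P: "module K P" and m: "m \<in> carrier M"
  shows "tsum P (coact M m) (\<lambda>x y. tsum P (coact M x) (\<lambda>x0 x1. f x0 x1 y))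
    = tsum P (coact M m) (\<lambda>x y. tsum P (comult H y) (f x))"
proof -
  let ?T = "tensor K M HH"
  let ?g = "\<lambda>t. tsum P t (\<lambda>a s. tsum P s (f a))"
  have M': "module K M" using M by simp
  note b = bilinear_map_trilinear[OF f M' H_module H_module P]
  have bf: "bilinear_map K H H P (f a)" if "a \<in> carrier M" for a
    using f that by (simp add: trilinear_map_def)
  have "?g (tsum ?T (coact M m) (\<lambda>x y. tsum ?T (coact M x) (\<lambda>x0 x1. tpure K M HH x0 (tpure K H H x1 y))))
    = ?g (tsum ?T (coact M m) (\<lambda>x y. tpure K M HH x (comult H y)))"
    using M m unfolding right_comodule_def by simp
  then show ?thesis
    using m P M by (simp add: tsum_tsum[OF b] tsum_tpure[OF b] tsum_tpure[OF bf])
qed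

lemma counit_coact_mod_hom:
  assumes "F \<in> mod_hom K M P" "module K P" "right_comodule K H M" "m \<in> carrier M"
  shows "tsum P (coact M m) (\<lambda>x y. counit H y \<odot>\<^bsub>P\<^esub> F x) = F m"
proof -
  have "F (tsum M (coact M m) (\<lambda>x y. counit H y \<odot>\<^bsub>M\<^esub> x)) = F m"
    using assms(3,4) unfolding right_comodule_def by simp
  then show ?thesis
    using assms by (simp add: mod_hom_tsum[OF assms(1)] mod_hom_smult[OF assms(1)])
qed

lemma left_moduleI:
  assumes "module K M" "act M \<in> carrier H \<rightarrow>\<^sub>E (carrier M \<rightarrow>\<^sub>E carrier M)"
    and "\<And>h. h \<in> carrier H \<Longrightarrow> act M h \<in> mod_hom K M M"
    and "\<And>m. m \<in> carrier M \<Longrightarrow> (\<lambda>h. act M h m) \<in> mod_hom K H M"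
    and "\<And>m. m \<in> carrier M \<Longrightarrow> act M \<one>\<^bsub>H\<^esub> m = m"
    and "\<And>g h m. \<lbrakk>g \<in> carrier H; h \<in> carrier H; m \<in> carrier M\<rbrakk>
      \<Longrightarrow> act M (g \<otimes>\<^bsub>H\<^esub> h) m = act M g (act M h m)"
  shows "left_module K H M"
  using assms unfolding left_module_def by blast

lemma right_comoduleI:
  assumes "module K M" "coact M \<in> extensional (carrier M)" "coact M \<in> mod_hom K M (tensor K M H)"
    and "\<And>m. m \<in> carrier M \<Longrightarrow>
        tsum (tensor K M HH) (coact M m) (\<lambda>x y.
          tsum (tensor K M HH) (coact M x) (\<lambda>x0 x1. tpure K M HH x0 (tpure K H H x1 y)))
        = tsum (tensor K M HH) (coact M m) (\<lambda>x y. tpure K M HH x (comult H y))"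
    and "\<And>m. m \<in> carrier M \<Longrightarrow> tsum M (coact M m) (\<lambda>x y. counit H y \<odot>\<^bsub>M\<^esub> x) = m"
  shows "right_comodule K H M"
  using assms unfolding right_comodule_def by blast

lemma yd_module_iff:
  "yd_module K H (\<alpha>, \<beta>) M \<longleftrightarrow> left_module K H M \<and> right_comodule K H M
    \<and> (\<forall>h\<in>carrier H. \<forall>m\<in>carrier M.
        tsum (tensor K M H) (comult H h) (\<lambda>h1 h2.
          tsum (tensor K M H) (coact M m) (\<lambda>m0 m1.
            tpure K M H (act M h1 m0) (\<beta> h2 \<otimes>\<^bsub>H\<^esub> m1)))
        = tsum (tensor K M H) (comult H h) (\<lambda>h1 h2.
            tsum (tensor K M H) (coact M (act M h2 m)) (\<lambda>x0 x1.
              tpure K M H x0 (x1 \<otimes>\<^bsub>H\<^esub> \<alpha> h1))))"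
  by (simp add: yd_module_def)

text \<open>The axiom is an equation in M \<otimes> H; the linear map to P induced by f carries it
  over.\<close>

lemma yd_compat:
  assumes M: "yd_module K H (\<alpha>, \<beta>) M" and aut: "\<alpha> \<in> carrier A" "\<beta> \<in> carrier A"
    and f: "bilinear_map K M H P f" and P: "module K P" and hm: "h \<in> carrier H" "m \<in> carrier M"
  shows "tsum P (comult H h) (\<lambda>h1 h2. tsum P (coact M m) (\<lambda>m0 m1. f (act M h1 m0) (\<beta> h2 \<otimes>\<^bsub>H\<^esub> m1)))
    = tsum P (comult H h) (\<lambda>h1 h2. tsum P (coact M (act M h2 m)) (\<lambda>x0 x1. f x0 (x1 \<otimes>\<^bsub>H\<^esub> \<alpha> h1)))"
proof -
  have [simp]: "left_module K H M" "right_comodule K H M"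
    using M by (auto simp: yd_module_iff)
  note [simp] = aut_rules[OF aut(1)] aut_rules[OF aut(2)]
  let ?T = "tensor K M H"
  have "tsum P (tsum ?T (comult H h) (\<lambda>h1 h2. tsum ?T (coact M m) (\<lambda>m0 m1.
            tpure K M H (act M h1 m0) (\<beta> h2 \<otimes>\<^bsub>H\<^esub> m1)))) f
    = tsum P (tsum ?T (comult H h) (\<lambda>h1 h2. tsum ?T (coact M (act M h2 m)) (\<lambda>x0 x1.
              tpure K M H x0 (x1 \<otimes>\<^bsub>H\<^esub> \<alpha> h1)))) f"
    using M hm by (simp add: yd_module_iff)
  then show ?thesis
    using P hm by (simp add: tsum_tsum[OF f] tsum_tpure[OF f])
qed

text \<open>The object part of \<open>yd_tensor\<close> without indices: f and g stand for \<delta>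
  and \<delta>\<alpha>\<delta>\<inverse>. Keeping them arbitrary lets each fact below name just the
  relations between twists on which it rests.\<close>

definition tensor_obj where
  "tensor_obj f g M N = (let T = tensor K M N in module.extend T (yd_mod.fields
     (\<lambda>h\<in>carrier H. \<lambda>t\<in>carrier T.
        tsum T t (\<lambda>m n. tsum T (comult H h) (\<lambda>h1 h2. tpure K M N (act M h2 m) (act N h1 n))))
     (\<lambda>t\<in>carrier T. tsum (tensor K T H) t (\<lambda>m n.
        tsum (tensor K T H) (coact M m) (\<lambda>m0 m1.
          tsum (tensor K T H) (coact N n) (\<lambda>n0 n1.
            tpure K T H (tpure K M N m0 n0) (f m1 \<otimes>\<^bsub>H\<^esub> g n1)))))))"

lemma same_module_tensor_obj: "same_module (tensor_obj f g M N) (tensor K M N)"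
  by (simp add: same_module_def tensor_obj_def Let_def module.defs)

lemmas tensor_obj_same [simp] =
  same_module_tensor_obj[unfolded same_module_def, THEN conjunct1]
  tensor_same[OF same_module_tensor_obj same_module_refl]
  tensor_same[OF same_module_refl same_module_tensor_obj]
  mod_hom_same[OF same_module_tensor_obj same_module_refl]
  mod_hom_same[OF same_module_refl same_module_tensor_obj]
  tsum_same[OF same_module_tensor_obj]
  module_same[OF same_module_sym[OF same_module_tensor_obj]]

lemma tensor_obj_smult [simp]: "(\<odot>\<^bsub>tensor_obj f g M N\<^esub>) = (\<odot>\<^bsub>tensor K M N\<^esub>)"
  by (simp add: tensor_obj_def Let_def module.defs)

lemma act_tensor_obj:
  "act (tensor_obj f g M N) = (\<lambda>h\<in>carrier H. \<lambda>t\<in>carrier (tensor K M N). tsum (tensor K M N) t (\<lambda>m n.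
     tsum (tensor K M N) (comult H h) (\<lambda>h1 h2. tpure K M N (act M h2 m) (act N h1 n))))"
  by (simp add: tensor_obj_def Let_def module.defs yd_mod.defs)

lemma coact_tensor_obj:
  "coact (tensor_obj f g M N) = (let T = tensor K M N in (\<lambda>t\<in>carrier T. tsum (tensor K T H) t (\<lambda>m n.
        tsum (tensor K T H) (coact M m) (\<lambda>m0 m1.
          tsum (tensor K T H) (coact N n) (\<lambda>n0 n1.
            tpure K T H (tpure K M N m0 n0) (f m1 \<otimes>\<^bsub>H\<^esub> g n1))))))"
  by (simp add: tensor_obj_def Let_def module.defs yd_mod.defs)

text \<open>Actions and coactions are restricted functions; linearity sees them only on the carrier,
  so they may be replaced by their bodies.\<close>

lemma mod_hom_cong:
  "(\<And>x. x \<in> carrier M \<Longrightarrow> f x = g x) \<Longrightarrow> module K M \<Longrightarrow> f \<in> mod_hom K M N \<longleftrightarrow> g \<in> mod_hom K M N"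
  by (auto simp: mod_hom_def Pi_iff)

lemma act_tensor_pure:
  assumes [simp]: "left_module K H M" "left_module K H N"
    and "h \<in> carrier H" "m \<in> carrier M" "n \<in> carrier N"
  shows "act (tensor_obj f g M N) h (tpure K M N m n)
    = tsum (tensor K M N) (comult H h) (\<lambda>h1 h2. tpure K M N (act M h2 m) (act N h1 n))"
  using assms(3-) by (simp add: act_tensor_obj tsum_tpure bilinear_map_def)

lemma act_tensor_mod_hom:
  assumes [simp]: "left_module K H M" "left_module K H N"
  shows "h \<in> carrier H \<Longrightarrow> act (tensor_obj f g M N) h \<in> mod_hom K (tensor K M N) (tensor K M N)"
    and "t \<in> carrier (tensor K M N) \<Longrightarrow> (\<lambda>h. act (tensor_obj f g M N) h t) \<in> mod_hom K H (tensor K M N)"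
proof -
  show "act (tensor_obj f g M N) h \<in> mod_hom K (tensor K M N) (tensor K M N)" if "h \<in> carrier H"
    using that tsum_mod_hom[of K M N "tensor K M N" "\<lambda>m n. tsum (tensor K M N) (comult H h)
      (\<lambda>h1 h2. tpure K M N (act M h2 m) (act N h1 n))"]
    by (subst mod_hom_cong) (auto simp: act_tensor_obj bilinear_map_def)
  show "(\<lambda>h. act (tensor_obj f g M N) h t) \<in> mod_hom K H (tensor K M N)"
    if t: "t \<in> carrier (tensor K M N)"
  proof -
    note [simp] = terms_carrier[OF _ t]
    show ?thesis
      using t by (subst mod_hom_cong[where g = "\<lambda>h. tsum (tensor K M N) t (\<lambda>m n.
     tsum (tensor K M N) (comult H h) (\<lambda>h1 h2. tpure K M N (act M h2 m) (act N h1 n)))"])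
       (simp_all add: act_tensor_obj bilinear_map_def)
  qed
qed

text \<open>Exchanging the two legs preserves multiplicativity of the comultiplication, so letting
  the second leg act on M and the first on N still gives an action.\<close>

lemma tensor_left_module:
  assumes [simp]: "left_module K H M" "left_module K H N"
  shows "left_module K H (tensor_obj f g M N)"
proof (rule left_moduleI)
  let ?T = "tensor K M N" and ?X = "tensor_obj f g M N"
  show "act ?X \<in> carrier H \<rightarrow>\<^sub>E (carrier ?X \<rightarrow>\<^sub>E carrier ?X)"
    using mod_hom_closed[OF act_tensor_mod_hom(1)] by (auto simp: act_tensor_obj)
  show "act ?X \<one>\<^bsub>H\<^esub> t = t" if "t \<in> carrier ?X" for t
  proof (rule tensor_hom_eqI[of "act ?X \<one>\<^bsub>H\<^esub>" K M N ?T "\<lambda>t. t"])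
    show "act ?X \<one>\<^bsub>H\<^esub> (tpure K M N m n) = tpure K M N m n"
      if "m \<in> carrier M" "n \<in> carrier N" for m n
      using that by (simp add: act_tensor_pure tsum_comult_one bilinear_map_def act_one)
  qed (use that in \<open>simp_all add: act_tensor_mod_hom\<close>)
  show "act ?X (g \<otimes>\<^bsub>H\<^esub> h) t = act ?X g (act ?X h t)"
    if gh: "g \<in> carrier H" "h \<in> carrier H" and t: "t \<in> carrier ?X" for g h t
  proof (rule tensor_hom_eqI[of "act ?X (g \<otimes>\<^bsub>H\<^esub> h)" K M N ?T "\<lambda>t. act ?X g (act ?X h t)"])
    show "act ?X (g \<otimes>\<^bsub>H\<^esub> h) (tpure K M N m n) = act ?X g (act ?X h (tpure K M N m n))"
      if "m \<in> carrier M" "n \<in> carrier N" for m n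
    proof -
      have "act ?X g (act ?X h (tpure K M N m n)) = tsum ?T (comult H h) (\<lambda>h1 h2. tsum ?T (comult H g) (\<lambda>g1 g2.
          tpure K M N (act M g2 (act M h2 m)) (act N g1 (act N h1 n))))"
        using that gh by (simp add: act_tensor_pure mod_hom_tsum[OF act_tensor_mod_hom(1)])
      also have "\<dots> = tsum ?T (comult H g) (\<lambda>g1 g2. tsum ?T (comult H h) (\<lambda>h1 h2.
          tpure K M N (act M g2 (act M h2 m)) (act N g1 (act N h1 n))))"
        using that gh by (subst tsum_swap[of K]) simp_all
      finally show ?thesis
        using that gh by (simp add: act_tensor_pure comult_mult bilinear_map_def act_mult)
    qed
    show "(\<lambda>t. act ?X g (act ?X h t)) \<in> mod_hom K ?T ?T"
      using gh by (intro mod_hom_compose[OF act_tensor_mod_hom(1) act_tensor_mod_hom(1)]) simp_all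
  qed (use t gh in \<open>simp_all add: act_tensor_mod_hom\<close>)
qed (simp_all add: act_tensor_mod_hom)

text \<open>The comodule axiom contains the comultiplication as an undecomposed tensor. This splits
  it into legs, after which coassociativity in Sweedler form applies.\<close>

lemma tensor_comult_expand:
  assumes "L \<in> mod_hom K HH P" "module K P" "z \<in> carrier H"
  shows "L (comult H z) = tsum P (comult H z) (\<lambda>x y. L (tpure K H H x y))"
  using mod_hom_tsum[OF assms(1), of "comult H z" "tpure K H H"] assms
  by (simp add: tsum_tpure_id)

lemma coact_tensor_mod_hom:
  assumes [simp]: "right_comodule K H M" "right_comodule K H N" and fg: "f \<in> carrier A" "g \<in> carrier A"
  shows "coact (tensor_obj f g M N) \<in> mod_hom K (tensor K M N) (tensor K (tensor K M N) H)"
proof -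
  let ?T = "tensor K M N"
  note [simp] = aut_rules[OF fg(1)] aut_rules[OF fg(2)]
  have "(\<lambda>t. tsum (tensor K ?T H) t (\<lambda>m n.
        tsum (tensor K ?T H) (coact M m) (\<lambda>m0 m1.
          tsum (tensor K ?T H) (coact N n) (\<lambda>n0 n1.
            tpure K ?T H (tpure K M N m0 n0) (f m1 \<otimes>\<^bsub>H\<^esub> g n1)))))
     \<in> mod_hom K ?T (tensor K ?T H)"
    by (rule tsum_mod_hom) (simp_all add: bilinear_map_def)
  then show ?thesis
    by (subst mod_hom_cong) (simp_all add: coact_tensor_obj Let_def)
qed

lemma coact_tensor_pure:
  assumes [simp]: "right_comodule K H M" "right_comodule K H N" and fg: "f \<in> carrier A" "g \<in> carrier A"
    and "m \<in> carrier M" "n \<in> carrier N"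
  shows "coact (tensor_obj f g M N) (tpure K M N m n)
    = (let T = tensor K M N in tsum (tensor K T H) (coact M m) (\<lambda>m0 m1.
          tsum (tensor K T H) (coact N n) (\<lambda>n0 n1.
            tpure K T H (tpure K M N m0 n0) (f m1 \<otimes>\<^bsub>H\<^esub> g n1))))"
proof -
  note [simp] = aut_rules[OF fg(1)] aut_rules[OF fg(2)]
  show ?thesis
    using assms(5-) by (simp add: coact_tensor_obj Let_def tsum_tpure bilinear_map_def)
qed

lemma tsum_coact_tensor_pure:
  assumes [simp]: "right_comodule K H M" "right_comodule K H N" and fg: "f \<in> carrier A" "g \<in> carrier A"
    and mn: "m \<in> carrier M" "n \<in> carrier N"
    and F: "bilinear_map K (tensor K M N) H P F" and P: "module K P"
  shows "tsum P (coact (tensor_obj f g M N) (tpure K M N m n)) F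
    = tsum P (coact M m) (\<lambda>m0 m1. tsum P (coact N n) (\<lambda>n0 n1. F (tpure K M N m0 n0) (f m1 \<otimes>\<^bsub>H\<^esub> g n1)))"
proof -
  note [simp] = aut_rules[OF fg(1)] aut_rules[OF fg(2)]
  show ?thesis
    using mn P by (simp add: coact_tensor_pure fg Let_def tsum_tsum[OF F] tsum_tpure[OF F])
qed

lemma tensor_coact_closed:
  assumes "right_comodule K H M" "right_comodule K H N" "f \<in> carrier A" "g \<in> carrier A"
    "t \<in> carrier (tensor K M N)"
  shows "coact (tensor_obj f g M N) t \<in> carrier (tensor K (tensor K M N) H)"
  using mod_hom_closed[OF coact_tensor_mod_hom] assms by blast

lemma tensor_coact_terms:
  assumes "right_comodule K H M" "right_comodule K H N" "f \<in> carrier A" "g \<in> carrier A"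
    "(x, y) \<in> set (terms (coact (tensor_obj f g M N) t))" "t \<in> carrier (tensor K M N)"
  shows "x \<in> carrier (tensor K M N)" "y \<in> carrier H"
  using terms_carrier[OF assms(5) tensor_coact_closed[OF assms(1-4,6)]] assms(1,2) by simp_all

text \<open>Interchanging sums brings the two coactions on m together, and coassociativity is used
  in each factor separately. The two resulting comultiplications merge into one because f and g are
  coalgebra maps and the comultiplication is multiplicative.\<close>

lemma tensor_coact_coassoc:
  assumes [simp]: "right_comodule K H M" "right_comodule K H N" and fg: "f \<in> carrier A" "g \<in> carrier A"
    and mn: "m \<in> carrier M" "n \<in> carrier N"
    and F: "trilinear_map K (tensor K M N) H H P F" and P: "module K P"
  shows "tsum P (coact M m) (\<lambda>m0 m1. tsum P (coact N n) (\<lambda>n0 n1. tsum P (coact M m0) (\<lambda>m00 m01.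
        tsum P (coact N n0) (\<lambda>n00 n01.
          F (tpure K M N m00 n00) (f m01 \<otimes>\<^bsub>H\<^esub> g n01) (f m1 \<otimes>\<^bsub>H\<^esub> g n1)))))
    = tsum P (coact M m) (\<lambda>m0 m1. tsum P (coact N n) (\<lambda>n0 n1.
        tsum P (comult H (f m1 \<otimes>\<^bsub>H\<^esub> g n1)) (\<lambda>a b. F (tpure K M N m0 n0) a b)))"
    (is "?L = ?R")
proof -
  note [simp] = aut_rules[OF fg(1)] aut_rules[OF fg(2)]
  \<comment> \<open>Linearity of F in each argument precomposed with an arbitrary linear map, which
    is the form that nested sums call for.\<close>
  have lin: "\<lbrakk>y \<in> carrier H; z \<in> carrier H; h \<in> mod_hom K X (tensor K M N)\<rbrakk> \<Longrightarrow> (\<lambda>x. F (h x) y z) \<in> mod_hom K X P"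
    "\<lbrakk>x \<in> carrier (tensor K M N); z \<in> carrier H; k \<in> mod_hom K X H\<rbrakk> \<Longrightarrow> (\<lambda>y. F x (k y) z) \<in> mod_hom K X P"
    "\<lbrakk>x \<in> carrier (tensor K M N); y \<in> carrier H; k \<in> mod_hom K X H\<rbrakk> \<Longrightarrow> (\<lambda>z. F x y (k z)) \<in> mod_hom K X P"
    "\<lbrakk>x \<in> carrier (tensor K M N); y \<in> carrier H; z \<in> carrier H\<rbrakk> \<Longrightarrow> F x y z \<in> carrier P"
    for x y z h k and X :: "('k, 'x1, 'x2) module_scheme"
    using F mod_hom_compose[of "\<lambda>x. F x y z" K "tensor K M N" P h X]
      mod_hom_compose[of "\<lambda>y. F x y z" K H P k X] mod_hom_compose[of "\<lambda>z. F x y z" K H P k X]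
      trilinear_map_closed[OF F]
    by (auto simp: trilinear_map_def bilinear_map_def)
  have id: "\<lbrakk>x \<in> carrier (tensor K M N); y \<in> carrier H\<rbrakk> \<Longrightarrow> F x y \<in> mod_hom K H P" for x y
    using F by (simp add: trilinear_map_def bilinear_map_def)
  note [simp] = lin id P
  have "?L = tsum P (coact M m) (\<lambda>m0 m1. tsum P (coact M m0) (\<lambda>m00 m01. tsum P (coact N n) (\<lambda>n0 n1.
        tsum P (coact N n0) (\<lambda>n00 n01.
          F (tpure K M N m00 n00) (f m01 \<otimes>\<^bsub>H\<^esub> g n01) (f m1 \<otimes>\<^bsub>H\<^esub> g n1)))))"
    using mn by (intro tsum_cong HOL.refl tsum_swap[of K]) simp_all
  also have "\<dots> = tsum P (coact M m) (\<lambda>m0 y. tsum P (comult H y) (\<lambda>m1 m2. tsum P (coact N n) (\<lambda>n0 n1.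
        tsum P (coact N n0) (\<lambda>n00 n01.
          F (tpure K M N m0 n00) (f m1 \<otimes>\<^bsub>H\<^esub> g n01) (f m2 \<otimes>\<^bsub>H\<^esub> g n1)))))"
    using mn by (intro coact_coassoc) (simp_all add: trilinear_map_def bilinear_map_def)
  also have "\<dots> = tsum P (coact M m) (\<lambda>m0 y. tsum P (comult H y) (\<lambda>m1 m2. tsum P (coact N n) (\<lambda>n0 z.
        tsum P (comult H z) (\<lambda>n1 n2. F (tpure K M N m0 n0) (f m1 \<otimes>\<^bsub>H\<^esub> g n1) (f m2 \<otimes>\<^bsub>H\<^esub> g n2)))))"
    using mn by (intro tsum_cong HOL.refl coact_coassoc) (simp_all add: trilinear_map_def bilinear_map_def)
  also have "\<dots> = tsum P (coact M m) (\<lambda>m0 y. tsum P (coact N n) (\<lambda>n0 z. tsum P (comult H y) (\<lambda>m1 m2.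
        tsum P (comult H z) (\<lambda>n1 n2. F (tpure K M N m0 n0) (f m1 \<otimes>\<^bsub>H\<^esub> g n1) (f m2 \<otimes>\<^bsub>H\<^esub> g n2)))))"
    using mn by (intro tsum_cong HOL.refl tsum_swap[of K]) simp_all
  also have "\<dots> = ?R"
    using mn by (simp add: comult_mult comult_aut[OF fg(1)] comult_aut[OF fg(2)] bilinear_map_def)
  finally show ?thesis .
qed

lemma smult_tpure:
  assumes "module K M" "module K N" "c \<in> carrier K" "m \<in> carrier M" "n \<in> carrier N"
  shows "c \<odot>\<^bsub>tensor K M N\<^esub> tpure K M N m n = tpure K M N (c \<odot>\<^bsub>M\<^esub> m) n"
    and "c \<odot>\<^bsub>tensor K M N\<^esub> tpure K M N m n = tpure K M N m (c \<odot>\<^bsub>N\<^esub> n)"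
  using mod_hom_smult[OF tpure_mod_hom_left[OF assms(1,2,5) mod_hom_id] assms(3,4)]
    mod_hom_smult[OF tpure_mod_hom_right(1)[OF assms(1,2,4)] assms(3,5)] by simp_all

lemma smult_left_comm:
  assumes "module K M" "c \<in> carrier K" "d \<in> carrier K" "x \<in> carrier M"
  shows "c \<odot>\<^bsub>M\<^esub> (d \<odot>\<^bsub>M\<^esub> x) = d \<odot>\<^bsub>M\<^esub> (c \<odot>\<^bsub>M\<^esub> x)"
  by (metis R.m_comm assms module.smult_assoc1)

lemma tensor_right_comodule:
  assumes M [simp]: "right_comodule K H M" and N [simp]: "right_comodule K H N"
    and fg: "f \<in> carrier A" "g \<in> carrier A"
  shows "right_comodule K H (tensor_obj f g M N)"
proof (rule right_comoduleI)
  let ?T = "tensor K M N" and ?X = "tensor_obj f g M N"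
  let ?P = "tensor K ?T HH"
  note [simp] = aut_rules[OF fg(1)] aut_rules[OF fg(2)]
  note lin = coact_tensor_mod_hom[OF M N fg] tsum_arg_mod_hom[OF coact_tensor_mod_hom[OF M N fg]]
    tensor_coact_closed[OF M N fg] tensor_coact_terms[OF M N fg]
  show "coact ?X \<in> extensional (carrier ?X)"
    by (simp add: coact_tensor_obj Let_def)
  show "coact ?X \<in> mod_hom K ?X (tensor K ?X H)"
    using lin by simp
  show "tsum (tensor K ?X HH) (coact ?X t) (\<lambda>x y. tsum (tensor K ?X HH) (coact ?X x) (\<lambda>x0 x1.
          tpure K ?X HH x0 (tpure K H H x1 y)))
        = tsum (tensor K ?X HH) (coact ?X t) (\<lambda>x y. tpure K ?X HH x (comult H y))" if "t \<in> carrier ?X" for t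
  proof -
    let ?l = "\<lambda>t. tsum ?P (coact ?X t) (\<lambda>x y. tsum ?P (coact ?X x) (\<lambda>x0 x1. tpure K ?T HH x0 (tpure K H H x1 y)))"
    let ?r = "\<lambda>t. tsum ?P (coact ?X t) (\<lambda>x y. tpure K ?T HH x (comult H y))"
    have "?l t = ?r t"
    proof (rule tensor_hom_eqI[of ?l K M N ?P ?r])
      fix m n assume mn: "m \<in> carrier M" "n \<in> carrier N"
      have "?r (tpure K M N m n) = tsum ?P (coact M m) (\<lambda>m0 m1. tsum ?P (coact N n) (\<lambda>n0 n1.
             tpure K ?T HH (tpure K M N m0 n0) (comult H (f m1 \<otimes>\<^bsub>H\<^esub> g n1))))"
        using mn by (simp add: tsum_coact_tensor_pure fg bilinear_map_def comult_linear
            mod_hom_compose[OF tpure_mod_hom_right(1)])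
      \<comment> \<open>The comultiplication is split into legs to meet the right side of
        \<open>tensor_coact_coassoc\<close>.\<close>
      also have "\<dots> = tsum ?P (coact M m) (\<lambda>m0 m1. tsum ?P (coact N n) (\<lambda>n0 n1.
             tsum ?P (comult H (f m1 \<otimes>\<^bsub>H\<^esub> g n1)) (\<lambda>a b. tpure K ?T HH (tpure K M N m0 n0) (tpure K H H a b))))"
        using mn by (intro tsum_cong HOL.refl tensor_comult_expand) simp_all
      finally show "?l (tpure K M N m n) = ?r (tpure K M N m n)"
        using mn tensor_coact_coassoc[OF M N fg mn, of ?P "\<lambda>a b c. tpure K ?T HH a (tpure K H H b c)"]
        by (simp add: tsum_coact_tensor_pure fg bilinear_map_def trilinear_map_def lin)
    qed (use that in \<open>simp_all add: lin bilinear_map_def comult_linear\<close>)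
    then show ?thesis by simp
  qed
  show "tsum ?X (coact ?X t) (\<lambda>x y. counit H y \<odot>\<^bsub>?X\<^esub> x) = t" if "t \<in> carrier ?X" for t
  proof -
    let ?l = "\<lambda>t. tsum ?T (coact ?X t) (\<lambda>x y. counit H y \<odot>\<^bsub>?T\<^esub> x)"
    have "?l t = t"
    proof (rule tensor_hom_eqI[of ?l K M N ?T "\<lambda>t. t"])
      fix m n assume mn: "m \<in> carrier M" "n \<in> carrier N"
      \<comment> \<open>The counit is multiplicative and invariant under f and g, so each factor
        receives a counit scalar of its own; the sums then collapse one factor at a time.\<close>
      have "?l (tpure K M N m n) = tsum ?T (coact M m) (\<lambda>m0 m1. tsum ?T (coact N n) (\<lambda>n0 n1.
             counit H n1 \<odot>\<^bsub>?T\<^esub> tpure K M N (counit H m1 \<odot>\<^bsub>M\<^esub> m0) n0))"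
        using mn by (simp add: tsum_coact_tensor_pure fg bilinear_map_def smult_tpure module.smult_assoc1[of K] smult_left_comm)
      also have "\<dots> = tsum ?T (coact M m) (\<lambda>m0 m1. counit H m1 \<odot>\<^bsub>?T\<^esub> tpure K M N m0 n)"
        using mn by (intro tsum_cong HOL.refl) (subst counit_coact_mod_hom; simp add: smult_tpure(1))
      also have "\<dots> = tpure K M N m n"
        using mn by (intro counit_coact_mod_hom) simp_all
      finally show "?l (tpure K M N m n) = tpure K M N m n" .
    qed (use that in \<open>simp_all add: lin bilinear_map_def\<close>)
    then show ?thesis by simp
  qed
qed simp

declare tensor_left_module [simp] tensor_right_comodule [simp]

lemma same_module_tensor_obj_iff [simp]:
  "same_module (tensor_obj f g M N) Z \<longleftrightarrow> same_module (tensor K M N) Z"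
  using same_module_tensor_obj[of f g M N] by (auto simp: same_module_def)

text \<open>Closure rules for carriers that simplification has already rewritten to those of another
  record on the same module, such as \<open>tensor K M N\<close> in place of a tensor
  object.\<close>

lemma act_same_module [simp]:
  assumes "left_module K H M" "same_module M M'"
  shows "\<lbrakk>h \<in> carrier H; m \<in> carrier M'\<rbrakk> \<Longrightarrow> act M h m \<in> carrier M'"
    and "h \<in> carrier H \<Longrightarrow> act M h \<in> mod_hom K M' M'"
    and "\<lbrakk>h \<in> carrier H; f \<in> mod_hom K X M'\<rbrakk> \<Longrightarrow> (\<lambda>x. act M h (f x)) \<in> mod_hom K X M'"
    and "\<lbrakk>m \<in> carrier M'; g \<in> mod_hom K X H\<rbrakk> \<Longrightarrow> (\<lambda>x. act M (g x) m) \<in> mod_hom K X M'"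
proof -
  have car: "carrier M' = carrier M" using assms(2) by (simp add: same_module_def)
  note eqs = car mod_hom_same[OF same_module_sym[OF assms(2)] same_module_sym[OF assms(2)]]
    mod_hom_same[OF same_module_refl same_module_sym[OF assms(2)]]
    mod_hom_same[OF same_module_sym[OF assms(2)] same_module_refl]
  show "\<lbrakk>h \<in> carrier H; m \<in> carrier M'\<rbrakk> \<Longrightarrow> act M h m \<in> carrier M'"
    "h \<in> carrier H \<Longrightarrow> act M h \<in> mod_hom K M' M'"
    "\<lbrakk>h \<in> carrier H; f \<in> mod_hom K X M'\<rbrakk> \<Longrightarrow> (\<lambda>x. act M h (f x)) \<in> mod_hom K X M'"
    "\<lbrakk>m \<in> carrier M'; g \<in> mod_hom K X H\<rbrakk> \<Longrightarrow> (\<lambda>x. act M (g x) m) \<in> mod_hom K X M'"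
    by (simp_all only: eqs act_closed[OF assms(1)] act_mod_hom[OF assms(1)])
qed

lemma coact_same_module [simp]:
  assumes "right_comodule K H M" "same_module M M'"
  shows "m \<in> carrier M' \<Longrightarrow> coact M m \<in> carrier (tensor K M' H)"
    and "coact M \<in> mod_hom K M' (tensor K M' H)"
    and "\<lbrakk>bilinear_map K M' H P F; module K P\<rbrakk> \<Longrightarrow> (\<lambda>x. tsum P (coact M x) F) \<in> mod_hom K M' P"
    and "\<lbrakk>f \<in> mod_hom K X M'\<rbrakk> \<Longrightarrow> (\<lambda>x. coact M (f x)) \<in> mod_hom K X (tensor K M' H)"
proof -
  have car: "carrier M = carrier M'" using assms(2) by (simp add: same_module_def)
  note t = tensor_same(1)[OF assms(2) same_module_refl]
  note b = bilinear_map_same[OF assms(2) same_module_refl same_module_refl]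
  show "m \<in> carrier M' \<Longrightarrow> coact M m \<in> carrier (tensor K M' H)"
    using coact_closed[OF assms(1)] car t by metis
  show 1: "coact M \<in> mod_hom K M' (tensor K M' H)"
    using coact_mod_hom[OF assms(1)] mod_hom_same[OF assms(2) same_module_refl] t by metis
  show "f \<in> mod_hom K X M' \<Longrightarrow> (\<lambda>x. coact M (f x)) \<in> mod_hom K X (tensor K M' H)"
    by (rule mod_hom_compose[OF 1])
  show "\<lbrakk>bilinear_map K M' H P F; module K P\<rbrakk> \<Longrightarrow> (\<lambda>x. tsum P (coact M x) F) \<in> mod_hom K M' P"
    using tsum_coact_mod_hom(1)[OF assms(1)] mod_hom_same[OF assms(2) same_module_refl] b by metis
qed

lemma coact_terms_same_module [simp]:
  "\<lbrakk>(x, y) \<in> set (terms (coact M m)); right_comodule K H M; same_module M M'; m \<in> carrier M'\<rbrakk>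
    \<Longrightarrow> x \<in> carrier M'"
  using coact_terms(1)[of x y M m] by (simp add: same_module_def)

lemma tsum_act_tensor_pure:
  assumes [simp]: "left_module K H M" "left_module K H N"
    and "h \<in> carrier H" "m \<in> carrier M" "n \<in> carrier N"
    and F: "F \<in> mod_hom K (tensor K M N) P" "module K P"
  shows "F (act (tensor_obj f g M N) h (tpure K M N m n))
    = tsum P (comult H h) (\<lambda>h1 h2. F (tpure K M N (act M h2 m) (act N h1 n)))"
  using assms(3-5) F by (simp add: act_tensor_pure mod_hom_tsum[OF F(1)])

text \<open>Split h into three legs. The condition for M consumes the last two and leaves \<alpha>
  of the middle one behind the coefficient of m; after regrouping, the condition for N consumes the
  first two. In between, the middle leg b has to change from \<delta>(\<alpha>(b)) to
  \<epsilon>(\<delta>(b)), which is why the twist on N is \<epsilon> =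
  \<delta>\<alpha>\<delta>\<inverse>.\<close>

lemma tensor_yd_module:
  assumes M: "yd_module K H (\<alpha>, \<beta>) M" and N: "yd_module K H (\<gamma>, \<delta>) N"
    and aut: "\<alpha> \<in> carrier A" "\<beta> \<in> carrier A" "\<gamma> \<in> carrier A" "\<delta> \<in> carrier A" "\<epsilon> \<in> carrier A"
      "\<alpha>' \<in> carrier A" "\<beta>' \<in> carrier A"
    and \<epsilon>: "\<And>h. h \<in> carrier H \<Longrightarrow> \<epsilon> (\<delta> h) = \<delta> (\<alpha> h)"
    and \<alpha>': "\<And>h. h \<in> carrier H \<Longrightarrow> \<alpha>' h = \<epsilon> (\<gamma> h)"
    and \<beta>': "\<And>h. h \<in> carrier H \<Longrightarrow> \<beta>' h = \<delta> (\<beta> h)"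
  shows "yd_module K H (\<alpha>', \<beta>') (tensor_obj \<delta> \<epsilon> M N)"
proof -
  have [simp]: "left_module K H M" "right_comodule K H M" "left_module K H N" "right_comodule K H N"
    using M N by (auto simp: yd_module_iff)
  note [simp] = aut(4,5) aut_rules[OF aut(1)] aut_rules[OF aut(2)] aut_rules[OF aut(3)] aut_rules[OF aut(4)]
    aut_rules[OF aut(5)] aut_rules[OF aut(6)] aut_rules[OF aut(7)]
  let ?T = "tensor K M N" and ?X = "tensor_obj \<delta> \<epsilon> M N"
  let ?P = "tensor K ?T H" and ?E = "\<lambda>x y z. tpure K (tensor K M N) H (tpure K M N x y) z"
  let ?l = "\<lambda>h t. tsum ?P (comult H h) (\<lambda>h1 h2. tsum ?P (coact ?X t) (\<lambda>m0 m1.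
      tpure K ?T H (act ?X h1 m0) (\<beta>' h2 \<otimes>\<^bsub>H\<^esub> m1)))"
  let ?r = "\<lambda>h t. tsum ?P (comult H h) (\<lambda>h1 h2. tsum ?P (coact ?X (act ?X h2 t)) (\<lambda>x0 x1.
      tpure K ?T H x0 (x1 \<otimes>\<^bsub>H\<^esub> \<alpha>' h1)))"
  have "?l h t = ?r h t" if h: "h \<in> carrier H" and t: "t \<in> carrier ?T" for h t
  proof (rule tensor_hom_eqI[where f = "?l h" and g = "?r h" and K = K and M = M and N = N and P = ?P])
    fix m n assume mn: "m \<in> carrier M" "n \<in> carrier N"
    have "?l h (tpure K M N m n) = tsum ?P (comult H h) (\<lambda>h1 h2. tsum ?P (coact M m) (\<lambda>m0 m1. tsum ?P (coact N n) (\<lambda>n0 n1.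
          tsum ?P (comult H h1) (\<lambda>a b. ?E (act M b m0) (act N a n0) (\<delta> (\<beta> h2) \<otimes>\<^bsub>H\<^esub> (\<delta> m1 \<otimes>\<^bsub>H\<^esub> \<epsilon> n1))))))"
      using h mn by (simp add: tsum_coact_tensor_pure bilinear_map_def \<beta>'
          tsum_act_tensor_pure[where P = ?P and F = "\<lambda>t. tpure K ?T H t _"])
    also have "\<dots> = tsum ?P (comult H h) (\<lambda>h1 h2. tsum ?P (comult H h1) (\<lambda>a b. tsum ?P (coact M m) (\<lambda>m0 m1.
          tsum ?P (coact N n) (\<lambda>n0 n1. ?E (act M b m0) (act N a n0) (\<delta> (\<beta> h2) \<otimes>\<^bsub>H\<^esub> (\<delta> m1 \<otimes>\<^bsub>H\<^esub> \<epsilon> n1))))))"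
      using h mn by (simp add: tsum_swap[of K _ "coact N n" "comult H _"] tsum_swap[of K _ "coact M m" "comult H _"])
    also have "\<dots> = tsum ?P (comult H h) (\<lambda>a x. tsum ?P (comult H x) (\<lambda>b h2. tsum ?P (coact M m) (\<lambda>m0 m1.
          tsum ?P (coact N n) (\<lambda>n0 n1. ?E (act M b m0) (act N a n0) (\<delta> (\<beta> h2) \<otimes>\<^bsub>H\<^esub> (\<delta> m1 \<otimes>\<^bsub>H\<^esub> \<epsilon> n1))))))"
      using h mn by (intro comult_coassoc) (simp_all add: trilinear_map_def bilinear_map_def)
    also have "\<dots> = tsum ?P (comult H h) (\<lambda>a x. tsum ?P (comult H x) (\<lambda>b h2. tsum ?P (coact M m) (\<lambda>m0 m1.
          tsum ?P (coact N n) (\<lambda>n0 n1. ?E (act M b m0) (act N a n0) (\<delta> (\<beta> h2 \<otimes>\<^bsub>H\<^esub> m1) \<otimes>\<^bsub>H\<^esub> \<epsilon> n1)))))"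
      using h mn by (simp add: H.m_assoc)
    also have "\<dots> = tsum ?P (comult H h) (\<lambda>a x. tsum ?P (comult H x) (\<lambda>b h2.
          tsum ?P (coact M (act M h2 m)) (\<lambda>x0 x1.
          tsum ?P (coact N n) (\<lambda>n0 n1. ?E x0 (act N a n0) (\<delta> (x1 \<otimes>\<^bsub>H\<^esub> \<alpha> b) \<otimes>\<^bsub>H\<^esub> \<epsilon> n1)))))"
      using h mn by (intro tsum_cong HOL.refl yd_compat[OF M]) (simp_all add: aut bilinear_map_def)
    also have "\<dots> = tsum ?P (comult H h) (\<lambda>x c. tsum ?P (comult H x) (\<lambda>a b.
          tsum ?P (coact M (act M c m)) (\<lambda>x0 x1.
          tsum ?P (coact N n) (\<lambda>n0 n1. ?E x0 (act N a n0) (\<delta> (x1 \<otimes>\<^bsub>H\<^esub> \<alpha> b) \<otimes>\<^bsub>H\<^esub> \<epsilon> n1)))))"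
      using h mn by (intro comult_coassoc[symmetric]) (simp_all add: trilinear_map_def bilinear_map_def)
    \<comment> \<open>The factor \<delta>(\<alpha>(b)) equals \<epsilon>(\<delta>(b)) and joins
      \<epsilon>(n1) under a common \<epsilon>; its argument is now the product in the condition for
      N.\<close>
    also have "\<dots> = tsum ?P (comult H h) (\<lambda>x c. tsum ?P (coact M (act M c m)) (\<lambda>x0 x1.
          tsum ?P (comult H x) (\<lambda>a b.
          tsum ?P (coact N n) (\<lambda>n0 n1. ?E x0 (act N a n0) (\<delta> x1 \<otimes>\<^bsub>H\<^esub> \<epsilon> (\<delta> b \<otimes>\<^bsub>H\<^esub> n1))))))"
      using h mn by (simp add: tsum_swap[of K _ "coact M _" "comult H _"] H.m_assoc \<epsilon>)
    also have "\<dots> = tsum ?P (comult H h) (\<lambda>x c. tsum ?P (coact M (act M c m)) (\<lambda>x0 x1.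
          tsum ?P (comult H x) (\<lambda>a b.
          tsum ?P (coact N (act N b n)) (\<lambda>n0 n1. ?E x0 n0 (\<delta> x1 \<otimes>\<^bsub>H\<^esub> \<epsilon> (n1 \<otimes>\<^bsub>H\<^esub> \<gamma> a))))))"
      using h mn by (intro tsum_cong HOL.refl yd_compat[OF N]) (simp_all add: aut bilinear_map_def)
    also have "\<dots> = tsum ?P (comult H h) (\<lambda>x c. tsum ?P (comult H x) (\<lambda>a b.
          tsum ?P (coact M (act M c m)) (\<lambda>x0 x1.
          tsum ?P (coact N (act N b n)) (\<lambda>n0 n1. ?E x0 n0 ((\<delta> x1 \<otimes>\<^bsub>H\<^esub> \<epsilon> n1) \<otimes>\<^bsub>H\<^esub> \<alpha>' a)))))"
      using h mn by (simp add: tsum_swap[of K _ "coact M _" "comult H _"] H.m_assoc \<alpha>')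
    also have "\<dots> = tsum ?P (comult H h) (\<lambda>a x. tsum ?P (comult H x) (\<lambda>b c.
          tsum ?P (coact M (act M c m)) (\<lambda>x0 x1.
          tsum ?P (coact N (act N b n)) (\<lambda>n0 n1. ?E x0 n0 ((\<delta> x1 \<otimes>\<^bsub>H\<^esub> \<epsilon> n1) \<otimes>\<^bsub>H\<^esub> \<alpha>' a)))))"
      using h mn by (intro comult_coassoc) (simp_all add: trilinear_map_def bilinear_map_def)
    also have "\<dots> = ?r h (tpure K M N m n)"
      using h mn by (simp add: tsum_coact_tensor_pure bilinear_map_def
          tsum_act_tensor_pure[where P = ?P and F = "\<lambda>t. tsum ?P (coact ?X t) _"])
    finally show "?l h (tpure K M N m n) = ?r h (tpure K M N m n)" .
  qed (use h t in \<open>simp_all add: bilinear_map_def\<close>)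
  then show ?thesis
    by (simp add: yd_module_iff)
qed

section \<open>Conjugate and unit objects\<close>

text \<open>Conjugation with arbitrary twists, \<kappa> on the action and \<mu> on the coaction; the
  values belonging to an index enter later as \<open>kap\<close> and \<open>mu\<close>.\<close>

definition conj_obj where
  "conj_obj \<kappa> \<mu> N = N\<lparr>act := \<lambda>h\<in>carrier H. \<lambda>n\<in>carrier N. act N (\<kappa> h) n,
     coact := \<lambda>n\<in>carrier N. tsum (tensor K N H) (coact N n) (\<lambda>n0 n1. tpure K N H n0 (\<mu> n1))\<rparr>"

lemma same_module_conj_obj: "same_module (conj_obj \<kappa> \<mu> N) N"
  by (simp add: same_module_def conj_obj_def)

lemmas conj_obj_same [simp] =
  same_module_conj_obj[unfolded same_module_def, THEN conjunct1]
  tensor_same[OF same_module_conj_obj same_module_refl]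
  tensor_same[OF same_module_refl same_module_conj_obj]
  mod_hom_same[OF same_module_conj_obj same_module_refl]
  mod_hom_same[OF same_module_refl same_module_conj_obj]
  tsum_same[OF same_module_conj_obj]
  module_same[OF same_module_sym[OF same_module_conj_obj]]

lemma same_module_conj_obj_iff [simp]:
  "same_module (conj_obj \<kappa> \<mu> N) Z \<longleftrightarrow> same_module N Z"
  using same_module_conj_obj[of \<kappa> \<mu> N] by (auto simp: same_module_def)

lemma conj_obj_smult [simp]: "(\<odot>\<^bsub>conj_obj \<kappa> \<mu> N\<^esub>) = (\<odot>\<^bsub>N\<^esub>)"
  by (simp add: conj_obj_def)

lemma act_conj [simp]:
  "\<lbrakk>h \<in> carrier H; n \<in> carrier N\<rbrakk> \<Longrightarrow> act (conj_obj \<kappa> \<mu> N) h n = act N (\<kappa> h) n"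
  by (simp add: conj_obj_def)

lemma coact_conj:
  "n \<in> carrier N \<Longrightarrow> coact (conj_obj \<kappa> \<mu> N) n
    = tsum (tensor K N H) (coact N n) (\<lambda>n0 n1. tpure K N H n0 (\<mu> n1))"
  by (simp add: conj_obj_def)

lemma tsum_coact_conj:
  assumes [simp]: "right_comodule K H N" and \<mu>: "\<mu> \<in> carrier A" and n: "n \<in> carrier N"
    and F: "bilinear_map K N H P F" and P: "module K P"
  shows "tsum P (coact (conj_obj \<kappa> \<mu> N) n) F = tsum P (coact N n) (\<lambda>n0 n1. F n0 (\<mu> n1))"
proof -
  note [simp] = aut_rules[OF \<mu>]
  show ?thesis
    using n P by (simp add: coact_conj tsum_tsum[OF F] tsum_tpure[OF F])
qed

lemma conj_left_module [simp]:
  assumes [simp]: "left_module K H N" and \<kappa>: "\<kappa> \<in> carrier A"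
  shows "left_module K H (conj_obj \<kappa> \<mu> N)"
proof (rule left_moduleI)
  note [simp] = aut_rules[OF \<kappa>]
  let ?X = "conj_obj \<kappa> \<mu> N"
  show "act ?X \<in> carrier H \<rightarrow>\<^sub>E (carrier ?X \<rightarrow>\<^sub>E carrier ?X)"
    by (auto simp: conj_obj_def)
  show "act ?X h \<in> mod_hom K ?X ?X" if "h \<in> carrier H" for h
    using that mod_hom_cong[where f = "act ?X h" and g = "act N (\<kappa> h)" and M = N and N = N] by simp
  show "(\<lambda>h. act ?X h m) \<in> mod_hom K H ?X" if "m \<in> carrier ?X" for m
    using that mod_hom_cong[where f = "\<lambda>h. act ?X h m" and g = "\<lambda>h. act N (\<kappa> h) m" and M = H and N = N] by simp
qed (simp_all add: aut_rules[OF \<kappa>] act_one act_mult)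

text \<open>Coassociativity survives because \<mu> commutes with the comultiplication, the counit
  axiom because \<mu> preserves the counit.\<close>

lemma conj_right_comodule [simp]:
  assumes N [simp]: "right_comodule K H N" and \<mu>: "\<mu> \<in> carrier A"
  shows "right_comodule K H (conj_obj \<kappa> \<mu> N)"
proof (rule right_comoduleI)
  note [simp] = aut_rules[OF \<mu>]
  let ?X = "conj_obj \<kappa> \<mu> N" and ?P = "tensor K N HH"
  show "coact ?X \<in> extensional (carrier ?X)"
    by (simp add: conj_obj_def)
  have "(\<lambda>n. tsum (tensor K N H) (coact N n) (\<lambda>n0 n1. tpure K N H n0 (\<mu> n1))) \<in> mod_hom K N (tensor K N H)"
    by (simp add: bilinear_map_def)
  then show l: "coact ?X \<in> mod_hom K ?X (tensor K ?X H)"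
    by (subst mod_hom_cong) (simp_all add: coact_conj)
  have [simp]: "(\<lambda>x. tsum P (coact ?X x) F) \<in> mod_hom K N P" if "bilinear_map K N H P F" "module K P"
    for F and P :: "('k, 'x1, 'x2) module_scheme"
    using l tsum_arg_mod_hom[OF _ that(1), of "coact ?X" N] that by simp
  have [simp]: "x \<in> carrier N" "y \<in> carrier H" if "(x, y) \<in> set (terms (coact ?X n))" "n \<in> carrier N" for x y n
    using terms_carrier[OF that(1), of K N H] mod_hom_closed[OF l, of n] that(2) by simp_all
  show "tsum (tensor K ?X HH) (coact ?X n) (\<lambda>x y. tsum (tensor K ?X HH) (coact ?X x) (\<lambda>x0 x1.
          tpure K ?X HH x0 (tpure K H H x1 y)))
        = tsum (tensor K ?X HH) (coact ?X n) (\<lambda>x y. tpure K ?X HH x (comult H y))" if "n \<in> carrier ?X" for n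
  proof -
    have n: "n \<in> carrier N" using that by simp
    have "tsum ?P (coact ?X n) (\<lambda>x y. tpure K N HH x (comult H y))
      = tsum ?P (coact N n) (\<lambda>x y. tpure K N HH x (comult H (\<mu> y)))"
      using n by (simp add: tsum_coact_conj[OF N \<mu>] bilinear_map_def comult_linear
            mod_hom_compose[OF tpure_mod_hom_right(1)])
    also have "\<dots> = tsum ?P (coact N n) (\<lambda>x y. tsum ?P (comult H (\<mu> y)) (\<lambda>a b. tpure K N HH x (tpure K H H a b)))"
      using n by (intro tsum_cong HOL.refl tensor_comult_expand) simp_all
    also have "\<dots> = tsum ?P (coact N n) (\<lambda>x y. tsum ?P (comult H y) (\<lambda>a b. tpure K N HH x (tpure K H H (\<mu> a) (\<mu> b))))"
      using n by (simp add: comult_aut[OF \<mu>] bilinear_map_def)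
    also have "\<dots> = tsum ?P (coact N n) (\<lambda>x y. tsum ?P (coact N x) (\<lambda>x0 x1. tpure K N HH x0 (tpure K H H (\<mu> x1) (\<mu> y))))"
      using n by (intro coact_coassoc[symmetric]) (simp_all add: trilinear_map_def bilinear_map_def)
    also have "\<dots> = tsum ?P (coact ?X n) (\<lambda>x y. tsum ?P (coact ?X x) (\<lambda>x0 x1.
          tpure K N HH x0 (tpure K H H x1 y)))"
      using n by (simp add: tsum_coact_conj[OF N \<mu>] bilinear_map_def)
    finally show ?thesis by simp
  qed
  show "tsum ?X (coact ?X n) (\<lambda>x y. counit H y \<odot>\<^bsub>?X\<^esub> x) = n" if "n \<in> carrier ?X" for n
    using that by (simp add: tsum_coact_conj[OF N \<mu>] bilinear_map_def counit_coact_mod_hom)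
qed simp

text \<open>The condition for N at \<kappa>(h), pushed along id \<otimes> \<mu>. The legs of
  \<kappa>(h) are the images of those of h and \<mu> is multiplicative, so the index becomes
  (\<mu>\<gamma>\<kappa>, \<mu>\<delta>\<kappa>).\<close>

lemma conj_yd_module:
  assumes N: "yd_module K H (\<gamma>, \<delta>) N"
    and aut: "\<gamma> \<in> carrier A" "\<delta> \<in> carrier A" "\<kappa> \<in> carrier A" "\<mu> \<in> carrier A"
      "\<gamma>' \<in> carrier A" "\<delta>' \<in> carrier A"
    and \<gamma>': "\<And>h. h \<in> carrier H \<Longrightarrow> \<gamma>' h = \<mu> (\<gamma> (\<kappa> h))"
    and \<delta>': "\<And>h. h \<in> carrier H \<Longrightarrow> \<delta>' h = \<mu> (\<delta> (\<kappa> h))"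
  shows "yd_module K H (\<gamma>', \<delta>') (conj_obj \<kappa> \<mu> N)"
proof -
  have N' [simp]: "left_module K H N" "right_comodule K H N"
    using N by (auto simp: yd_module_iff)
  note [simp] = aut aut_rules[OF aut(1)] aut_rules[OF aut(2)] aut_rules[OF aut(3)] aut_rules[OF aut(4)]
    aut_rules[OF aut(5)] aut_rules[OF aut(6)]
  let ?X = "conj_obj \<kappa> \<mu> N" and ?P = "tensor K N H"
  have "tsum ?P (comult H h) (\<lambda>h1 h2. tsum ?P (coact ?X n) (\<lambda>m0 m1.
            tpure K N H (act N (\<kappa> h1) m0) (\<delta>' h2 \<otimes>\<^bsub>H\<^esub> m1)))
        = tsum ?P (comult H h) (\<lambda>h1 h2. tsum ?P (coact ?X (act N (\<kappa> h2) n)) (\<lambda>x0 x1.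
              tpure K N H x0 (x1 \<otimes>\<^bsub>H\<^esub> \<gamma>' h1)))"
    if h: "h \<in> carrier H" and n: "n \<in> carrier N" for h n
  proof -
    have "tsum ?P (comult H h) (\<lambda>h1 h2. tsum ?P (coact ?X n) (\<lambda>m0 m1.
            tpure K N H (act N (\<kappa> h1) m0) (\<delta>' h2 \<otimes>\<^bsub>H\<^esub> m1)))
      = tsum ?P (comult H (\<kappa> h)) (\<lambda>h1 h2. tsum ?P (coact N n) (\<lambda>m0 m1.
            tpure K N H (act N h1 m0) (\<mu> (\<delta> h2 \<otimes>\<^bsub>H\<^esub> m1))))"
      using h n by (simp add: comult_aut[OF aut(3)] tsum_coact_conj \<delta>' bilinear_map_def)
    also have "\<dots> = tsum ?P (comult H (\<kappa> h)) (\<lambda>h1 h2. tsum ?P (coact N (act N h2 n)) (\<lambda>m0 m1.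
            tpure K N H m0 (\<mu> (m1 \<otimes>\<^bsub>H\<^esub> \<gamma> h1))))"
      using h n by (intro yd_compat[OF N aut(1,2)]) (simp_all add: bilinear_map_def)
    also have "\<dots> = tsum ?P (comult H h) (\<lambda>h1 h2. tsum ?P (coact ?X (act N (\<kappa> h2) n)) (\<lambda>x0 x1.
              tpure K N H x0 (x1 \<otimes>\<^bsub>H\<^esub> \<gamma>' h1)))"
      using h n by (simp add: comult_aut[OF aut(3)] tsum_coact_conj \<gamma>' bilinear_map_def)
    finally show ?thesis .
  qed
  moreover have "x \<in> carrier N" if "(x, y) \<in> set (terms (coact ?X n))" "n \<in> carrier N" for x y n
    using coact_terms(1)[OF that(1) conj_right_comodule] that(2) by simp
  ultimately show ?thesis
    by (simp add: yd_module_iff)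
qed

section \<open>The unit object\<close>

lemma ground_module [simp]: "module K (ground K)"
proof -
  have "abelian_group (ground K)"
  proof (rule abelian_groupI)
    show "\<exists>y\<in>carrier (ground K). y \<oplus>\<^bsub>ground K\<^esub> x = \<zero>\<^bsub>ground K\<^esub>" if "x \<in> carrier (ground K)" for x
      using that by (intro bexI[of _ "Scalar (\<ominus>\<^bsub>K\<^esub> scalar x)"]) (auto simp: ground_def R.l_neg)
  qed (auto simp: ground_def R.a_ac)
  then show ?thesis
    by (rule moduleI[OF R.is_cring]) (auto simp: ground_def R.l_distr R.r_distr R.m_assoc)
qed

abbreviation "unit_obj \<equiv> snd (yd_unit K H)"

lemma same_module_unit_obj: "same_module unit_obj (ground K)"
  by (simp add: same_module_def yd_unit_def module.defs)

lemmas unit_obj_same [simp] =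
  same_module_unit_obj[unfolded same_module_def, THEN conjunct1]
  tensor_same[OF same_module_unit_obj same_module_refl]
  tensor_same[OF same_module_refl same_module_unit_obj]
  mod_hom_same[OF same_module_unit_obj same_module_refl]
  mod_hom_same[OF same_module_refl same_module_unit_obj]
  tsum_same[OF same_module_unit_obj]
  module_same[OF same_module_sym[OF same_module_unit_obj]]

lemma same_module_unit_obj_iff [simp]: "same_module unit_obj Z \<longleftrightarrow> same_module (ground K) Z"
  using same_module_unit_obj by (auto simp: same_module_def)

lemma unit_obj_smult [simp]: "(\<odot>\<^bsub>unit_obj\<^esub>) = (\<odot>\<^bsub>ground K\<^esub>)"
  by (simp add: yd_unit_def module.defs)

lemma act_unit [simp]:
  "\<lbrakk>h \<in> carrier H; x \<in> carrier (ground K)\<rbrakk> \<Longrightarrow> act unit_obj h x = counit H h \<odot>\<^bsub>ground K\<^esub> x"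
  by (simp add: yd_unit_def module.defs yd_mod.defs)

lemma coact_unit [simp]: "x \<in> carrier (ground K) \<Longrightarrow> coact unit_obj x = tpure K (ground K) H x \<one>\<^bsub>H\<^esub>"
  by (simp add: yd_unit_def module.defs yd_mod.defs)

lemma unit_left_module [simp]: "left_module K H unit_obj"
proof (rule left_moduleI)
  show "act unit_obj \<in> carrier H \<rightarrow>\<^sub>E (carrier unit_obj \<rightarrow>\<^sub>E carrier unit_obj)"
    by (auto simp: yd_unit_def module.defs yd_mod.defs)
  show "act unit_obj h \<in> mod_hom K unit_obj unit_obj" if "h \<in> carrier H" for h
    using that mod_hom_cong[where f = "act unit_obj h" and g = "\<lambda>x. counit H h \<odot>\<^bsub>ground K\<^esub> x"
        and M = "ground K" and N = "ground K"]
      smult_mod_hom[OF ground_module _ mod_hom_id] by simp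
  show "(\<lambda>h. act unit_obj h m) \<in> mod_hom K H unit_obj" if "m \<in> carrier unit_obj" for m
    using that mod_hom_cong[where f = "\<lambda>h. act unit_obj h m" and g = "\<lambda>h. counit H h \<odot>\<^bsub>ground K\<^esub> m" and M = H
        and N = "ground K"]
    by simp
qed (simp_all add: module.smult_one[of K] module.smult_assoc1[of K])

lemma unit_right_comodule [simp]: "right_comodule K H unit_obj"
proof (rule right_comoduleI)
  show "coact unit_obj \<in> extensional (carrier unit_obj)"
    by (auto simp: yd_unit_def module.defs yd_mod.defs)
  show l: "coact unit_obj \<in> mod_hom K unit_obj (tensor K unit_obj H)"
    using mod_hom_cong[where f = "coact unit_obj" and g = "\<lambda>x. tpure K (ground K) H x \<one>\<^bsub>H\<^esub>" and M = "ground K"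
        and N = "tensor K (ground K) H"]
    by simp
  have [simp]: "(\<lambda>x. tsum P (coact unit_obj x) F) \<in> mod_hom K (ground K) P" if "bilinear_map K (ground K) H P F" "module K P"
    for F and P :: "('k, 'x1, 'x2) module_scheme"
    using l tsum_arg_mod_hom[OF _ that(1), of "coact unit_obj" "ground K"] that by simp
  have [simp]: "x \<in> carrier (ground K)" "y \<in> carrier H"
    if "(x, y) \<in> set (terms (coact unit_obj n))" "n \<in> carrier (ground K)" for x y n
    using terms_carrier[OF that(1), of K "ground K" H] mod_hom_closed[OF l, of n] that(2) by simp_all
  have [simp]: "x \<in> carrier (ground K)" "y \<in> carrier H"
    if "(x, y) \<in> set (terms (tpure K (ground K) H n \<one>\<^bsub>H\<^esub>))" "n \<in> carrier (ground K)" for x y n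
    using terms_carrier[OF that(1), of K "ground K" H] that(2) by simp_all
  show "tsum (tensor K unit_obj HH) (coact unit_obj x) (\<lambda>x y. tsum (tensor K unit_obj HH) (coact unit_obj x) (\<lambda>x0 x1.
          tpure K unit_obj HH x0 (tpure K H H x1 y)))
        = tsum (tensor K unit_obj HH) (coact unit_obj x) (\<lambda>x y. tpure K unit_obj HH x (comult H y))"
    if "x \<in> carrier unit_obj" for x
    using that by (simp add: tsum_tpure bilinear_map_def comult_linear mod_hom_compose[OF tpure_mod_hom_right(1)] comult_one)
  show "tsum unit_obj (coact unit_obj n) (\<lambda>x y. counit H y \<odot>\<^bsub>unit_obj\<^esub> x) = n" if "n \<in> carrier unit_obj" for n
    using that by (simp add: tsum_tpure bilinear_map_def module.smult_one[of K])
qed simp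

text \<open>Both sides collapse to x \<otimes> h, one by the left and the other by the right counit
  axiom.\<close>

lemma unit_yd_module: "yd_module K H (\<one>\<^bsub>A\<^esub>, \<one>\<^bsub>A\<^esub>) unit_obj"
proof -
  interpret A: group A by (rule aut_group)
  note [simp] = aut_rules[OF A.one_closed]
  let ?U = "ground K" and ?P = "tensor K (ground K) H"
  have [simp]: "x \<in> carrier (ground K)" "y \<in> carrier H"
    if "(x, y) \<in> set (terms (tpure K (ground K) H n \<one>\<^bsub>H\<^esub>))" "n \<in> carrier (ground K)" for x y n
    using terms_carrier[OF that(1), of K "ground K" H] that(2) by simp_all
  have "tsum ?P (comult H h) (\<lambda>h1 h2. tsum ?P (tpure K ?U H x \<one>\<^bsub>H\<^esub>) (\<lambda>m0 m1.
            tpure K ?U H (counit H h1 \<odot>\<^bsub>?U\<^esub> m0) (\<one>\<^bsub>A\<^esub> h2 \<otimes>\<^bsub>H\<^esub> m1)))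
        = tsum ?P (comult H h) (\<lambda>h1 h2. tsum ?P (tpure K ?U H (counit H h2 \<odot>\<^bsub>?U\<^esub> x) \<one>\<^bsub>H\<^esub>) (\<lambda>x0 x1.
              tpure K ?U H x0 (x1 \<otimes>\<^bsub>H\<^esub> \<one>\<^bsub>A\<^esub> h1)))"
    if "h \<in> carrier H" "x \<in> carrier ?U" for h x
  proof -
    have "tsum ?P (comult H h) (\<lambda>h1 h2. tsum ?P (tpure K ?U H x \<one>\<^bsub>H\<^esub>) (\<lambda>m0 m1.
            tpure K ?U H (counit H h1 \<odot>\<^bsub>?U\<^esub> m0) (\<one>\<^bsub>A\<^esub> h2 \<otimes>\<^bsub>H\<^esub> m1)))
      = tsum ?P (comult H h) (\<lambda>h1 h2. counit H h1 \<odot>\<^bsub>?P\<^esub> tpure K ?U H x h2)"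
      using that by (simp add: tsum_tpure bilinear_map_def aut_one_apply smult_tpure(1))
    also have "\<dots> = tsum ?P (comult H h) (\<lambda>h1 h2. counit H h2 \<odot>\<^bsub>?P\<^esub> tpure K ?U H x h1)"
      using that by (simp add: counit_left_mod_hom counit_right_mod_hom)
    also have "\<dots> = tsum ?P (comult H h) (\<lambda>h1 h2. tsum ?P (tpure K ?U H (counit H h2 \<odot>\<^bsub>?U\<^esub> x) \<one>\<^bsub>H\<^esub>) (\<lambda>x0 x1.
              tpure K ?U H x0 (x1 \<otimes>\<^bsub>H\<^esub> \<one>\<^bsub>A\<^esub> h1)))"
      using that by (simp add: tsum_tpure bilinear_map_def aut_one_apply smult_tpure(1))
    finally show ?thesis .
  qed
  then show ?thesis
    by (simp add: yd_module_iff)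
qed

end

section \<open>Morphisms of Yetter-Drinfel'd modules\<close>

text \<open>The principle for pure tensors is used twice: on the outer tensor, then with p fixed on
  the inner one.\<close>

lemma tensor_hom_eqI_left:
  assumes f: "f \<in> mod_hom K (tensor K (tensor K M N) P) Q" and g: "g \<in> mod_hom K (tensor K (tensor K M N) P) Q"
    and t: "t \<in> carrier (tensor K (tensor K M N) P)"
    and mods: "module K M" "module K N" "module K P" "module K Q"
    and eq: "\<And>m n p. \<lbrakk>m \<in> carrier M; n \<in> carrier N; p \<in> carrier P\<rbrakk>
      \<Longrightarrow> f (tpure K (tensor K M N) P (tpure K M N m n) p) = g (tpure K (tensor K M N) P (tpure K M N m n) p)"
  shows "f t = g t"
proof (rule tensor_hom_eqI[OF f g t])
  fix s p assume s: "s \<in> carrier (tensor K M N)" and p: "p \<in> carrier P"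
  show "f (tpure K (tensor K M N) P s p) = g (tpure K (tensor K M N) P s p)"
    by (rule tensor_hom_eqI[where f = "\<lambda>s. f (tpure K (tensor K M N) P s p)" and g = "\<lambda>s. g (tpure K (tensor K M N) P s p)"
        and K = K and M = M and N = N and P = Q])
      (use s p mods eq in \<open>auto intro!: mod_hom_compose[OF f] mod_hom_compose[OF g]\<close>)
qed (use mods in simp_all)

lemma tensor_hom_eqI_right:
  assumes f: "f \<in> mod_hom K (tensor K M (tensor K N P)) Q" and g: "g \<in> mod_hom K (tensor K M (tensor K N P)) Q"
    and t: "t \<in> carrier (tensor K M (tensor K N P))"
    and mods: "module K M" "module K N" "module K P" "module K Q"
    and eq: "\<And>m n p. \<lbrakk>m \<in> carrier M; n \<in> carrier N; p \<in> carrier P\<rbrakk>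
      \<Longrightarrow> f (tpure K M (tensor K N P) m (tpure K N P n p)) = g (tpure K M (tensor K N P) m (tpure K N P n p))"
  shows "f t = g t"
proof (rule tensor_hom_eqI[OF f g t])
  fix m s assume m: "m \<in> carrier M" and s: "s \<in> carrier (tensor K N P)"
  show "f (tpure K M (tensor K N P) m s) = g (tpure K M (tensor K N P) m s)"
    by (rule tensor_hom_eqI[where f = "\<lambda>s. f (tpure K M (tensor K N P) m s)" and g = "\<lambda>s. g (tpure K M (tensor K N P) m s)"
        and K = K and M = N and N = P and P = Q])
      (use s m mods eq in \<open>auto intro!: mod_hom_compose[OF f] mod_hom_compose[OF g]\<close>)
qed (use mods in simp_all)

lemma tsum_arg_mod_hom_simp [simp]:
  assumes "bilinear_map K M N P f" "module K M" "module K N" "module K P"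
  shows "(\<lambda>t. tsum P t f) \<in> mod_hom K (tensor K M N) P"
  by (rule tsum_mod_hom[OF assms])

context hopf_algebra
begin

text \<open>Evaluation rules for arbitrary modules agreeing with M and N, since after simplification
  the pure tensors no longer mention the records that carry the action and coaction.\<close>

lemma tensor_pure_rules:
  assumes sm: "same_module M M'" "same_module N N'"
    and mn: "m \<in> carrier M'" "n \<in> carrier N'"
  shows "\<lbrakk>left_module K H M; left_module K H N; h \<in> carrier H\<rbrakk>
      \<Longrightarrow> act (tensor_obj f g M N) h (tpure K M' N' m n)
        = tsum (tensor K M' N') (comult H h) (\<lambda>h1 h2. tpure K M' N' (act M h2 m) (act N h1 n))"
    and "\<lbrakk>right_comodule K H M; right_comodule K H N; f \<in> carrier A; g \<in> carrier A\<rbrakk>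
      \<Longrightarrow> coact (tensor_obj f g M N) (tpure K M' N' m n)
        = tsum (tensor K (tensor K M' N') H) (coact M m) (\<lambda>m0 m1.
          tsum (tensor K (tensor K M' N') H) (coact N n) (\<lambda>n0 n1.
            tpure K (tensor K M' N') H (tpure K M' N' m0 n0) (f m1 \<otimes>\<^bsub>H\<^esub> g n1)))"
    and "\<lbrakk>right_comodule K H M; right_comodule K H N; f \<in> carrier A; g \<in> carrier A;
        bilinear_map K (tensor K M' N') H P F; module K P\<rbrakk>
      \<Longrightarrow> tsum P (coact (tensor_obj f g M N) (tpure K M' N' m n)) F
        = tsum P (coact M m) (\<lambda>m0 m1. tsum P (coact N n) (\<lambda>n0 n1.
            F (tpure K M' N' m0 n0) (f m1 \<otimes>\<^bsub>H\<^esub> g n1)))"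
proof -
  have car: "carrier M = carrier M'" "carrier N = carrier N'"
    using sm by (simp_all add: same_module_def)
  note t = tensor_same[OF sm, symmetric]
  show "\<lbrakk>left_module K H M; left_module K H N; h \<in> carrier H\<rbrakk>
      \<Longrightarrow> act (tensor_obj f g M N) h (tpure K M' N' m n)
        = tsum (tensor K M' N') (comult H h) (\<lambda>h1 h2. tpure K M' N' (act M h2 m) (act N h1 n))"
    unfolding t using mn car by (simp add: act_tensor_pure)
  show "\<lbrakk>right_comodule K H M; right_comodule K H N; f \<in> carrier A; g \<in> carrier A\<rbrakk>
      \<Longrightarrow> coact (tensor_obj f g M N) (tpure K M' N' m n)
        = tsum (tensor K (tensor K M' N') H) (coact M m) (\<lambda>m0 m1.
          tsum (tensor K (tensor K M' N') H) (coact N n) (\<lambda>n0 n1.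
            tpure K (tensor K M' N') H (tpure K M' N' m0 n0) (f m1 \<otimes>\<^bsub>H\<^esub> g n1)))"
    unfolding t using mn car by (simp add: coact_tensor_pure Let_def)
  show "\<lbrakk>right_comodule K H M; right_comodule K H N; f \<in> carrier A; g \<in> carrier A;
        bilinear_map K (tensor K M' N') H P F; module K P\<rbrakk>
      \<Longrightarrow> tsum P (coact (tensor_obj f g M N) (tpure K M' N' m n)) F
        = tsum P (coact M m) (\<lambda>m0 m1. tsum P (coact N n) (\<lambda>n0 n1.
            F (tpure K M' N' m0 n0) (f m1 \<otimes>\<^bsub>H\<^esub> g n1)))"
    unfolding t using mn car by (simp add: tsum_coact_tensor_pure)
qed

text \<open>Morphisms without the extensionality that arrows have, so that composites are plain
  abstractions.\<close>

definition yd_map where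
  "yd_map M N f \<longleftrightarrow> f \<in> mod_hom K M N
    \<and> (\<forall>h\<in>carrier H. \<forall>m\<in>carrier M. f (act M h m) = act N h (f m))
    \<and> (\<forall>m\<in>carrier M. coact N (f m) = tsum (tensor K N H) (coact M m) (\<lambda>m0 m1. tpure K N H (f m0) m1))"

lemma yd_map_mod_hom: "yd_map M N f \<Longrightarrow> f \<in> mod_hom K M N"
  by (simp add: yd_map_def)

lemma yd_map_rules:
  assumes "yd_map M N f"
  shows "m \<in> carrier M \<Longrightarrow> f m \<in> carrier N"
    and "f \<in> mod_hom K M N"
    and "g \<in> mod_hom K X M \<Longrightarrow> (\<lambda>x. f (g x)) \<in> mod_hom K X N"
    and "\<lbrakk>h \<in> carrier H; m \<in> carrier M\<rbrakk> \<Longrightarrow> f (act M h m) = act N h (f m)"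
  using assms mod_hom_compose by (auto simp: yd_map_def mod_hom_closed)

lemma yd_map_coact:
  assumes f: "yd_map M N f" and [simp]: "right_comodule K H M" "right_comodule K H N"
    and m: "m \<in> carrier M" and F: "bilinear_map K N H P F" and P: "module K P"
  shows "tsum P (coact N (f m)) F = tsum P (coact M m) (\<lambda>m0 m1. F (f m0) m1)"
proof -
  note [simp] = yd_map_rules[OF f]
  have "tsum P (coact N (f m)) F = tsum P (tsum (tensor K N H) (coact M m) (\<lambda>m0 m1. tpure K N H (f m0) m1)) F"
    using f m by (simp add: yd_map_def)
  also have "\<dots> = tsum P (coact M m) (\<lambda>m0 m1. F (f m0) m1)"
    using m P by (simp add: tsum_tsum[OF F] tsum_tpure[OF F])
  finally show ?thesis .
qed

lemma yd_map_id:
  assumes "right_comodule K H M"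
  shows "yd_map M M (\<lambda>x. x)"
  using assms by (simp add: yd_map_def tsum_tpure_id)

lemma yd_map_compose:
  assumes f: "yd_map M N f" and g: "yd_map N Q g"
    and [simp]: "right_comodule K H M" "right_comodule K H N" "right_comodule K H Q"
  shows "yd_map M Q (\<lambda>x. g (f x))"
proof -
  note [simp] = yd_map_rules[OF f] yd_map_rules[OF g]
  have "coact Q (g (f m)) = tsum (tensor K Q H) (coact M m) (\<lambda>m0 m1. tpure K Q H (g (f m0)) m1)"
    if m: "m \<in> carrier M" for m
  proof -
    have "coact Q (g (f m)) = tsum (tensor K Q H) (coact N (f m)) (\<lambda>m0 m1. tpure K Q H (g m0) m1)"
      using g m by (simp add: yd_map_def)
    also have "\<dots> = tsum (tensor K Q H) (coact M m) (\<lambda>m0 m1. tpure K Q H (g (f m0)) m1)"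
      using m by (intro yd_map_coact[OF f]) (simp_all add: bilinear_map_def)
    finally show ?thesis .
  qed
  then show ?thesis by (simp add: yd_map_def)
qed

text \<open>Identities for g are checked after applying the injective f. Hence the inverses of the
  associator and of the braiding are morphisms without any Sweedler computation.\<close>

lemma yd_map_inverse:
  assumes f: "yd_map M N f" and [simp]: "left_module K H M" "right_comodule K H M" "right_comodule K H N"
      "left_module K H N"
    and g: "\<And>n. n \<in> carrier N \<Longrightarrow> g n \<in> carrier M"
    and gf: "\<And>m. m \<in> carrier M \<Longrightarrow> g (f m) = m" and fg: "\<And>n. n \<in> carrier N \<Longrightarrow> f (g n) = n"
  shows "yd_map N M g"
proof -
  note [simp] = yd_map_rules[OF f] g gf fg
  have inj: "x = y" if "f x = f y" "x \<in> carrier M" "y \<in> carrier M" for x y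
    using that gf by metis
  have l: "g \<in> mod_hom K N M"
  proof (rule mod_homI)
    show "g (x \<oplus>\<^bsub>N\<^esub> y) = g x \<oplus>\<^bsub>M\<^esub> g y" if "x \<in> carrier N" "y \<in> carrier N" for x y
      by (rule inj) (use that in \<open>simp_all add: mod_hom_add[OF yd_map_mod_hom[OF f]]\<close>)
    show "g (c \<odot>\<^bsub>N\<^esub> x) = c \<odot>\<^bsub>M\<^esub> g x" if "c \<in> carrier K" "x \<in> carrier N" for c x
      by (rule inj) (use that in \<open>simp_all add: mod_hom_smult[OF yd_map_mod_hom[OF f]]\<close>)
  qed simp
  have [simp]: "(\<lambda>x. g (k x)) \<in> mod_hom K X M" if "k \<in> mod_hom K X N" for k and X :: "('k, 'x1, 'x2) module_scheme"
    using mod_hom_compose[OF l that] .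
  have "g (act N h n) = act M h (g n)" if "h \<in> carrier H" "n \<in> carrier N" for h n
    by (rule inj) (use that in simp_all)
  moreover have "coact M (g n) = tsum (tensor K M H) (coact N n) (\<lambda>m0 m1. tpure K M H (g m0) m1)"
    if n: "n \<in> carrier N" for n
  proof -
    \<comment> \<open>Writing n as f (g n) brings in colinearity of f; then g (f m0) = m0 removes
      both maps from the first factor.\<close>
    have "tsum (tensor K M H) (coact N (f (g n))) (\<lambda>m0 m1. tpure K M H (g m0) m1)
      = tsum (tensor K M H) (coact M (g n)) (\<lambda>m0 m1. tpure K M H (g (f m0)) m1)"
      using n by (intro yd_map_coact[OF f]) (simp_all add: bilinear_map_def l)
    then show ?thesis
      using n by (simp add: tsum_tpure_id)
  qed
  ultimately show ?thesis
    using l by (simp add: yd_map_def)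
qed

text \<open>Both conditions on a morphism compare linear maps, so pure tensors suffice, where the
  action and coaction of the tensor object are explicit. The modules M', N', Q' admit records
  already simplified.\<close>

lemma tensor_yd_mapI:
  assumes f: "f \<in> mod_hom K (tensor K M' N') Q'" and sm: "same_module M M'" "same_module N N'" "same_module Q Q'"
    and [simp]: "left_module K H M" "left_module K H N" "left_module K H Q"
      "right_comodule K H M" "right_comodule K H N" "right_comodule K H Q" "p \<in> carrier A" "q \<in> carrier A"
    and act: "\<And>h m n. \<lbrakk>h \<in> carrier H; m \<in> carrier M'; n \<in> carrier N'\<rbrakk>
      \<Longrightarrow> tsum Q' (comult H h) (\<lambda>h1 h2. f (tpure K M' N' (act M h2 m) (act N h1 n)))
        = act Q h (f (tpure K M' N' m n))"
    and coact: "\<And>m n. \<lbrakk>m \<in> carrier M'; n \<in> carrier N'\<rbrakk>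
      \<Longrightarrow> coact Q (f (tpure K M' N' m n)) = tsum (tensor K Q' H) (coact M m) (\<lambda>m0 m1.
          tsum (tensor K Q' H) (coact N n) (\<lambda>n0 n1. tpure K Q' H (f (tpure K M' N' m0 n0)) (p m1 \<otimes>\<^bsub>H\<^esub> q n1)))"
  shows "yd_map (tensor_obj p q M N) Q f"
proof -
  let ?T = "tensor K M N" and ?X = "tensor_obj p q M N" and ?P = "tensor K Q H"
  have car: "carrier M' = carrier M" "carrier N' = carrier N" "carrier Q' = carrier Q"
    using sm by (simp_all add: same_module_def)
  note t = tensor_same[OF sm(1,2), symmetric] mod_hom_same[OF same_module_refl sm(3), symmetric]
    tsum_same[OF sm(3), symmetric] tensor_same[OF sm(3) same_module_refl, symmetric] car
  note f' = f[unfolded t] and act' = act[unfolded t] and coact' = coact[unfolded t]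
  note [simp] = mod_hom_closed[OF f'] mod_hom_compose[OF f'] f'
  have "f (act ?X h t) = act Q h (f t)" if h: "h \<in> carrier H" and t: "t \<in> carrier ?T" for h t
  proof (rule tensor_hom_eqI[where f = "\<lambda>t. f (act ?X h t)" and g = "\<lambda>t. act Q h (f t)" and K = K
        and M = M and N = N and P = Q])
    show "f (act ?X h (tpure K M N m n)) = act Q h (f (tpure K M N m n))"
      if "m \<in> carrier M" "n \<in> carrier N" for m n
      using that h act' by (simp add: tensor_pure_rules mod_hom_tsum[OF f'])
  qed (use h t in simp_all)
  moreover have "coact Q (f t) = tsum ?P (coact ?X t) (\<lambda>m0 m1. tpure K Q H (f m0) m1)"
    if t: "t \<in> carrier ?T" for t
  proof (rule tensor_hom_eqI[where f = "\<lambda>t. coact Q (f t)"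
        and g = "\<lambda>t. tsum ?P (coact ?X t) (\<lambda>m0 m1. tpure K Q H (f m0) m1)" and K = K
        and M = M and N = N and P = ?P])
    show "coact Q (f (tpure K M N m n)) = tsum ?P (coact ?X (tpure K M N m n)) (\<lambda>m0 m1. tpure K Q H (f m0) m1)"
      if "m \<in> carrier M" "n \<in> carrier N" for m n
      using that coact' by (simp add: tensor_pure_rules(3) bilinear_map_def)
  qed (use t in \<open>simp_all add: bilinear_map_def\<close>)
  ultimately show ?thesis
    by (simp add: yd_map_def)
qed

text \<open>\<open>tensor_map\<close> without its restriction to the carrier.\<close>

definition tensor_fun where
  "tensor_fun M' N' f g t = tsum (tensor K M' N') t (\<lambda>m n. tpure K M' N' (f m) (g n))"

lemma tensor_fun_rules:
  assumes f: "f \<in> mod_hom K M M'" and g: "g \<in> mod_hom K N N'"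
    and [simp]: "module K M" "module K N" "module K M'" "module K N'"
  shows "tensor_fun M' N' f g \<in> mod_hom K (tensor K M N) (tensor K M' N')"
    and "\<lbrakk>m \<in> carrier M; n \<in> carrier N\<rbrakk>
      \<Longrightarrow> tensor_fun M' N' f g (tpure K M N m n) = tpure K M' N' (f m) (g n)"
proof -
  note [simp] = mod_hom_closed[OF f] mod_hom_closed[OF g] f g
  show "tensor_fun M' N' f g \<in> mod_hom K (tensor K M N) (tensor K M' N')"
    using tsum_mod_hom[of K M N "tensor K M' N'" "\<lambda>m n. tpure K M' N' (f m) (g n)"]
    by (simp add: tensor_fun_def[abs_def] bilinear_map_def)
  show "\<lbrakk>m \<in> carrier M; n \<in> carrier N\<rbrakk>
      \<Longrightarrow> tensor_fun M' N' f g (tpure K M N m n) = tpure K M' N' (f m) (g n)"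
    by (simp add: tensor_fun_def tsum_tpure bilinear_map_def)
qed

text \<open>Each factor uses its own linearity and colinearity. The two tensor objects share the
  twists p and q, as they do when f and g stay within their components.\<close>

lemma tensor_fun_yd_map:
  assumes f: "yd_map M M' f" and g: "yd_map N N' g"
    and [simp]: "left_module K H M" "left_module K H N" "left_module K H M'" "left_module K H N'"
      "right_comodule K H M" "right_comodule K H N" "right_comodule K H M'" "right_comodule K H N'"
      "p \<in> carrier A" "q \<in> carrier A"
  shows "yd_map (tensor_obj p q M N) (tensor_obj p q M' N') (tensor_fun M' N' f g)"
proof (rule tensor_yd_mapI[of _ M N "tensor K M' N'"])
  note [simp] = yd_map_rules[OF f] yd_map_rules[OF g] aut_rules[OF assms(11)] aut_rules[OF assms(12)]
  note tf = tensor_fun_rules[OF yd_map_mod_hom[OF f] yd_map_mod_hom[OF g]]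
  show "tensor_fun M' N' f g \<in> mod_hom K (tensor K M N) (tensor K M' N')"
    by (rule tf) simp_all
  show "tsum (tensor K M' N') (comult H h) (\<lambda>h1 h2. tensor_fun M' N' f g (tpure K M N (act M h2 m) (act N h1 n)))
        = act (tensor_obj p q M' N') h (tensor_fun M' N' f g (tpure K M N m n))"
    if "h \<in> carrier H" "m \<in> carrier M" "n \<in> carrier N" for h m n
    using that by (simp add: tf tensor_pure_rules)
  show "coact (tensor_obj p q M' N') (tensor_fun M' N' f g (tpure K M N m n))
      = tsum (tensor K (tensor K M' N') H) (coact M m) (\<lambda>m0 m1.
          tsum (tensor K (tensor K M' N') H) (coact N n) (\<lambda>n0 n1.
            tpure K (tensor K M' N') H (tensor_fun M' N' f g (tpure K M N m0 n0)) (p m1 \<otimes>\<^bsub>H\<^esub> q n1)))"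
    if "m \<in> carrier M" "n \<in> carrier N" for m n
    using that by (simp add: tf tensor_pure_rules yd_map_coact[OF f] yd_map_coact[OF g] bilinear_map_def)
qed simp_all

section \<open>Associativity and unit isomorphisms\<close>

lemma tpure_tsum:
  assumes [simp]: "module K M" "module K N"
  shows "\<lbrakk>m \<in> carrier M; \<And>x y. (x, y) \<in> set (terms t) \<Longrightarrow> F x y \<in> carrier N\<rbrakk>
      \<Longrightarrow> tpure K M N m (tsum N t F) = tsum (tensor K M N) t (\<lambda>x y. tpure K M N m (F x y))"
    and "\<lbrakk>n \<in> carrier N; \<And>x y. (x, y) \<in> set (terms t) \<Longrightarrow> F x y \<in> carrier M\<rbrakk>
      \<Longrightarrow> tpure K M N (tsum M t F) n = tsum (tensor K M N) t (\<lambda>x y. tpure K M N (F x y) n)"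
  using mod_hom_tsum[of "\<lambda>x. tpure K M N m x" K N "tensor K M N" t F]
    mod_hom_tsum[of "\<lambda>x. tpure K M N x n" K M "tensor K M N" t F] by simp_all

section \<open>The associator and its inverse\<close>

definition assoc_map where
  "assoc_map M N P t = tsum (tensor K M (tensor K N P)) t (\<lambda>s p.
     tsum (tensor K M (tensor K N P)) s (\<lambda>m n. tpure K M (tensor K N P) m (tpure K N P n p)))"

definition assoc_inv where
  "assoc_inv M N P t = tsum (tensor K (tensor K M N) P) t (\<lambda>m s.
     tsum (tensor K (tensor K M N) P) s (\<lambda>n p. tpure K (tensor K M N) P (tpure K M N m n) p))"

lemma assoc_map_same:
  assumes "same_module M M'" "same_module N N'" "same_module P P'"
  shows "assoc_map M N P = assoc_map M' N' P'" "assoc_inv M N P = assoc_inv M' N' P'"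
proof -
  note [simp] = tensor_same[OF assms(1) same_module_refl] tensor_same[OF assms(2) same_module_refl]
    tensor_same[OF same_module_refl assms(2)] tensor_same[OF same_module_refl assms(3)]
  show "assoc_map M N P = assoc_map M' N' P'" "assoc_inv M N P = assoc_inv M' N' P'"
    by (simp_all add: assoc_map_def assoc_inv_def fun_eq_iff)
qed

lemma assoc_bilinear:
  assumes [simp]: "module K M" "module K N" "module K P"
  shows "bilinear_map K (tensor K M N) P (tensor K M (tensor K N P)) (\<lambda>s p. tsum (tensor K M (tensor K N P)) s
      (\<lambda>m n. tpure K M (tensor K N P) m (tpure K N P n p)))"
    and "bilinear_map K M (tensor K N P) (tensor K (tensor K M N) P) (\<lambda>m s. tsum (tensor K (tensor K M N) P) s
      (\<lambda>n p. tpure K (tensor K M N) P (tpure K M N m n) p))"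
proof -
  show "bilinear_map K (tensor K M N) P (tensor K M (tensor K N P)) (\<lambda>s p. tsum (tensor K M (tensor K N P)) s
      (\<lambda>m n. tpure K M (tensor K N P) m (tpure K N P n p)))"
  proof (rule bilinear_mapI)
    fix s assume "s \<in> carrier (tensor K M N)"
    note [simp] = terms_carrier[OF _ this]
    show "(\<lambda>p. tsum (tensor K M (tensor K N P)) s
      (\<lambda>m n. tpure K M (tensor K N P) m (tpure K N P n p))) \<in> mod_hom K P (tensor K M (tensor K N P))"
      by simp
  qed (simp add: bilinear_map_def)
  show "bilinear_map K M (tensor K N P) (tensor K (tensor K M N) P) (\<lambda>m s. tsum (tensor K (tensor K M N) P) s
      (\<lambda>n p. tpure K (tensor K M N) P (tpure K M N m n) p))"
  proof (rule bilinear_mapI)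
    fix s assume "s \<in> carrier (tensor K N P)"
    note [simp] = terms_carrier[OF _ this]
    show "(\<lambda>m. tsum (tensor K (tensor K M N) P) s
      (\<lambda>n p. tpure K (tensor K M N) P (tpure K M N m n) p)) \<in> mod_hom K M (tensor K (tensor K M N) P)"
      by simp
  qed (simp add: bilinear_map_def)
qed

lemma assoc_mod_hom:
  assumes "same_module M M'" "same_module N N'" "same_module P P'"
    and mods [simp]: "module K M'" "module K N'" "module K P'"
  shows "assoc_map M N P \<in> mod_hom K (tensor K (tensor K M' N') P') (tensor K M' (tensor K N' P'))"
    and "assoc_inv M N P \<in> mod_hom K (tensor K M' (tensor K N' P')) (tensor K (tensor K M' N') P')"
  using tsum_mod_hom[OF assoc_bilinear(1)[OF mods]] tsum_mod_hom[OF assoc_bilinear(2)[OF mods]]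
  unfolding assoc_map_same[OF assms(1-3)] by (simp_all add: assoc_map_def[abs_def] assoc_inv_def[abs_def])

lemma assoc_pure:
  assumes "same_module M M'" "same_module N N'" "same_module P P'"
    and mods [simp]: "module K M'" "module K N'" "module K P'"
    and mnp: "m \<in> carrier M'" "n \<in> carrier N'" "p \<in> carrier P'"
  shows "assoc_map M N P (tpure K (tensor K M' N') P' (tpure K M' N' m n) p)
      = tpure K M' (tensor K N' P') m (tpure K N' P' n p)"
    and "assoc_inv M N P (tpure K M' (tensor K N' P') m (tpure K N' P' n p))
      = tpure K (tensor K M' N') P' (tpure K M' N' m n) p"
  using mnp unfolding assoc_map_same[OF assms(1-3)] assoc_map_def assoc_inv_def
  by (simp_all add: tsum_tpure[OF assoc_bilinear(1)] tsum_tpure[OF assoc_bilinear(2)] tsum_tpure bilinear_map_def)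

lemma assoc_inverse:
  assumes mods [simp]: "module K M" "module K N" "module K P"
  shows "t \<in> carrier (tensor K (tensor K M N) P) \<Longrightarrow> assoc_inv M N P (assoc_map M N P t) = t"
    and "u \<in> carrier (tensor K M (tensor K N P)) \<Longrightarrow> assoc_map M N P (assoc_inv M N P u) = u"
proof -
  note h = assoc_mod_hom[OF same_module_refl same_module_refl same_module_refl mods]
  note [simp] = assoc_pure mod_hom_compose[OF h(1) h(2)] mod_hom_compose[OF h(2) h(1)]
  show "assoc_inv M N P (assoc_map M N P t) = t" if "t \<in> carrier (tensor K (tensor K M N) P)"
    by (rule tensor_hom_eqI_left[where f = "\<lambda>t. assoc_inv M N P (assoc_map M N P t)" and g = "\<lambda>t. t"
          and Q = "tensor K (tensor K M N) P", OF _ _ that]) simp_all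
  show "assoc_map M N P (assoc_inv M N P u) = u" if "u \<in> carrier (tensor K M (tensor K N P))"
    by (rule tensor_hom_eqI_right[where f = "\<lambda>u. assoc_map M N P (assoc_inv M N P u)" and g = "\<lambda>t. t"
          and Q = "tensor K M (tensor K N P)", OF _ _ that]) simp_all
qed

text \<open>Linearity is coassociativity of the comultiplication. Colinearity compares the twists
  that the two bracketings put on the coefficients of the three factors: p r with p', p s with q'
  r', and q with q' s'.\<close>

lemma assoc_yd_map:
  assumes [simp]: "left_module K H M" "left_module K H N" "left_module K H P"
      "right_comodule K H M" "right_comodule K H N" "right_comodule K H P"
    and aut [simp]: "p \<in> carrier A" "q \<in> carrier A" "r \<in> carrier A" "s \<in> carrier A"
      "p' \<in> carrier A" "q' \<in> carrier A" "r' \<in> carrier A" "s' \<in> carrier A"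
    and eqs: "\<And>h. h \<in> carrier H \<Longrightarrow> p' h = p (r h)" "\<And>h. h \<in> carrier H \<Longrightarrow> p (s h) = q' (r' h)"
      "\<And>h. h \<in> carrier H \<Longrightarrow> q h = q' (s' h)"
  shows "yd_map (tensor_obj p q (tensor_obj r s M N) P) (tensor_obj p' q' M (tensor_obj r' s' N P)) (assoc_map M N P)"
proof (rule tensor_yd_mapI[of _ "tensor K M N" P "tensor K M (tensor K N P)"])
  let ?f = "assoc_map M N P" and ?MN = "tensor_obj r s M N" and ?NP = "tensor_obj r' s' N P"
  let ?Q = "tensor K M (tensor K N P)" and ?X = "tensor_obj p' q' M (tensor_obj r' s' N P)"
  let ?QH = "tensor K (tensor K M (tensor K N P)) H"
  note [simp] = aut_rules[OF aut(1)] aut_rules[OF aut(2)] aut_rules[OF aut(3)] aut_rules[OF aut(4)]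
    aut_rules[OF aut(5)] aut_rules[OF aut(6)] aut_rules[OF aut(7)] aut_rules[OF aut(8)]
  have f [simp]: "?f \<in> mod_hom K (tensor K (tensor K M N) P) ?Q"
    by (rule assoc_mod_hom) simp_all
  note [simp] = mod_hom_closed[OF f] mod_hom_compose[OF f]
  show "?f \<in> mod_hom K (tensor K (tensor K M N) P) ?Q" by simp
  let ?la = "\<lambda>h x t. tsum ?Q (comult H h) (\<lambda>h1 h2. ?f (tpure K (tensor K M N) P (act ?MN h2 t) (act P h1 x)))"
  let ?ra = "\<lambda>h x t. act ?X h (?f (tpure K (tensor K M N) P t x))"
  show "?la h x t = ?ra h x t" if h: "h \<in> carrier H" and t: "t \<in> carrier (tensor K M N)" and x: "x \<in> carrier P" for h t x
  proof (rule tensor_hom_eqI[where K = K and M = M and N = N and P = ?Q and f = "?la h x" and g = "?ra h x"])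
    fix m n assume mn: "m \<in> carrier M" "n \<in> carrier N"
    have "?la h x (tpure K M N m n) = tsum ?Q (comult H h) (\<lambda>h1 h2. tsum ?Q (comult H h2) (\<lambda>a b.
          tpure K M (tensor K N P) (act M b m) (tpure K N P (act N a n) (act P h1 x))))"
      using h x mn by (simp add: tensor_pure_rules(1) tpure_tsum mod_hom_tsum[OF f] assoc_pure)
    also have "\<dots> = tsum ?Q (comult H h) (\<lambda>y b. tsum ?Q (comult H y) (\<lambda>h1 a.
          tpure K M (tensor K N P) (act M b m) (tpure K N P (act N a n) (act P h1 x))))"
      using h x mn by (intro comult_coassoc[symmetric]) (simp_all add: trilinear_map_def bilinear_map_def)
    also have "\<dots> = ?ra h x (tpure K M N m n)"
      using h x mn by (simp add: tensor_pure_rules(1) tpure_tsum assoc_pure)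
    finally show "?la h x (tpure K M N m n) = ?ra h x (tpure K M N m n)" .
  qed (use h t x in simp_all)
  let ?lc = "\<lambda>x t. coact ?X (?f (tpure K (tensor K M N) P t x))"
  let ?rc = "\<lambda>x t. tsum ?QH (coact ?MN t) (\<lambda>m0 m1.
      tsum ?QH (coact P x) (\<lambda>n0 n1. tpure K ?Q H (?f (tpure K (tensor K M N) P m0 n0)) (p m1 \<otimes>\<^bsub>H\<^esub> q n1)))"
  show "?lc x t = ?rc x t" if t: "t \<in> carrier (tensor K M N)" and x: "x \<in> carrier P" for t x
  proof (rule tensor_hom_eqI[where K = K and M = M and N = N and P = ?QH and f = "?lc x" and g = "?rc x"])
    fix m n assume mn: "m \<in> carrier M" "n \<in> carrier N"
    have "?lc x (tpure K M N m n) = tsum ?QH (coact M m) (\<lambda>m0 m1. tsum ?QH (coact ?NP (tpure K N P n x)) (\<lambda>u v.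
          tpure K ?Q H (tpure K M (tensor K N P) m0 u) (p' m1 \<otimes>\<^bsub>H\<^esub> q' v)))"
      using x mn by (simp add: assoc_pure tensor_pure_rules(2)[where M' = M and N' = "tensor K N P"])
    also have "\<dots> = tsum ?QH (coact M m) (\<lambda>m0 m1. tsum ?QH (coact N n) (\<lambda>n0 n1. tsum ?QH (coact P x) (\<lambda>x0 x1.
          tpure K ?Q H (tpure K M (tensor K N P) m0 (tpure K N P n0 x0)) (p (r m1 \<otimes>\<^bsub>H\<^esub> s n1) \<otimes>\<^bsub>H\<^esub> q x1))))"
      using x mn by (simp add: tensor_pure_rules(3) bilinear_map_def eqs H.m_assoc)
    also have "\<dots> = ?rc x (tpure K M N m n)"
      using x mn by (simp add: tensor_pure_rules(3) bilinear_map_def assoc_pure)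
    finally show "?lc x (tpure K M N m n) = ?rc x (tpure K M N m n)" .
  qed (use t x in \<open>simp_all add: bilinear_map_def\<close>)
qed simp_all

section \<open>The unit isomorphisms\<close>

definition lunit_map where
  "lunit_map M t = tsum M t (\<lambda>x m. scalar x \<odot>\<^bsub>M\<^esub> m)"

definition runit_map where
  "runit_map M t = tsum M t (\<lambda>m x. scalar x \<odot>\<^bsub>M\<^esub> m)"

lemma scalar_closed [simp]: "x \<in> carrier (ground K) \<Longrightarrow> scalar x \<in> carrier K"
  by (auto simp: ground_def)

lemma one_ground_closed [simp]: "Scalar \<one>\<^bsub>K\<^esub> \<in> carrier (ground K)"
  by (simp add: ground_def)

lemma scalar_smult [simp]: "scalar (c \<odot>\<^bsub>ground K\<^esub> x) = c \<otimes>\<^bsub>K\<^esub> scalar x"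
  by (simp add: ground_def)

lemma ground_smult_one: "x \<in> carrier (ground K) \<Longrightarrow> scalar x \<odot>\<^bsub>ground K\<^esub> Scalar \<one>\<^bsub>K\<^esub> = x"
  by (auto simp: ground_def)

lemma scalar_smult_mod_hom [simp]:
  assumes "module K M" "m \<in> carrier M"
  shows "(\<lambda>x. scalar x \<odot>\<^bsub>M\<^esub> m) \<in> mod_hom K (ground K) M"
proof -
  interpret M: module K M by (rule assms)
  show ?thesis
    using assms(2) by (intro mod_homI) (auto simp: ground_def M.smult_l_distr M.smult_assoc1)
qed

lemma unit_maps_mod_hom:
  assumes [simp]: "module K M"
  shows "lunit_map M \<in> mod_hom K (tensor K (ground K) M) M"
    and "runit_map M \<in> mod_hom K (tensor K M (ground K)) M"
proof -
  have "(\<lambda>t. lunit_map M t) \<in> mod_hom K (tensor K (ground K) M) M"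
    unfolding lunit_map_def by (simp add: bilinear_map_def)
  then show "lunit_map M \<in> mod_hom K (tensor K (ground K) M) M" by simp
  have "(\<lambda>t. runit_map M t) \<in> mod_hom K (tensor K M (ground K)) M"
    unfolding runit_map_def by (simp add: bilinear_map_def)
  then show "runit_map M \<in> mod_hom K (tensor K M (ground K)) M" by simp
qed

lemma unit_maps_pure:
  assumes [simp]: "module K M" and "x \<in> carrier (ground K)" "m \<in> carrier M"
  shows "lunit_map M (tpure K (ground K) M x m) = scalar x \<odot>\<^bsub>M\<^esub> m"
    and "runit_map M (tpure K M (ground K) m x) = scalar x \<odot>\<^bsub>M\<^esub> m"
  using assms(2,3) by (simp_all add: lunit_map_def runit_map_def tsum_tpure bilinear_map_def)

text \<open>Every x in the ground field is the multiple of 1 by its own scalar, and this scalar may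
  be moved across the tensor sign.\<close>

lemma unit_maps_inverse:
  assumes [simp]: "module K M"
  shows "t \<in> carrier (tensor K (ground K) M) \<Longrightarrow> tpure K (ground K) M (Scalar \<one>\<^bsub>K\<^esub>) (lunit_map M t) = t"
    and "u \<in> carrier (tensor K M (ground K)) \<Longrightarrow> tpure K M (ground K) (runit_map M u) (Scalar \<one>\<^bsub>K\<^esub>) = u"
    and "m \<in> carrier M \<Longrightarrow> lunit_map M (tpure K (ground K) M (Scalar \<one>\<^bsub>K\<^esub>) m) = m"
    and "m \<in> carrier M \<Longrightarrow> runit_map M (tpure K M (ground K) m (Scalar \<one>\<^bsub>K\<^esub>)) = m"
proof -
  note [simp] = unit_maps_mod_hom unit_maps_pure ground_smult_one module.smult_one[of K]
  show "tpure K (ground K) M (Scalar \<one>\<^bsub>K\<^esub>) (lunit_map M t) = t" if "t \<in> carrier (tensor K (ground K) M)"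
    by (rule tensor_hom_eqI[where f = "\<lambda>t. tpure K (ground K) M (Scalar \<one>\<^bsub>K\<^esub>) (lunit_map M t)" and g = "\<lambda>t. t"
          and P = "tensor K (ground K) M",
          OF _ _ that])
      (simp_all flip: smult_tpure(2), simp_all add: smult_tpure(1))
  show "tpure K M (ground K) (runit_map M u) (Scalar \<one>\<^bsub>K\<^esub>) = u" if "u \<in> carrier (tensor K M (ground K))"
    by (rule tensor_hom_eqI[where f = "\<lambda>u. tpure K M (ground K) (runit_map M u) (Scalar \<one>\<^bsub>K\<^esub>)" and g = "\<lambda>t. t"
          and P = "tensor K M (ground K)",
          OF _ _ that])
      (simp_all flip: smult_tpure(1), simp_all add: smult_tpure(2))
qed (simp_all add: unit_maps_pure module.smult_one[of K])

lemma act_smult: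
  "\<lbrakk>left_module K H M; h \<in> carrier H; c \<in> carrier K; m \<in> carrier M\<rbrakk> \<Longrightarrow> act M h (c \<odot>\<^bsub>M\<^esub> m) = c \<odot>\<^bsub>M\<^esub> act M h m"
  by (rule mod_hom_smult[OF act_mod_hom(1)])

lemma coact_smult:
  "\<lbrakk>right_comodule K H M; c \<in> carrier K; m \<in> carrier M\<rbrakk> \<Longrightarrow> coact M (c \<odot>\<^bsub>M\<^esub> m) = c \<odot>\<^bsub>tensor K M H\<^esub> coact M m"
  by (rule mod_hom_smult[OF coact_mod_hom])

lemma smult_tsum:
  "\<lbrakk>module K M; c \<in> carrier K; \<And>x y. (x, y) \<in> set (terms t) \<Longrightarrow> F x y \<in> carrier M\<rbrakk>
    \<Longrightarrow> c \<odot>\<^bsub>M\<^esub> tsum M t F = tsum M t (\<lambda>x y. c \<odot>\<^bsub>M\<^esub> F x y)"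
  by (rule mod_hom_tsum[of "\<lambda>x. c \<odot>\<^bsub>M\<^esub> x" K]) simp_all

text \<open>The unit object takes the second leg of h, so linearity is the right counit axiom. Its
  coefficient is 1, which p fixes, and the coefficients of M remain as they are because q is the
  identity.\<close>

lemma lunit_yd_map:
  assumes [simp]: "left_module K H M" "right_comodule K H M" and aut [simp]: "p \<in> carrier A" "q \<in> carrier A"
    and q: "\<And>h. h \<in> carrier H \<Longrightarrow> q h = h"
  shows "yd_map (tensor_obj p q unit_obj M) M (lunit_map M)"
proof (rule tensor_yd_mapI[of _ "ground K" M M])
  let ?P = "tensor K M H"
  note [simp] = aut_rules[OF aut(1)] aut_rules[OF aut(2)]
  show "tsum M (comult H h) (\<lambda>h1 h2. lunit_map M (tpure K (ground K) M (act unit_obj h2 x) (act M h1 n)))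
        = act M h (lunit_map M (tpure K (ground K) M x n))"
    if "h \<in> carrier H" "x \<in> carrier (ground K)" "n \<in> carrier M" for h x n
  proof -
    have "tsum M (comult H h) (\<lambda>h1 h2. lunit_map M (tpure K (ground K) M (act unit_obj h2 x) (act M h1 n)))
      = tsum M (comult H h) (\<lambda>h1 h2. counit H h2 \<odot>\<^bsub>M\<^esub> (act M h1 (scalar x \<odot>\<^bsub>M\<^esub> n)))"
      using that by (simp add: unit_maps_pure module.smult_assoc1[of K] act_smult)
    also have "\<dots> = act M h (scalar x \<odot>\<^bsub>M\<^esub> n)"
      using that by (intro counit_right_mod_hom) simp_all
    finally show ?thesis
      using that by (simp add: unit_maps_pure)
  qed
  show "coact M (lunit_map M (tpure K (ground K) M x n)) = tsum ?P (coact unit_obj x) (\<lambda>m0 m1.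
          tsum ?P (coact M n) (\<lambda>n0 n1. tpure K M H (lunit_map M (tpure K (ground K) M m0 n0)) (p m1 \<otimes>\<^bsub>H\<^esub> q n1)))"
    if x: "x \<in> carrier (ground K)" and n: "n \<in> carrier M" for x n
  proof -
    note [simp] = unit_maps_mod_hom mod_hom_compose[OF unit_maps_mod_hom(1)]
    have "tsum ?P (coact unit_obj x) (\<lambda>m0 m1. tsum ?P (coact M n) (\<lambda>n0 n1.
          tpure K M H (lunit_map M (tpure K (ground K) M m0 n0)) (p m1 \<otimes>\<^bsub>H\<^esub> q n1)))
      = tsum ?P (coact M n) (\<lambda>n0 n1. tpure K M H (scalar x \<odot>\<^bsub>M\<^esub> n0) n1)"
      using x n by (simp add: tsum_tpure bilinear_map_def unit_maps_pure q)
    also have "\<dots> = scalar x \<odot>\<^bsub>?P\<^esub> tsum ?P (coact M n) (tpure K M H)"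
      using x n by (simp add: smult_tsum smult_tpure(1))
    finally show ?thesis
      using x n by (simp add: unit_maps_pure coact_smult tsum_tpure_id)
  qed
qed (simp_all add: unit_maps_mod_hom)

text \<open>The mirror image of \<open>lunit_yd_map\<close>: the unit object now takes the first
  leg, which calls for the left counit axiom.\<close>

lemma runit_yd_map:
  assumes [simp]: "left_module K H M" "right_comodule K H M" and aut [simp]: "p \<in> carrier A" "q \<in> carrier A"
    and p: "\<And>h. h \<in> carrier H \<Longrightarrow> p h = h"
  shows "yd_map (tensor_obj p q M unit_obj) M (runit_map M)"
proof (rule tensor_yd_mapI[of _ M "ground K" M])
  let ?P = "tensor K M H"
  note [simp] = aut_rules[OF aut(1)] aut_rules[OF aut(2)]
  show "tsum M (comult H h) (\<lambda>h1 h2. runit_map M (tpure K M (ground K) (act M h2 n) (act unit_obj h1 x)))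
        = act M h (runit_map M (tpure K M (ground K) n x))"
    if "h \<in> carrier H" "n \<in> carrier M" "x \<in> carrier (ground K)" for h x n
  proof -
    have "tsum M (comult H h) (\<lambda>h1 h2. runit_map M (tpure K M (ground K) (act M h2 n) (act unit_obj h1 x)))
      = tsum M (comult H h) (\<lambda>h1 h2. counit H h1 \<odot>\<^bsub>M\<^esub> (act M h2 (scalar x \<odot>\<^bsub>M\<^esub> n)))"
      using that by (simp add: unit_maps_pure module.smult_assoc1[of K] act_smult)
    also have "\<dots> = act M h (scalar x \<odot>\<^bsub>M\<^esub> n)"
      using that by (intro counit_left_mod_hom) simp_all
    finally show ?thesis
      using that by (simp add: unit_maps_pure)
  qed
  show "coact M (runit_map M (tpure K M (ground K) n x)) = tsum ?P (coact M n) (\<lambda>n0 n1.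
          tsum ?P (coact unit_obj x) (\<lambda>m0 m1. tpure K M H (runit_map M (tpure K M (ground K) n0 m0)) (p n1 \<otimes>\<^bsub>H\<^esub> q m1)))"
    if n: "n \<in> carrier M" and x: "x \<in> carrier (ground K)" for x n
  proof -
    note [simp] = unit_maps_mod_hom mod_hom_compose[OF unit_maps_mod_hom(2)]
    have "tsum ?P (coact M n) (\<lambda>n0 n1. tsum ?P (coact unit_obj x) (\<lambda>m0 m1.
          tpure K M H (runit_map M (tpure K M (ground K) n0 m0)) (p n1 \<otimes>\<^bsub>H\<^esub> q m1)))
      = tsum ?P (coact M n) (\<lambda>n0 n1. tpure K M H (scalar x \<odot>\<^bsub>M\<^esub> n0) n1)"
      using x n by (simp add: tsum_tpure bilinear_map_def unit_maps_pure p)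
    also have "\<dots> = scalar x \<odot>\<^bsub>?P\<^esub> tsum ?P (coact M n) (tpure K M H)"
      using x n by (simp add: smult_tsum smult_tpure(1))
    finally show ?thesis
      using x n by (simp add: unit_maps_pure coact_smult tsum_tpure_id)
  qed
qed (simp_all add: unit_maps_mod_hom)

section \<open>The braiding\<close>

text \<open>The parameter a is meant to be \<alpha>\<inverse> for M of index (\<alpha>,
  \<beta>).\<close>

definition braid where
  "braid a M N t = tsum (tensor K N M) t (\<lambda>m n. tsum (tensor K N M) (coact M m) (\<lambda>m0 m1.
     tpure K N M (act N (a m1) n) m0))"

definition braid_inv where
  "braid_inv a M N t = tsum (tensor K M N) t (\<lambda>n m. tsum (tensor K M N) (coact M m) (\<lambda>m0 m1.
     tpure K M N m0 (act N (a (antipode H m1)) n)))"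

lemma braid_rules:
  assumes [simp]: "right_comodule K H M" "left_module K H N" and a: "a \<in> carrier A"
    and sm: "same_module M M'" "same_module N N'"
  shows "braid a M N \<in> mod_hom K (tensor K M' N') (tensor K N' M')"
    and "\<lbrakk>m \<in> carrier M'; n \<in> carrier N'\<rbrakk> \<Longrightarrow> braid a M N (tpure K M' N' m n)
      = tsum (tensor K N' M') (coact M m) (\<lambda>m0 m1. tpure K N' M' (act N (a m1) n) m0)"
    and "braid_inv a M N \<in> mod_hom K (tensor K N' M') (tensor K M' N')"
    and "\<lbrakk>m \<in> carrier M'; n \<in> carrier N'\<rbrakk> \<Longrightarrow> braid_inv a M N (tpure K N' M' n m)
      = tsum (tensor K M' N') (coact M m) (\<lambda>m0 m1. tpure K M' N' m0 (act N (a (antipode H m1)) n))"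
proof -
  note [simp] = aut_rules[OF a]
  have car: "carrier M' = carrier M" "carrier N' = carrier N"
    using sm by (simp_all add: same_module_def)
  note t = tensor_same[OF sm, symmetric] tensor_same[OF sm(2,1), symmetric]
  have b1: "bilinear_map K M N (tensor K N M) (\<lambda>m n. tsum (tensor K N M) (coact M m) (\<lambda>m0 m1.
     tpure K N M (act N (a m1) n) m0))"
    by (simp add: bilinear_map_def)
  have b2: "bilinear_map K N M (tensor K M N) (\<lambda>n m. tsum (tensor K M N) (coact M m) (\<lambda>m0 m1.
     tpure K M N m0 (act N (a (antipode H m1)) n)))"
    by (simp add: bilinear_map_def)
  show "braid a M N \<in> mod_hom K (tensor K M' N') (tensor K N' M')"
    "braid_inv a M N \<in> mod_hom K (tensor K N' M') (tensor K M' N')"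
    using tsum_mod_hom[OF b1] tsum_mod_hom[OF b2] unfolding t by (simp_all add: braid_def[abs_def] braid_inv_def[abs_def])
  show "\<lbrakk>m \<in> carrier M'; n \<in> carrier N'\<rbrakk> \<Longrightarrow> braid a M N (tpure K M' N' m n)
      = tsum (tensor K N' M') (coact M m) (\<lambda>m0 m1. tpure K N' M' (act N (a m1) n) m0)"
    "\<lbrakk>m \<in> carrier M'; n \<in> carrier N'\<rbrakk> \<Longrightarrow> braid_inv a M N (tpure K N' M' n m)
      = tsum (tensor K M' N') (coact M m) (\<lambda>m0 m1. tpure K M' N' m0 (act N (a (antipode H m1)) n))"
    unfolding t car by (simp_all add: braid_def braid_inv_def tsum_tpure[OF b1] tsum_tpure[OF b2])
qed

text \<open>After coassociativity the two composites act on n through S(y1) y2 and y1 S(y2)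
  respectively. Each antipode axiom cancels one of them and the counit axiom restores m, so S itself
  occurs in the inverse.\<close>

lemma braid_inverse:
  assumes [simp]: "right_comodule K H M" "left_module K H N" and a: "a \<in> carrier A"
  shows "t \<in> carrier (tensor K M N) \<Longrightarrow> braid_inv a M N (braid a M N t) = t"
    and "u \<in> carrier (tensor K N M) \<Longrightarrow> braid a M N (braid_inv a M N u) = u"
proof -
  note [simp] = aut_rules[OF a]
  note b = braid_rules[OF assms(1,2) a same_module_refl same_module_refl]
  note [simp] = mod_hom_compose[OF b(1) b(3)] mod_hom_compose[OF b(3) b(1)]
  let ?P = "tensor K M N" and ?Q = "tensor K N M"
  show "braid_inv a M N (braid a M N t) = t" if "t \<in> carrier (tensor K M N)"
  proof (rule tensor_hom_eqI[where f = "\<lambda>t. braid_inv a M N (braid a M N t)" and g = "\<lambda>t. t" and P = ?P,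
        OF _ _ that])
    fix m n assume mn: "m \<in> carrier M" "n \<in> carrier N"
    have "braid_inv a M N (braid a M N (tpure K M N m n))
      = tsum ?P (coact M m) (\<lambda>x y. tsum ?P (coact M x) (\<lambda>m0 m1.
          tpure K M N m0 (act N (a (antipode H m1 \<otimes>\<^bsub>H\<^esub> y)) n)))"
      using mn by (simp add: b mod_hom_tsum[OF b(3)] act_mult)
    also have "\<dots> = tsum ?P (coact M m) (\<lambda>m0 y. tsum ?P (comult H y) (\<lambda>y1 y2.
          tpure K M N m0 (act N (a (antipode H y1 \<otimes>\<^bsub>H\<^esub> y2)) n)))"
      using mn by (intro coact_coassoc) (simp_all add: trilinear_map_def bilinear_map_def)
    also have "\<dots> = tsum ?P (coact M m) (\<lambda>m0 y. counit H y \<odot>\<^bsub>?P\<^esub> tpure K M N m0 (act N (a \<one>\<^bsub>H\<^esub>) n))"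
      using mn by (intro tsum_cong HOL.refl antipode_left_mod_hom[where F = "\<lambda>z. tpure K M N _ (act N (a z) n)"]) simp_all
    also have "\<dots> = tpure K M N m (act N (a \<one>\<^bsub>H\<^esub>) n)"
      using mn by (intro counit_coact_mod_hom) simp_all
    finally show "braid_inv a M N (braid a M N (tpure K M N m n)) = tpure K M N m n"
      using mn by (simp add: act_one)
  qed simp_all
  show "braid a M N (braid_inv a M N u) = u" if "u \<in> carrier (tensor K N M)"
  proof (rule tensor_hom_eqI[where f = "\<lambda>u. braid a M N (braid_inv a M N u)" and g = "\<lambda>t. t" and P = ?Q,
        OF _ _ that])
    fix n m assume mn: "n \<in> carrier N" "m \<in> carrier M"
    have "braid a M N (braid_inv a M N (tpure K N M n m))
      = tsum ?Q (coact M m) (\<lambda>x y. tsum ?Q (coact M x) (\<lambda>m0 m1.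
          tpure K N M (act N (a (m1 \<otimes>\<^bsub>H\<^esub> antipode H y)) n) m0))"
      using mn by (simp add: b mod_hom_tsum[OF b(1)] act_mult)
    also have "\<dots> = tsum ?Q (coact M m) (\<lambda>m0 y. tsum ?Q (comult H y) (\<lambda>y1 y2.
          tpure K N M (act N (a (y1 \<otimes>\<^bsub>H\<^esub> antipode H y2)) n) m0))"
      using mn by (intro coact_coassoc) (simp_all add: trilinear_map_def bilinear_map_def)
    also have "\<dots> = tsum ?Q (coact M m) (\<lambda>m0 y. counit H y \<odot>\<^bsub>?Q\<^esub> tpure K N M (act N (a \<one>\<^bsub>H\<^esub>) n) m0)"
      using mn by (intro tsum_cong HOL.refl antipode_right_mod_hom[where F = "\<lambda>z. tpure K N M (act N (a z) n) _"]) simp_all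
    also have "\<dots> = tpure K N M (act N (a \<one>\<^bsub>H\<^esub>) n) m"
      using mn by (intro counit_coact_mod_hom) simp_all
    finally show "braid a M N (braid_inv a M N (tpure K N M n m)) = tpure K N M n m"
      using mn by (simp add: act_one)
  qed simp_all
qed

text \<open>Linearity is the condition for M read from right to left, colinearity the condition for
  N at a(y) with y a coefficient of m. The relations for \<kappa>, \<mu> and \<zeta> say that the
  twists on the target agree with what these two conditions produce.\<close>

lemma braid_yd_map:
  assumes M: "yd_module K H (\<alpha>, \<beta>) M" and N: "yd_module K H (\<gamma>, \<delta>) N"
    and aut: "\<alpha> \<in> carrier A" "\<beta> \<in> carrier A" "\<gamma> \<in> carrier A" "\<delta> \<in> carrier A" "\<epsilon> \<in> carrier A"
      "a \<in> carrier A" "\<kappa> \<in> carrier A" "\<mu> \<in> carrier A" "\<zeta> \<in> carrier A"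
    and a: "\<And>h. h \<in> carrier H \<Longrightarrow> a (\<alpha> h) = h" "\<And>h. h \<in> carrier H \<Longrightarrow> \<alpha> (a h) = h"
    and \<epsilon>: "\<And>h. h \<in> carrier H \<Longrightarrow> \<epsilon> (\<delta> h) = \<delta> (\<alpha> h)"
    and \<kappa>: "\<And>h. h \<in> carrier H \<Longrightarrow> \<kappa> h = a (\<beta> h)"
    and \<mu>: "\<And>h. h \<in> carrier H \<Longrightarrow> \<beta> (\<mu> h) = \<epsilon> h"
    and \<zeta>: "\<And>h. h \<in> carrier H \<Longrightarrow> \<zeta> h = \<epsilon> (\<gamma> (a h))"
  shows "yd_map (tensor_obj \<delta> \<epsilon> M N) (tensor_obj \<beta> \<zeta> (conj_obj \<kappa> \<mu> N) M) (braid a M N)"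
proof (rule tensor_yd_mapI[of _ M N "tensor K N M"])
  have M' [simp]: "left_module K H M" "right_comodule K H M" and N' [simp]: "left_module K H N" "right_comodule K H N"
    using M N by (auto simp: yd_module_iff)
  note [simp] = aut aut_rules[OF aut(1)] aut_rules[OF aut(2)] aut_rules[OF aut(3)] aut_rules[OF aut(4)]
    aut_rules[OF aut(5)] aut_rules[OF aut(6)] aut_rules[OF aut(7)] aut_rules[OF aut(8)] aut_rules[OF aut(9)] a
  let ?Q = "tensor K N M" and ?QH = "tensor K (tensor K N M) H" and ?Y = "tensor_obj \<beta> \<zeta> (conj_obj \<kappa> \<mu> N) M"
  let ?E = "\<lambda>x y z. tpure K (tensor K N M) H (tpure K N M x y) z"
  note b = braid_rules[OF M'(2) N'(1) aut(6) same_module_refl same_module_refl]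
  show "braid a M N \<in> mod_hom K (tensor K M N) ?Q" by (rule b)
  show "tsum ?Q (comult H h) (\<lambda>h1 h2. braid a M N (tpure K M N (act M h2 m) (act N h1 n)))
        = act ?Y h (braid a M N (tpure K M N m n))"
    if h: "h \<in> carrier H" and mn: "m \<in> carrier M" "n \<in> carrier N" for h m n
  proof -
    \<comment> \<open>The leg h1 is written as a(\<alpha>(h1)), which creates the product with
      \<alpha>(h1) on the right side of the condition for M.\<close>
    have "tsum ?Q (comult H h) (\<lambda>h1 h2. braid a M N (tpure K M N (act M h2 m) (act N h1 n)))
      = tsum ?Q (comult H h) (\<lambda>h1 h2. tsum ?Q (coact M (act M h2 m)) (\<lambda>x0 x1.
          tpure K N M (act N (a (x1 \<otimes>\<^bsub>H\<^esub> \<alpha> h1)) n) x0))"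
      using h mn by (simp add: b act_mult)
    also have "\<dots> = tsum ?Q (comult H h) (\<lambda>h1 h2. tsum ?Q (coact M m) (\<lambda>m0 m1.
          tpure K N M (act N (a (\<beta> h2 \<otimes>\<^bsub>H\<^esub> m1)) n) (act M h1 m0)))"
      using h mn by (intro yd_compat[OF M aut(1,2), symmetric]) (simp_all add: bilinear_map_def)
    also have "\<dots> = tsum ?Q (coact M m) (\<lambda>m0 m1. tsum ?Q (comult H h) (\<lambda>h1 h2.
          tpure K N M (act N (a (\<beta> h2 \<otimes>\<^bsub>H\<^esub> m1)) n) (act M h1 m0)))"
      using h mn by (intro tsum_swap[of K]) simp_all
    also have "\<dots> = act ?Y h (braid a M N (tpure K M N m n))"
      using h mn by (simp add: b mod_hom_tsum[of "act ?Y h" K ?Q ?Q] tensor_pure_rules(1) act_mult \<kappa>)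
    finally show ?thesis .
  qed
  show "coact ?Y (braid a M N (tpure K M N m n)) = tsum ?QH (coact M m) (\<lambda>m0 m1.
          tsum ?QH (coact N n) (\<lambda>n0 n1. tpure K ?Q H (braid a M N (tpure K M N m0 n0)) (\<delta> m1 \<otimes>\<^bsub>H\<^esub> \<epsilon> n1)))"
    if mn: "m \<in> carrier M" "n \<in> carrier N" for m n
  proof -
    have "coact ?Y (braid a M N (tpure K M N m n))
      = tsum ?QH (coact M m) (\<lambda>x y. tsum ?QH (coact (conj_obj \<kappa> \<mu> N) (act N (a y) n)) (\<lambda>n0 n1.
          tsum ?QH (coact M x) (\<lambda>m0 m1. ?E n0 m0 (\<beta> n1 \<otimes>\<^bsub>H\<^esub> \<zeta> m1))))"
      using mn by (simp add: b mod_hom_tsum[of "coact ?Y" K ?Q ?QH] tensor_pure_rules(2))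
    \<comment> \<open>Here \<beta>\<mu> = \<epsilon> and \<zeta> = \<epsilon>\<gamma>a collect both
      coefficients under a single \<epsilon>.\<close>
    also have "\<dots> = tsum ?QH (coact M m) (\<lambda>x y. tsum ?QH (coact M x) (\<lambda>m0 m1.
          tsum ?QH (coact N (act N (a y) n)) (\<lambda>n0 n1. ?E n0 m0 (\<epsilon> (n1 \<otimes>\<^bsub>H\<^esub> \<gamma> (a m1))))))"
      using mn by (simp add: tsum_coact_conj bilinear_map_def \<mu> \<zeta> tsum_swap[of K _ "coact N _" "coact M _"])
    also have "\<dots> = tsum ?QH (coact M m) (\<lambda>m0 y. tsum ?QH (comult H y) (\<lambda>u v.
          tsum ?QH (coact N (act N (a v) n)) (\<lambda>n0 n1. ?E n0 m0 (\<epsilon> (n1 \<otimes>\<^bsub>H\<^esub> \<gamma> (a u))))))"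
      using mn by (intro coact_coassoc) (simp_all add: trilinear_map_def bilinear_map_def)
    \<comment> \<open>Since a is a coalgebra map, the images of the legs of y are the legs of a(y),
      the element at which the condition for N is used next, again from right to left.\<close>
    also have "\<dots> = tsum ?QH (coact M m) (\<lambda>m0 y. tsum ?QH (comult H (a y)) (\<lambda>u v.
          tsum ?QH (coact N (act N v n)) (\<lambda>n0 n1. ?E n0 m0 (\<epsilon> (n1 \<otimes>\<^bsub>H\<^esub> \<gamma> u)))))"
      using mn by (simp add: comult_aut[OF aut(6)] bilinear_map_def)
    also have "\<dots> = tsum ?QH (coact M m) (\<lambda>m0 y. tsum ?QH (comult H (a y)) (\<lambda>u v.
          tsum ?QH (coact N n) (\<lambda>n0 n1. ?E (act N u n0) m0 (\<epsilon> (\<delta> v \<otimes>\<^bsub>H\<^esub> n1)))))"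
      using mn by (intro tsum_cong HOL.refl yd_compat[OF N aut(3,4), symmetric]) (simp_all add: bilinear_map_def)
    also have "\<dots> = tsum ?QH (coact M m) (\<lambda>m0 y. tsum ?QH (comult H y) (\<lambda>u v.
          tsum ?QH (coact N n) (\<lambda>n0 n1. ?E (act N (a u) n0) m0 (\<delta> v \<otimes>\<^bsub>H\<^esub> \<epsilon> n1))))"
      using mn by (simp add: comult_aut[OF aut(6)] bilinear_map_def \<epsilon>)
    also have "\<dots> = tsum ?QH (coact M m) (\<lambda>x y. tsum ?QH (coact M x) (\<lambda>m0 m1.
          tsum ?QH (coact N n) (\<lambda>n0 n1. ?E (act N (a m1) n0) m0 (\<delta> y \<otimes>\<^bsub>H\<^esub> \<epsilon> n1))))"
      using mn by (intro coact_coassoc[symmetric]) (simp_all add: trilinear_map_def bilinear_map_def)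
    also have "\<dots> = tsum ?QH (coact M m) (\<lambda>x y. tsum ?QH (coact N n) (\<lambda>n0 n1.
          tsum ?QH (coact M x) (\<lambda>m0 m1. ?E (act N (a m1) n0) m0 (\<delta> y \<otimes>\<^bsub>H\<^esub> \<epsilon> n1))))"
      using mn by (intro tsum_cong HOL.refl tsum_swap[of K]) simp_all
    also have "\<dots> = tsum ?QH (coact M m) (\<lambda>m0 m1.
          tsum ?QH (coact N n) (\<lambda>n0 n1. tpure K ?Q H (braid a M N (tpure K M N m0 n0)) (\<delta> m1 \<otimes>\<^bsub>H\<^esub> \<epsilon> n1)))"
      using mn by (simp add: b tpure_tsum)
    finally show ?thesis .
  qed
qed (use M N aut in \<open>simp_all add: yd_module_iff\<close>)

text \<open>Colinearity of f takes it past the coaction and linearity of g takes it past the action.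
  One parameter a serves both braidings.\<close>

lemma braid_natural:
  assumes f: "yd_map M M' f" and g: "yd_map N N' g" and a: "a \<in> carrier A"
    and [simp]: "left_module K H M" "left_module K H N" "left_module K H M'" "left_module K H N'"
      "right_comodule K H M" "right_comodule K H N" "right_comodule K H M'" "right_comodule K H N'"
    and t: "t \<in> carrier (tensor K M N)"
  shows "tensor_fun N' M' g f (braid a M N t) = braid a M' N' (tensor_fun M' N' f g t)"
proof -
  note [simp] = yd_map_rules[OF f] yd_map_rules[OF g] aut_rules[OF a] a
  note tf = tensor_fun_rules[OF yd_map_mod_hom[OF f] yd_map_mod_hom[OF g]]
  note tg = tensor_fun_rules[OF yd_map_mod_hom[OF g] yd_map_mod_hom[OF f]]
  note b = braid_rules[OF _ _ a same_module_refl same_module_refl]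
  have [simp]: "(\<lambda>t. tensor_fun N' M' g f (braid a M N t)) \<in> mod_hom K (tensor K M N) (tensor K N' M')"
    by (rule mod_hom_compose[of "tensor_fun N' M' g f" K "tensor K N M"]) (simp_all add: b tg)
  have [simp]: "(\<lambda>t. braid a M' N' (tensor_fun M' N' f g t)) \<in> mod_hom K (tensor K M N) (tensor K N' M')"
    by (rule mod_hom_compose[of "braid a M' N'" K "tensor K M' N'"]) (simp_all add: b tf)
  show ?thesis
  proof (rule tensor_hom_eqI[where f = "\<lambda>t. tensor_fun N' M' g f (braid a M N t)"
        and g = "\<lambda>t. braid a M' N' (tensor_fun M' N' f g t)" and P = "tensor K N' M'", OF _ _ t])
    fix m n assume mn: "m \<in> carrier M" "n \<in> carrier N"
    have "tensor_fun N' M' g f (tsum (tensor K N M) (coact M m) (\<lambda>m0 m1. tpure K N M (act N (a m1) n) m0))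
      = tsum (tensor K N' M') (coact M m) (\<lambda>m0 m1. tensor_fun N' M' g f (tpure K N M (act N (a m1) n) m0))"
      using mn by (intro mod_hom_tsum[OF tg(1)]) simp_all
    then show "tensor_fun N' M' g f (braid a M N (tpure K M N m n)) = braid a M' N' (tensor_fun M' N' f g (tpure K M N m n))"
      using mn by (simp add: b tf tg yd_map_coact[OF f] bilinear_map_def)
  qed simp_all
qed

section \<open>Coherence\<close>

lemma tensor_fun_same:
  assumes "same_module M M'" "same_module N N'"
  shows "tensor_fun M N = tensor_fun M' N'"
  by (simp add: tensor_fun_def fun_eq_iff tensor_same[OF assms])

lemma unit_maps_same:
  assumes "same_module M M'"
  shows "lunit_map M = lunit_map M'" "runit_map M = runit_map M'"
  using assms by (simp_all add: lunit_map_def runit_map_def fun_eq_iff tsum_same[OF assms] same_module_def)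

text \<open>The structure maps depend only on the underlying modules; these instances strip actions
  and coactions from their arguments.\<close>

lemmas structure_map_same [simp] =
  tensor_fun_same[OF same_module_tensor_obj same_module_refl] tensor_fun_same[OF same_module_refl same_module_tensor_obj]
  tensor_fun_same[OF same_module_conj_obj same_module_refl] tensor_fun_same[OF same_module_refl same_module_conj_obj]
  tensor_fun_same[OF same_module_unit_obj same_module_refl] tensor_fun_same[OF same_module_refl same_module_unit_obj]
  unit_maps_same[OF same_module_tensor_obj] unit_maps_same[OF same_module_conj_obj] unit_maps_same[OF same_module_unit_obj]
  assoc_map_same[OF same_module_tensor_obj same_module_refl same_module_refl]
  assoc_map_same[OF same_module_refl same_module_tensor_obj same_module_refl]
  assoc_map_same[OF same_module_refl same_module_refl same_module_tensor_obj]
  assoc_map_same[OF same_module_conj_obj same_module_refl same_module_refl]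
  assoc_map_same[OF same_module_refl same_module_conj_obj same_module_refl]
  assoc_map_same[OF same_module_refl same_module_refl same_module_conj_obj]
  assoc_map_same[OF same_module_unit_obj same_module_refl same_module_refl]
  assoc_map_same[OF same_module_refl same_module_unit_obj same_module_refl]
  assoc_map_same[OF same_module_refl same_module_refl same_module_unit_obj]

lemma tensor_fun_mod_hom:
  assumes "f \<in> mod_hom K M M'" "g \<in> mod_hom K N N'" "module K M" "module K N" "module K M'" "module K N'"
    and "k \<in> mod_hom K X (tensor K M N)"
  shows "(\<lambda>x. tensor_fun M' N' f g (k x)) \<in> mod_hom K X (tensor K M' N')"
  by (rule mod_hom_compose[OF tensor_fun_rules(1)[OF assms(1-6)] assms(7)])

lemma assoc_map_mod_hom:
  assumes "module K M" "module K N" "module K P"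
  shows "k \<in> mod_hom K X (tensor K (tensor K M N) P) \<Longrightarrow> (\<lambda>x. assoc_map M N P (k x)) \<in> mod_hom K X (tensor K M (tensor K N P))"
    and "k \<in> mod_hom K X (tensor K M (tensor K N P)) \<Longrightarrow> (\<lambda>x. assoc_inv M N P (k x)) \<in> mod_hom K X (tensor K (tensor K M N) P)"
  using assoc_mod_hom[OF same_module_refl same_module_refl same_module_refl assms] by (auto intro: mod_hom_compose)

section \<open>Naturality, pentagon and triangle for linear maps\<close>

lemma assoc_natural:
  assumes f: "f \<in> mod_hom K M M'" and g: "g \<in> mod_hom K N N'" and h: "h \<in> mod_hom K P P'"
    and [simp]: "module K M" "module K N" "module K P" "module K M'" "module K N'" "module K P'"
    and t: "t \<in> carrier (tensor K (tensor K M N) P)"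
  shows "assoc_map M' N' P' (tensor_fun (tensor K M' N') P' (tensor_fun M' N' f g) h t)
    = tensor_fun M' (tensor K N' P') f (tensor_fun N' P' g h) (assoc_map M N P t)"
proof -
  note [simp] = f g h mod_hom_closed[OF f] mod_hom_closed[OF g] mod_hom_closed[OF h]
    tensor_fun_rules assoc_mod_hom assoc_pure assoc_map_mod_hom tensor_fun_mod_hom
  note [simp] = tensor_fun_mod_hom[OF f tensor_fun_rules(1)[OF g h]] tensor_fun_mod_hom[OF tensor_fun_rules(1)[OF f g] h]
    tensor_fun_rules(2)[OF f tensor_fun_rules(1)[OF g h]] tensor_fun_rules(2)[OF tensor_fun_rules(1)[OF f g] h]
    tensor_fun_rules(1)[OF tensor_fun_rules(1)[OF f g] h]
    tensor_fun_rules(2)[OF f g] tensor_fun_rules(2)[OF g h]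
  show ?thesis
    by (rule tensor_hom_eqI_left[where Q = "tensor K M' (tensor K N' P')" and t = t
        and f = "\<lambda>t. assoc_map M' N' P' (tensor_fun (tensor K M' N') P' (tensor_fun M' N' f g) h t)"
        and g = "\<lambda>t. tensor_fun M' (tensor K N' P') f (tensor_fun N' P' g h) (assoc_map M N P t)", OF _ _ t])
      simp_all
qed

lemma unit_natural:
  assumes f: "f \<in> mod_hom K M N" and [simp]: "module K M" "module K N"
  shows "t \<in> carrier (tensor K (ground K) M) \<Longrightarrow> lunit_map N (tensor_fun (ground K) N (\<lambda>x. x) f t) = f (lunit_map M t)"
    and "t \<in> carrier (tensor K M (ground K)) \<Longrightarrow> runit_map N (tensor_fun N (ground K) f (\<lambda>x. x) t) = f (runit_map M t)"
proof -
  note tl = tensor_fun_rules[where f = "\<lambda>x. x" and g = f and M = "ground K" and M' = "ground K", OF mod_hom_id f]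
  note tr = tensor_fun_rules[where f = f and g = "\<lambda>x. x" and N = "ground K" and N' = "ground K", OF f mod_hom_id]
  note [simp] = mod_hom_closed[OF f] mod_hom_compose[OF f] tl tr unit_maps_mod_hom unit_maps_pure mod_hom_smult[OF f]
    mod_hom_compose[OF unit_maps_mod_hom(1)] mod_hom_compose[OF unit_maps_mod_hom(2)]
  show "lunit_map N (tensor_fun (ground K) N (\<lambda>x. x) f t) = f (lunit_map M t)"
    if "t \<in> carrier (tensor K (ground K) M)"
    by (rule tensor_hom_eqI[where f = "\<lambda>t. lunit_map N (tensor_fun (ground K) N (\<lambda>x. x) f t)"
          and g = "\<lambda>t. f (lunit_map M t)" and P = N, OF _ _ that]) simp_all
  show "runit_map N (tensor_fun N (ground K) f (\<lambda>x. x) t) = f (runit_map M t)"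
    if "t \<in> carrier (tensor K M (ground K))"
    by (rule tensor_hom_eqI[where f = "\<lambda>t. runit_map N (tensor_fun N (ground K) f (\<lambda>x. x) t)"
          and g = "\<lambda>t. f (runit_map M t)" and P = N, OF _ _ that]) simp_all
qed

lemma assoc_pentagon:
  assumes [simp]: "module K W" "module K X" "module K Y" "module K Z"
    and t: "t \<in> carrier (tensor K (tensor K (tensor K W X) Y) Z)"
  shows "tensor_fun W (tensor K X (tensor K Y Z)) (\<lambda>x. x) (assoc_map X Y Z)
      (assoc_map W (tensor K X Y) Z (tensor_fun (tensor K W (tensor K X Y)) Z (assoc_map W X Y) (\<lambda>x. x) t))
    = assoc_map W X (tensor K Y Z) (assoc_map (tensor K W X) Y Z t)" (is "?l t = ?r t")
proof -
  let ?Q = "tensor K W (tensor K X (tensor K Y Z))"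
  note a = assoc_mod_hom(1)[OF same_module_refl same_module_refl same_module_refl]
  note t1 = tensor_fun_rules[OF mod_hom_id a]
  note t2 = tensor_fun_rules[OF a mod_hom_id]
  note [simp] = a mod_hom_compose[OF a] t1 t2 assoc_pure mod_hom_compose[OF t1(1)] mod_hom_compose[OF t2(1)]
  have l: "?l \<in> mod_hom K (tensor K (tensor K (tensor K W X) Y) Z) ?Q"
    and r: "?r \<in> mod_hom K (tensor K (tensor K (tensor K W X) Y) Z) ?Q" by simp_all
  show ?thesis
  proof (rule tensor_hom_eqI[OF l r t])
    fix s z assume s: "s \<in> carrier (tensor K (tensor K W X) Y)" and z: "z \<in> carrier Z"
    have p: "(\<lambda>s. tpure K (tensor K (tensor K W X) Y) Z s z)
        \<in> mod_hom K (tensor K (tensor K W X) Y) (tensor K (tensor K (tensor K W X) Y) Z)"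
      using z by simp
    show "?l (tpure K (tensor K (tensor K W X) Y) Z s z) = ?r (tpure K (tensor K (tensor K W X) Y) Z s z)"
      \<comment> \<open>There are four factors: with z fixed, both sides are linear in the triple
        tensor s, so pure tensors suffice there too.\<close>
      by (rule tensor_hom_eqI_left[OF mod_hom_compose[OF l p] mod_hom_compose[OF r p] s]) (use z in simp_all)
  qed simp_all
qed

text \<open>On pure tensors the two sides differ in the factor that carries the scalar, and a scalar
  may cross the tensor sign.\<close>

lemma assoc_triangle:
  assumes [simp]: "module K M" "module K N"
    and t: "t \<in> carrier (tensor K (tensor K M (ground K)) N)"
  shows "tensor_fun M N (\<lambda>x. x) (lunit_map N) (assoc_map M (ground K) N t) = tensor_fun M N (runit_map M) (\<lambda>x. x) t"
    (is "?l t = ?r t")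
proof -
  note a = assoc_mod_hom(1)[OF same_module_refl same_module_refl same_module_refl]
  note t1 = tensor_fun_rules[OF mod_hom_id unit_maps_mod_hom(1)]
  note t2 = tensor_fun_rules[OF unit_maps_mod_hom(2) mod_hom_id]
  note [simp] = a t1 t2 assoc_pure mod_hom_compose[OF t1(1)] unit_maps_pure
  have l: "?l \<in> mod_hom K (tensor K (tensor K M (ground K)) N) (tensor K M N)"
    and r: "?r \<in> mod_hom K (tensor K (tensor K M (ground K)) N) (tensor K M N)" by simp_all
  show ?thesis
    by (rule tensor_hom_eqI_left[OF l r t]) (simp_all, metis scalar_closed smult_tpure assms)
qed

section \<open>Functoriality of the tensor product\<close>

lemma tensor_fun_id:
  assumes "module K M" "module K N" "t \<in> carrier (tensor K M N)"
  shows "tensor_fun M N (\<lambda>x. x) (\<lambda>x. x) t = t"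
  using assms by (simp add: tensor_fun_def tsum_tpure_id)

lemma tensor_fun_compose:
  assumes f: "f \<in> mod_hom K M M'" and f': "f' \<in> mod_hom K M' M''" and g: "g \<in> mod_hom K N N'" and g': "g' \<in> mod_hom K N' N''"
    and [simp]: "module K M" "module K N" "module K M'" "module K N'" "module K M''" "module K N''"
    and t: "t \<in> carrier (tensor K M N)"
  shows "tensor_fun M'' N'' f' g' (tensor_fun M' N' f g t) = tensor_fun M'' N'' (\<lambda>x. f' (f x)) (\<lambda>x. g' (g x)) t"
    (is "?l t = ?r t")
proof -
  note [simp] = mod_hom_closed[OF f] mod_hom_closed[OF g]
  note t1 = tensor_fun_rules[OF f g] and t2 = tensor_fun_rules[OF f' g']
    and t3 = tensor_fun_rules[OF mod_hom_compose[OF f' f] mod_hom_compose[OF g' g]]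
  have l: "?l \<in> mod_hom K (tensor K M N) (tensor K M'' N'')" and r: "?r \<in> mod_hom K (tensor K M N) (tensor K M'' N'')"
    by (simp_all add: t1 t3 mod_hom_compose[OF t2(1)])
  show ?thesis
    by (rule tensor_hom_eqI[OF l r t]) (simp_all add: t1 t2 t3)
qed

text \<open>Serves to drop the restrictions that arrows impose on f and g.\<close>

lemma tensor_fun_cong:
  assumes "\<And>m. m \<in> carrier M \<Longrightarrow> f m = f' m" "\<And>n. n \<in> carrier N \<Longrightarrow> g n = g' n"
    and "module K M" "module K N" "t \<in> carrier (tensor K M N)"
  shows "tensor_fun M' N' f g t = tensor_fun M' N' f' g' t"
  using terms_carrier[OF _ assms(5,3,4)] assms(1,2) by (simp add: tensor_fun_def)

text \<open>The coefficient of m \<otimes> n is \<delta>(m1) \<epsilon>(n1). The two relations turn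
  its image under a' into \<kappa>(a(m1)) c(n1): first the coefficient of n acts on P, then that of
  m acts on the conjugate of P.\<close>

lemma braid_tensor_left:
  assumes [simp]: "left_module K H P" "right_comodule K H M" "right_comodule K H N" "right_comodule K H P"
      "left_module K H M" "left_module K H N"
    and aut [simp]: "a \<in> carrier A" "c \<in> carrier A" "a' \<in> carrier A" "\<kappa> \<in> carrier A" "\<mu> \<in> carrier A"
      "\<delta> \<in> carrier A" "\<epsilon> \<in> carrier A"
    and eqs: "\<And>h. h \<in> carrier H \<Longrightarrow> a' (\<delta> h) = \<kappa> (a h)" "\<And>h. h \<in> carrier H \<Longrightarrow> a' (\<epsilon> h) = c h"
    and t: "t \<in> carrier (tensor K (tensor K M N) P)"
  shows "braid a' (tensor_obj \<delta> \<epsilon> M N) P t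
    = assoc_map P M N (tensor_fun (tensor K P M) N (braid a M (conj_obj \<kappa> \<mu> P)) (\<lambda>x. x)
        (assoc_inv M P N (tensor_fun M (tensor K P N) (\<lambda>x. x) (braid c N P) (assoc_map M N P t))))"
    (is "?l t = ?r t")
proof -
  note [simp] = aut_rules[OF aut(1)] aut_rules[OF aut(2)] aut_rules[OF aut(3)] aut_rules[OF aut(4)]
    aut_rules[OF aut(5)] aut_rules[OF aut(6)] aut_rules[OF aut(7)]
  let ?Q = "tensor K P (tensor K M N)"
  have b1: "braid a M (conj_obj \<kappa> \<mu> P) \<in> mod_hom K (tensor K M P) (tensor K P M)"
    and b2: "braid c N P \<in> mod_hom K (tensor K N P) (tensor K P N)"
    and b3: "braid a' (tensor_obj \<delta> \<epsilon> M N) P \<in> mod_hom K (tensor K (tensor K M N) P) ?Q"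
    by (rule braid_rules; simp)+
  note a = assoc_mod_hom[OF same_module_refl same_module_refl same_module_refl]
  note t1 = tensor_fun_rules[OF b1 mod_hom_id] and t2 = tensor_fun_rules[OF mod_hom_id b2]
  note [simp] = b1 b2 b3 a t1 t2 mod_hom_compose[OF t1(1)] mod_hom_compose[OF t2(1)]
    mod_hom_compose[OF a(1)] mod_hom_compose[OF a(2)]
  have l: "?l \<in> mod_hom K (tensor K (tensor K M N) P) ?Q" and r: "?r \<in> mod_hom K (tensor K (tensor K M N) P) ?Q"
    by simp_all
  show ?thesis
  proof (rule tensor_hom_eqI_left[where f = ?l and g = ?r, OF l r t])
    fix m n p assume mnp: "m \<in> carrier M" "n \<in> carrier N" "p \<in> carrier P"
    have "?l (tpure K (tensor K M N) P (tpure K M N m n) p) = tsum ?Q (coact M m) (\<lambda>m0 m1. tsum ?Q (coact N n) (\<lambda>n0 n1.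
        tpure K P (tensor K M N) (act P (\<kappa> (a m1)) (act P (c n1) p)) (tpure K M N m0 n0)))"
      using mnp by (simp add: braid_rules(2) tensor_pure_rules(3) bilinear_map_def eqs act_mult)
    \<comment> \<open>The composite on the right braids N past P before M, so its outer sum runs
      over the coaction of n.\<close>
    also have "\<dots> = tsum ?Q (coact N n) (\<lambda>n0 n1. tsum ?Q (coact M m) (\<lambda>m0 m1.
        tpure K P (tensor K M N) (act P (\<kappa> (a m1)) (act P (c n1) p)) (tpure K M N m0 n0)))"
      using mnp by (intro tsum_swap[of K]) simp_all
    also have "\<dots> = ?r (tpure K (tensor K M N) P (tpure K M N m n) p)"
      using mnp by (simp add: braid_rules(2) assoc_pure tpure_tsum mod_hom_tsum[OF a(1)] mod_hom_tsum[OF a(2)]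
          mod_hom_tsum[OF t1(1)] mod_hom_tsum[OF t2(1)])
    finally show "?l (tpure K (tensor K M N) P (tpure K M N m n) p) = ?r (tpure K (tensor K M N) P (tpure K M N m n) p)" .
  qed simp_all
qed

text \<open>The composite coacts on m twice, acting on N with the last leg and on P with the middle
  one. Coassociativity makes these the second and first legs of a single coefficient, which is how
  the action on N \<otimes> P distributes them.\<close>

lemma braid_tensor_right:
  assumes [simp]: "right_comodule K H M" "left_module K H N" "left_module K H P"
    and aut [simp]: "a \<in> carrier A"
    and t: "t \<in> carrier (tensor K M (tensor K N P))"
  shows "braid a M (tensor_obj p q N P) t
    = assoc_inv N P M (tensor_fun N (tensor K P M) (\<lambda>x. x) (braid a M P)
        (assoc_map N M P (tensor_fun (tensor K N M) P (braid a M N) (\<lambda>x. x) (assoc_inv M N P t))))"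
    (is "?l t = ?r t")
proof -
  note [simp] = aut_rules[OF aut(1)]
  let ?Q = "tensor K (tensor K N P) M"
  have b1: "braid a M N \<in> mod_hom K (tensor K M N) (tensor K N M)"
    and b2: "braid a M P \<in> mod_hom K (tensor K M P) (tensor K P M)"
    and b3: "braid a M (tensor_obj p q N P) \<in> mod_hom K (tensor K M (tensor K N P)) ?Q"
    by (rule braid_rules; simp)+
  note a = assoc_mod_hom[OF same_module_refl same_module_refl same_module_refl]
  note t1 = tensor_fun_rules[OF b1 mod_hom_id] and t2 = tensor_fun_rules[OF mod_hom_id b2]
  note [simp] = b1 b2 b3 a t1 t2 mod_hom_compose[OF t1(1)] mod_hom_compose[OF t2(1)]
    mod_hom_compose[OF a(1)] mod_hom_compose[OF a(2)]
  have l: "?l \<in> mod_hom K (tensor K M (tensor K N P)) ?Q" and r: "?r \<in> mod_hom K (tensor K M (tensor K N P)) ?Q"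
    by simp_all
  show ?thesis
  proof (rule tensor_hom_eqI_right[where f = ?l and g = ?r, OF l r t])
    fix m n x assume mnx: "m \<in> carrier M" "n \<in> carrier N" "x \<in> carrier P"
    have "?r (tpure K M (tensor K N P) m (tpure K N P n x)) = tsum ?Q (coact M m) (\<lambda>y z. tsum ?Q (coact M y) (\<lambda>m0 m1.
        tpure K (tensor K N P) M (tpure K N P (act N (a z) n) (act P (a m1) x)) m0))"
      using mnx by (simp add: braid_rules(2) assoc_pure tpure_tsum mod_hom_tsum[OF a(1)] mod_hom_tsum[OF a(2)]
          mod_hom_tsum[OF t1(1)] mod_hom_tsum[OF t2(1)])
    also have "\<dots> = tsum ?Q (coact M m) (\<lambda>m0 z. tsum ?Q (comult H z) (\<lambda>u v.
        tpure K (tensor K N P) M (tpure K N P (act N (a v) n) (act P (a u) x)) m0))"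
      using mnx by (intro coact_coassoc) (simp_all add: trilinear_map_def bilinear_map_def)
    also have "\<dots> = ?l (tpure K M (tensor K N P) m (tpure K N P n x))"
      using mnx by (simp add: braid_rules(2) tensor_pure_rules(1) tpure_tsum comult_aut[OF aut(1)] bilinear_map_def)
    finally show "?l (tpure K M (tensor K N P) m (tpure K N P n x)) = ?r (tpure K M (tensor K N P) m (tpure K N P n x))" ..
  qed simp_all
qed

text \<open>The coefficient of m passes through \<mu>, the parameter a' and the twist \<kappa> of
  the action on N; the relation says that the composite is the original parameter.\<close>

lemma braid_conj:
  assumes [simp]: "right_comodule K H M" "left_module K H N"
    and aut [simp]: "a \<in> carrier A" "a' \<in> carrier A" "\<kappa> \<in> carrier A" "\<mu> \<in> carrier A" "\<mu>' \<in> carrier A"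
    and eq: "\<And>h. h \<in> carrier H \<Longrightarrow> \<kappa> (a' (\<mu> h)) = a h"
    and t: "t \<in> carrier (tensor K M N)"
  shows "braid a' (conj_obj \<kappa> \<mu> M) (conj_obj \<kappa> \<mu>' N) t = braid a M N t"
proof -
  note [simp] = aut_rules[OF aut(1)] aut_rules[OF aut(2)] aut_rules[OF aut(3)] aut_rules[OF aut(4)] terms_carrier[OF _ t]
  show ?thesis
    by (simp add: braid_def tsum_coact_conj bilinear_map_def eq)
qed

lemma conj_yd_map:
  assumes f: "yd_map M N f" and aut: "\<kappa> \<in> carrier A" "\<mu> \<in> carrier A"
    and [simp]: "right_comodule K H M" "right_comodule K H N"
  shows "yd_map (conj_obj \<kappa> \<mu> M) (conj_obj \<kappa> \<mu> N) f"
proof -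
  note [simp] = aut_rules[OF aut(1)] aut_rules[OF aut(2)] yd_map_rules[OF f] aut
  have "coact (conj_obj \<kappa> \<mu> N) (f m)
      = tsum (tensor K N H) (coact (conj_obj \<kappa> \<mu> M) m) (\<lambda>m0 m1. tpure K N H (f m0) m1)" if m: "m \<in> carrier M" for m
  proof -
    have "coact (conj_obj \<kappa> \<mu> N) (f m) = tsum (tensor K N H) (coact N (f m)) (\<lambda>n0 n1. tpure K N H n0 (\<mu> n1))"
      using m by (simp add: coact_conj)
    also have "\<dots> = tsum (tensor K N H) (coact M m) (\<lambda>m0 m1. tpure K N H (f m0) (\<mu> m1))"
      using m by (intro yd_map_coact[OF f]) (simp_all add: bilinear_map_def)
    finally show ?thesis
      using m by (simp add: tsum_coact_conj bilinear_map_def)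
  qed
  then show ?thesis
    by (simp add: yd_map_def)
qed

end

section \<open>The monoidal category\<close>

lemma group_inv_cancel:
  assumes "group G" "a \<in> carrier G" "x \<in> carrier G"
  shows "inv\<^bsub>G\<^esub> a \<otimes>\<^bsub>G\<^esub> (a \<otimes>\<^bsub>G\<^esub> x) = x" "a \<otimes>\<^bsub>G\<^esub> (inv\<^bsub>G\<^esub> a \<otimes>\<^bsub>G\<^esub> x) = x"
proof -
  interpret group G by (rule assms)
  show "inv\<^bsub>G\<^esub> a \<otimes>\<^bsub>G\<^esub> (a \<otimes>\<^bsub>G\<^esub> x) = x" "a \<otimes>\<^bsub>G\<^esub> (inv\<^bsub>G\<^esub> a \<otimes>\<^bsub>G\<^esub> x) = x"
    using assms(2,3) by (simp_all flip: m_assoc)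
qed

context hopf_algebra
begin

abbreviation "G \<equiv> yd_group K H"
abbreviation "C \<equiv> yd_hat K H"

interpretation A: group A by (rule aut_group)

section \<open>The group of indices\<close>

lemma G_carrier: "a \<in> carrier G \<longleftrightarrow> fst a \<in> carrier A \<and> snd a \<in> carrier A"
  by (cases a) (simp add: yd_group_def Let_def)

lemma G_components [simp]: "a \<in> carrier G \<Longrightarrow> fst a \<in> carrier A" "a \<in> carrier G \<Longrightarrow> snd a \<in> carrier A"
  by (simp_all add: G_carrier)

lemma G_mult [simp]:
  "fst (a \<otimes>\<^bsub>G\<^esub> b) = snd b \<otimes>\<^bsub>A\<^esub> fst a \<otimes>\<^bsub>A\<^esub> inv\<^bsub>A\<^esub> (snd b) \<otimes>\<^bsub>A\<^esub> fst b"
  "snd (a \<otimes>\<^bsub>G\<^esub> b) = snd b \<otimes>\<^bsub>A\<^esub> snd a"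
  by (simp_all add: yd_group_def Let_def case_prod_unfold)

lemma G_one [simp]: "fst \<one>\<^bsub>G\<^esub> = \<one>\<^bsub>A\<^esub>" "snd \<one>\<^bsub>G\<^esub> = \<one>\<^bsub>A\<^esub>"
  by (simp_all add: yd_group_def Let_def)

text \<open>Brackets words to the right and cancels adjacent inverses also when they stand in front
  of a longer word.\<close>

lemmas A_word = A.m_assoc A.inv_mult_group group_inv_cancel[OF aut_group]

lemma G_group: "group G"
proof (rule groupI)
  fix a assume a: "a \<in> carrier G"
  show "\<exists>b\<in>carrier G. b \<otimes>\<^bsub>G\<^esub> a = \<one>\<^bsub>G\<^esub>"
    \<comment> \<open>Solving (x, y) (\<alpha>, \<beta>) = (1, 1) gives y = \<beta>\<inverse> and
      \<beta> x \<beta>\<inverse> \<alpha> = 1.\<close>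
    using a by (intro bexI[of _ "(inv\<^bsub>A\<^esub> (snd a) \<otimes>\<^bsub>A\<^esub> inv\<^bsub>A\<^esub> (fst a) \<otimes>\<^bsub>A\<^esub> snd a, inv\<^bsub>A\<^esub> (snd a))"])
      (simp_all add: G_carrier prod_eq_iff A_word del: G_components)
qed (simp_all add: G_carrier prod_eq_iff A_word del: G_components)

interpretation G: group G by (rule G_group)

lemma G_inv [simp]:
  assumes "a \<in> carrier G"
  shows "fst (inv\<^bsub>G\<^esub> a) = inv\<^bsub>A\<^esub> (snd a) \<otimes>\<^bsub>A\<^esub> inv\<^bsub>A\<^esub> (fst a) \<otimes>\<^bsub>A\<^esub> snd a"
    and "snd (inv\<^bsub>G\<^esub> a) = inv\<^bsub>A\<^esub> (snd a)"
proof -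
  have "inv\<^bsub>G\<^esub> a = (inv\<^bsub>A\<^esub> (snd a) \<otimes>\<^bsub>A\<^esub> inv\<^bsub>A\<^esub> (fst a) \<otimes>\<^bsub>A\<^esub> snd a, inv\<^bsub>A\<^esub> (snd a))"
    using assms by (intro G.inv_equality) (simp_all add: G_carrier prod_eq_iff A_word del: G_components)
  then show "fst (inv\<^bsub>G\<^esub> a) = inv\<^bsub>A\<^esub> (snd a) \<otimes>\<^bsub>A\<^esub> inv\<^bsub>A\<^esub> (fst a) \<otimes>\<^bsub>A\<^esub> snd a"
    "snd (inv\<^bsub>G\<^esub> a) = inv\<^bsub>A\<^esub> (snd a)" by simp_all
qed

text \<open>The twist that a tensor product of objects of indices a and b puts on the coefficients
  of the second factor.\<close>

definition tau where
  "tau a b = snd b \<otimes>\<^bsub>A\<^esub> fst a \<otimes>\<^bsub>A\<^esub> inv\<^bsub>A\<^esub> (snd b)"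

lemma tau_closed [simp]: "\<lbrakk>a \<in> carrier G; b \<in> carrier G\<rbrakk> \<Longrightarrow> tau a b \<in> carrier A"
  by (simp add: tau_def)

lemma yd_tensor_simps [simp]:
  "fst (yd_tensor K H X Y) = fst X \<otimes>\<^bsub>G\<^esub> fst Y"
  "snd (yd_tensor K H X Y) = tensor_obj (snd (fst Y)) (tau (fst X) (fst Y)) (snd X) (snd Y)"
proof -
  obtain \<alpha> \<beta> M \<gamma> \<delta> N where "X = ((\<alpha>, \<beta>), M)" "Y = ((\<gamma>, \<delta>), N)"
    by (metis prod.exhaust)
  then show "fst (yd_tensor K H X Y) = fst X \<otimes>\<^bsub>G\<^esub> fst Y"
    "snd (yd_tensor K H X Y) = tensor_obj (snd (fst Y)) (tau (fst X) (fst Y)) (snd X) (snd Y)"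
    by (simp_all add: Let_def tensor_obj_def tau_def)
qed

lemma fst_yd_unit [simp]: "fst (yd_unit K H) = \<one>\<^bsub>G\<^esub>"
  by (simp add: yd_unit_def)

section \<open>Objects and arrows of the disjoint union\<close>

lemma hat_defs:
  "Obj C = (SIGMA a:carrier G. Obj (yd_category K H a))"
  "Arr C = (SIGMA a:carrier G. Arr (yd_category K H a))"
  "Dom C = (\<lambda>(a, f). (a, Dom (yd_category K H a) f))"
  "Cod C = (\<lambda>(a, f). (a, Cod (yd_category K H a) f))"
  "Ident C = (\<lambda>(a, M). (a, Ident (yd_category K H a) M))"
  "Comp C = (\<lambda>(a, g) (_, f). (a, Comp (yd_category K H a) g f))"
  "TensO C = yd_tensor K H" "UnitO C = yd_unit K H"
  "TensA C = (\<lambda>(a, M, M', f) (b, N, N', g).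
     yd_arrow (yd_tensor K H (a, M) (b, N)) (yd_tensor K H (a, M') (b, N')) (tensor_map K M N M' N' f g))"
  unfolding yd_hat_def disjoint_union_def category.defs monoidal_category.defs
  by (simp_all only: category.simps monoidal_category.simps)

lemma hat_Obj: "X \<in> Obj C \<longleftrightarrow> fst X \<in> carrier G \<and> yd_module K H (fst X) (snd X)"
  by (cases X) (simp add: hat_defs yd_category_def)

lemma Obj_simps [simp]:
  assumes "X \<in> Obj C"
  shows "fst X \<in> carrier G" "left_module K H (snd X)" "right_comodule K H (snd X)"
    "yd_module K H (fst (fst X), snd (fst X)) (snd X)"
  using assms yd_module_iff[of "fst (fst X)" "snd (fst X)" "snd X"] unfolding hat_Obj by simp_all

lemma hat_simps:
  "TensO C = yd_tensor K H" "UnitO C = yd_unit K H"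
  "Ident C X = yd_arrow X X (\<lambda>x. x)"
  by (simp_all only: hat_defs) (simp add: yd_category_def yd_arrow_def case_prod_unfold)

lemma hat_LUnit: "LUnit C X = yd_arrow (yd_tensor K H (yd_unit K H) X) X (lunit_map (snd X))"
  unfolding yd_hat_def disjoint_union_def category.defs monoidal_category.defs lunit_map_def[abs_def]
  by (cases X) (simp only: monoidal_category.simps prod.case snd_conv)

lemma hat_RUnit: "RUnit C X = yd_arrow (yd_tensor K H X (yd_unit K H)) X (runit_map (snd X))"
  unfolding yd_hat_def disjoint_union_def category.defs monoidal_category.defs runit_map_def[abs_def]
  by (cases X) (simp only: monoidal_category.simps prod.case snd_conv)

lemma hat_Assoc:
  "Assoc C X Y Z = yd_arrow (yd_tensor K H (yd_tensor K H X Y) Z) (yd_tensor K H X (yd_tensor K H Y Z))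
     (assoc_map (snd X) (snd Y) (snd Z))"
proof -
  obtain a M b N c P where "X = (a, M)" "Y = (b, N)" "Z = (c, P)"
    by (metis surj_pair)
  then show ?thesis
    unfolding yd_hat_def disjoint_union_def category.defs monoidal_category.defs assoc_map_def[abs_def]
    by (simp only: monoidal_category.simps prod.case snd_conv)
qed

lemmas hat_structure = hat_LUnit hat_RUnit hat_Assoc

lemma Dom_arrow [simp]: "Dom C (yd_arrow X Y f) = X"
  by (simp add: hat_defs yd_category_def yd_arrow_def)

lemma Cod_arrow: "Cod C (yd_arrow X Y f) = (fst X, snd Y)"
  by (simp add: hat_defs yd_category_def yd_arrow_def)

lemma Cod_arrow_same [simp]: "fst X = fst Y \<Longrightarrow> Cod C (yd_arrow X Y f) = Y"
  by (simp add: Cod_arrow)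

text \<open>Arrows store restricted functions, so an equation of arrows with common source and
  target is a pointwise equation on the carrier of the source.\<close>

lemma yd_arrow_eqI: "(\<And>m. m \<in> carrier (snd X) \<Longrightarrow> f m = g m) \<Longrightarrow> yd_arrow X Y f = yd_arrow X Y g"
  by (simp add: yd_arrow_def fun_eq_iff restrict_def)

lemma yd_map_cong:
  assumes "\<And>m. m \<in> carrier M \<Longrightarrow> f m = g m" "left_module K H M" "right_comodule K H M" "yd_map M N f"
  shows "yd_map M N g"
  using assms yd_map_mod_hom[OF assms(4)] mod_hom_cong[of M f g N] by (simp add: yd_map_def)

text \<open>Any linear and colinear function presents an arrow, whatever its values outside the
  carrier; later computations need not carry \<open>restrict\<close> along.\<close>

lemma hat_Arr:
  "\<phi> \<in> Arr C \<longleftrightarrow> (\<exists>X Y f. X \<in> Obj C \<and> Y \<in> Obj C \<and> fst X = fst Y \<and> yd_map (snd X) (snd Y) f \<and> \<phi> = yd_arrow X Y f)"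
    (is "_ \<longleftrightarrow> ?r")
proof
  have C: "\<phi> \<in> Arr C \<longleftrightarrow> (\<exists>a M N f. \<phi> = (a, M, N, f) \<and> a \<in> carrier G \<and> yd_module K H a M \<and> yd_module K H a N
      \<and> f \<in> extensional (carrier M) \<and> yd_map M N f)" for \<phi>
    unfolding hat_defs by (auto simp: yd_category_def yd_map_def)
  show ?r if "\<phi> \<in> Arr C"
  proof -
    obtain a M N f where f: "\<phi> = (a, M, N, f)" "a \<in> carrier G" "yd_module K H a M" "yd_module K H a N"
      "f \<in> extensional (carrier M)" "yd_map M N f"
      using \<open>\<phi> \<in> Arr C\<close> C by blast
    then show ?thesis
      by (intro exI[of _ "(a, M)"] exI[of _ "(a, N)"] exI[of _ f])
        (simp add: hat_Obj yd_arrow_def extensional_restrict)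
  qed
  assume ?r
  then obtain X Y f where f: "X \<in> Obj C" "Y \<in> Obj C" "fst X = fst Y" "yd_map (snd X) (snd Y) f" "\<phi> = yd_arrow X Y f"
    by blast
  have "yd_map (snd X) (snd Y) (restrict f (carrier (snd X)))"
    by (rule yd_map_cong[OF _ _ _ f(4)]) (use f(1) in simp_all)
  then show "\<phi> \<in> Arr C"
    using f unfolding C by (auto simp: yd_arrow_def hat_Obj)
qed

lemma arrow_in_Hom:
  "\<lbrakk>X \<in> Obj C; Y \<in> Obj C; fst X = fst Y; yd_map (snd X) (snd Y) f\<rbrakk> \<Longrightarrow> yd_arrow X Y f \<in> Hom C X Y"
proof -
  assume a: "X \<in> Obj C" "Y \<in> Obj C" "fst X = fst Y" "yd_map (snd X) (snd Y) f"
  then have "yd_arrow X Y f \<in> Arr C" unfolding hat_Arr by blast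
  then show ?thesis using a(3) by (simp add: Hom_def)
qed

lemma HomE:
  assumes "\<phi> \<in> Hom C X Y"
  obtains f where "X \<in> Obj C" "Y \<in> Obj C" "fst X = fst Y" "yd_map (snd X) (snd Y) f" "\<phi> = yd_arrow X Y f"
  using assms by (auto simp: Hom_def hat_Arr)

lemma Comp_arrow:
  assumes "yd_map (snd X) (snd Y) f" "fst X = fst Y"
  shows "yd_arrow Y Z g \<cdot>\<^bsub>C\<^esub> yd_arrow X Y f = yd_arrow X Z (\<lambda>x. g (f x))"
  using yd_map_rules(1)[OF assms(1)] assms(2)
  by (simp add: hat_defs yd_category_def yd_arrow_def
      compose_def fun_eq_iff restrict_def)

lemma TensA_arrow:
  assumes "fst X = fst X'" "fst Y = fst Y'" and [simp]: "X \<in> Obj C" "Y \<in> Obj C"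
  shows "yd_arrow X X' f \<star>\<^bsub>C\<^esub> yd_arrow Y Y' g
    = yd_arrow (yd_tensor K H X Y) (yd_tensor K H X' Y') (tensor_fun (snd X') (snd Y') f g)"
proof -
  let ?r = "\<lambda>f X. restrict f (carrier (snd X))"
  let ?m = "tensor_map K (snd X) (snd Y) (snd X') (snd Y') (?r f X) (?r g Y)"
  have "yd_arrow X X' f \<star>\<^bsub>C\<^esub> yd_arrow Y Y' g = yd_arrow (yd_tensor K H X Y) (yd_tensor K H X' Y') ?m"
    using assms(1,2) by (simp add: hat_defs yd_arrow_def)
  also have "\<dots> = yd_arrow (yd_tensor K H X Y) (yd_tensor K H X' Y') (tensor_fun (snd X') (snd Y') f g)"
  proof (rule yd_arrow_eqI)
    fix t assume "t \<in> carrier (snd (yd_tensor K H X Y))"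
    then have t: "t \<in> carrier (tensor K (snd X) (snd Y))" by simp
    then have "?m t = tensor_fun (snd X') (snd Y') (?r f X) (?r g Y) t"
      by (simp add: tensor_map_def tensor_fun_def)
    also have "\<dots> = tensor_fun (snd X') (snd Y') f g t"
      by (rule tensor_fun_cong[OF _ _ _ _ t]) simp_all
    finally show "?m t = tensor_fun (snd X') (snd Y') f g t" .
  qed
  finally show ?thesis .
qed

text \<open>\<open>Inv_arr\<close> is a definite description, hence the uniqueness argument. Its
  explicit value matters because the braiding axioms contain inverse associators.\<close>

lemma arrow_inverse:
  assumes X: "X \<in> Obj C" and Y: "Y \<in> Obj C" and eq: "fst X = fst Y" and f: "yd_map (snd X) (snd Y) f"
    and g: "\<And>y. y \<in> carrier (snd Y) \<Longrightarrow> g y \<in> carrier (snd X)"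
    and gf: "\<And>x. x \<in> carrier (snd X) \<Longrightarrow> g (f x) = x" and fg: "\<And>y. y \<in> carrier (snd Y) \<Longrightarrow> f (g y) = y"
  shows "yd_map (snd Y) (snd X) g" and "yd_arrow X Y f \<in> Iso C X Y" and "Inv_arr C (yd_arrow X Y f) = yd_arrow Y X g"
proof -
  show g': "yd_map (snd Y) (snd X) g"
    by (rule yd_map_inverse[OF f _ _ _ _ g gf fg]) (use X Y in simp_all)
  have inv: "inverse_arrows C (yd_arrow X Y f) (yd_arrow Y X g)"
  proof -
    have "yd_arrow X X (\<lambda>x. g (f x)) = yd_arrow X X (\<lambda>x. x)" "yd_arrow Y Y (\<lambda>x. f (g x)) = yd_arrow Y Y (\<lambda>x. x)"
      by (rule yd_arrow_eqI; simp add: gf fg)+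
    then show ?thesis
      using eq arrow_in_Hom[OF Y X eq[symmetric] g']
      by (simp add: inverse_arrows_def Comp_arrow[OF f eq] Comp_arrow[OF g' eq[symmetric]] hat_simps)
  qed
  then show "yd_arrow X Y f \<in> Iso C X Y"
    using arrow_in_Hom[OF X Y eq f] unfolding Iso_def by blast
  show "Inv_arr C (yd_arrow X Y f) = yd_arrow Y X g"
    unfolding Inv_arr_def
  proof (rule the_equality[where P = "inverse_arrows C (yd_arrow X Y f)"])
    show "inverse_arrows C (yd_arrow X Y f) (yd_arrow Y X g)" by (rule inv)
    fix \<psi> assume \<psi>: "inverse_arrows C (yd_arrow X Y f) \<psi>"
    then have "\<psi> \<in> Hom C Y X" using eq by (simp add: inverse_arrows_def)
    then obtain k where k: "yd_map (snd Y) (snd X) k" "\<psi> = yd_arrow Y X k" by (rule HomE)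
    \<comment> \<open>Uniqueness: an inverse presented by k satisfies k (f x) = x, and at x = g y
      this reads k y = g y.\<close>
    have "yd_arrow X X (\<lambda>x. k (f x)) = yd_arrow X X (\<lambda>x. x)"
      using \<psi> eq by (simp add: inverse_arrows_def k(2) Comp_arrow[OF f] hat_simps)
    then have r: "restrict (\<lambda>x. k (f x)) (carrier (snd X)) = restrict (\<lambda>x. x) (carrier (snd X))"
      by (simp add: yd_arrow_def)
    have kf: "k (f x) = x" if "x \<in> carrier (snd X)" for x
      using fun_cong[OF r, of x] that by simp
    show "\<psi> = yd_arrow Y X g"
      unfolding k(2)
    proof (rule yd_arrow_eqI)
      show "k m = g m" if "m \<in> carrier (snd Y)" for m
        using kf[OF g[OF that]] fg[OF that] by simp
    qed
  qed
qed

lemma hat_category: "category C"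
proof (rule category.intro)
  fix W X Y Z \<phi> \<psi> \<chi>
  show "Dom C \<phi> \<in> Obj C" "Cod C \<phi> \<in> Obj C" if "\<phi> \<in> Arr C"
    using that by (auto simp: hat_Arr)
  show "Ident C X \<in> Hom C X X" if "X \<in> Obj C"
    using that by (auto simp: hat_simps intro!: arrow_in_Hom yd_map_id)
  show "\<psi> \<cdot>\<^bsub>C\<^esub> \<phi> \<in> Hom C X Z" if "\<phi> \<in> Hom C X Y" "\<psi> \<in> Hom C Y Z"
    using that by (elim HomE) (auto simp: Comp_arrow intro!: arrow_in_Hom intro: yd_map_compose)
  show "Ident C Y \<cdot>\<^bsub>C\<^esub> \<phi> = \<phi>" "\<phi> \<cdot>\<^bsub>C\<^esub> Ident C X = \<phi>" if "\<phi> \<in> Hom C X Y"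
    using that by (auto elim!: HomE simp: hat_simps Comp_arrow yd_map_id)
  show "(\<chi> \<cdot>\<^bsub>C\<^esub> \<psi>) \<cdot>\<^bsub>C\<^esub> \<phi> = \<chi> \<cdot>\<^bsub>C\<^esub> \<psi> \<cdot>\<^bsub>C\<^esub> \<phi>"
    if arr: "\<phi> \<in> Hom C W X" "\<psi> \<in> Hom C X Y" "\<chi> \<in> Hom C Y Z"
  proof -
    obtain f where f: "W \<in> Obj C" "X \<in> Obj C" "fst W = fst X" "yd_map (snd W) (snd X) f" "\<phi> = yd_arrow W X f"
      using arr(1) by (rule HomE)
    obtain g where g: "Y \<in> Obj C" "fst X = fst Y" "yd_map (snd X) (snd Y) g" "\<psi> = yd_arrow X Y g"
      using arr(2) by (rule HomE)
    obtain h where h: "fst Y = fst Z" "\<chi> = yd_arrow Y Z h"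
      using arr(3) by (rule HomE)
    have "yd_map (snd W) (snd Y) (\<lambda>x. g (f x))"
      by (rule yd_map_compose[OF f(4) g(3)]) (use f g in simp_all)
    then show ?thesis using f g h by (simp add: Comp_arrow)
  qed
qed

text \<open>With \<epsilon> = \<open>tau\<close> the relations between twists in
  \<open>tensor_yd_module\<close> become identities of words in the automorphism group.\<close>

lemma tensor_in_Obj:
  assumes X: "X \<in> Obj C" and Y: "Y \<in> Obj C"
  shows "yd_tensor K H X Y \<in> Obj C"
proof -
  have "yd_module K H (fst (fst X \<otimes>\<^bsub>G\<^esub> fst Y), snd (fst X \<otimes>\<^bsub>G\<^esub> fst Y))
      (tensor_obj (snd (fst Y)) (tau (fst X) (fst Y)) (snd X) (snd Y))"
    by (rule tensor_yd_module[OF Obj_simps(4)[OF X] Obj_simps(4)[OF Y]])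
      (use X Y in \<open>simp_all add: tau_def aut_mult_apply aut_inv_apply aut_rules(1)\<close>)
  then show ?thesis
    using X Y unfolding hat_Obj prod.collapse by simp
qed

lemma unit_in_Obj: "yd_unit K H \<in> Obj C"
proof -
  have "\<one>\<^bsub>G\<^esub> = (\<one>\<^bsub>A\<^esub>, \<one>\<^bsub>A\<^esub>)" by (simp add: prod_eq_iff)
  then show ?thesis using unit_yd_module G.one_closed by (simp add: hat_Obj)
qed

abbreviation yd_prod (infixr "\<odot>\<odot>" 65) where "X \<odot>\<odot> Y \<equiv> yd_tensor K H X Y"

text \<open>A morphism before it is packaged as an arrow; \<open>fst X = fst Y\<close> keeps it
  within one component of the disjoint union.\<close>

definition yd_hom where
  "yd_hom X Y f \<longleftrightarrow> X \<in> Obj C \<and> Y \<in> Obj C \<and> fst X = fst Y \<and> yd_map (snd X) (snd Y) f"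

lemma yd_homD:
  assumes "yd_hom X Y f"
  shows "X \<in> Obj C" "Y \<in> Obj C" "fst X = fst Y" "yd_map (snd X) (snd Y) f" "f \<in> mod_hom K (snd X) (snd Y)"
  using assms by (simp_all add: yd_hom_def yd_map_def)

lemma Hom_iff: "\<phi> \<in> Hom C X Y \<longleftrightarrow> (\<exists>f. yd_hom X Y f \<and> \<phi> = yd_arrow X Y f)"
  by (auto simp: yd_hom_def intro: arrow_in_Hom elim: HomE)

lemma yd_hom_id: "X \<in> Obj C \<Longrightarrow> yd_hom X X (\<lambda>x. x)"
  by (simp add: yd_hom_def yd_map_id)

lemma yd_hom_compose:
  assumes f: "yd_hom X Y f" and g: "yd_hom Y Z g"
  shows "yd_hom X Z (\<lambda>x. g (f x))" and "yd_arrow Y Z g \<cdot>\<^bsub>C\<^esub> yd_arrow X Y f = yd_arrow X Z (\<lambda>x. g (f x))"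
  using yd_homD[OF f] yd_homD[OF g] by (simp_all add: yd_hom_def yd_map_compose[of "snd X" "snd Y"] Comp_arrow)

lemma yd_hom_tensor:
  assumes f: "yd_hom X X' f" and g: "yd_hom Y Y' g"
  shows "yd_hom (X \<odot>\<odot> Y) (X' \<odot>\<odot> Y') (tensor_fun (snd X') (snd Y') f g)"
    and "yd_arrow X X' f \<star>\<^bsub>C\<^esub> yd_arrow Y Y' g = yd_arrow (X \<odot>\<odot> Y) (X' \<odot>\<odot> Y') (tensor_fun (snd X') (snd Y') f g)"
proof -
  note [simp] = yd_homD(1,2)[OF f] yd_homD(1,2)[OF g]
  have "yd_map (snd (X \<odot>\<odot> Y)) (snd (X' \<odot>\<odot> Y')) (tensor_fun (snd X') (snd Y') f g)"
    unfolding yd_tensor_simps yd_homD(3)[OF f] yd_homD(3)[OF g]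
    by (rule tensor_fun_yd_map[OF yd_homD(4)[OF f] yd_homD(4)[OF g]]) simp_all
  then show "yd_hom (X \<odot>\<odot> Y) (X' \<odot>\<odot> Y') (tensor_fun (snd X') (snd Y') f g)"
    unfolding yd_hom_def by (simp add: tensor_in_Obj yd_homD(3)[OF f] yd_homD(3)[OF g])
  show "yd_arrow X X' f \<star>\<^bsub>C\<^esub> yd_arrow Y Y' g = yd_arrow (X \<odot>\<odot> Y) (X' \<odot>\<odot> Y') (tensor_fun (snd X') (snd Y') f g)"
    by (rule TensA_arrow[OF yd_homD(3)[OF f] yd_homD(3)[OF g]]) simp_all
qed

lemma yd_hom_inverse:
  assumes f: "yd_hom X Y f"
    and g: "\<And>y. y \<in> carrier (snd Y) \<Longrightarrow> g y \<in> carrier (snd X)"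
    and gf: "\<And>x. x \<in> carrier (snd X) \<Longrightarrow> g (f x) = x" and fg: "\<And>y. y \<in> carrier (snd Y) \<Longrightarrow> f (g y) = y"
  shows "yd_hom Y X g" and "yd_arrow X Y f \<in> Iso C X Y" and "Inv_arr C (yd_arrow X Y f) = yd_arrow Y X g"
  using arrow_inverse[OF yd_homD(1-4)[OF f] g gf fg] yd_homD(1-3)[OF f] by (simp_all add: yd_hom_def)

lemma yd_hom_assoc:
  assumes X: "X \<in> Obj C" and Y: "Y \<in> Obj C" and Z: "Z \<in> Obj C"
  shows "yd_hom ((X \<odot>\<odot> Y) \<odot>\<odot> Z) (X \<odot>\<odot> (Y \<odot>\<odot> Z)) (assoc_map (snd X) (snd Y) (snd Z))"
    and "yd_hom (X \<odot>\<odot> (Y \<odot>\<odot> Z)) ((X \<odot>\<odot> Y) \<odot>\<odot> Z) (assoc_inv (snd X) (snd Y) (snd Z))"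
    and "Assoc C X Y Z \<in> Iso C ((X \<odot>\<odot> Y) \<odot>\<odot> Z) (X \<odot>\<odot> (Y \<odot>\<odot> Z))"
    and "Inv_arr C (Assoc C X Y Z) = yd_arrow (X \<odot>\<odot> (Y \<odot>\<odot> Z)) ((X \<odot>\<odot> Y) \<odot>\<odot> Z) (assoc_inv (snd X) (snd Y) (snd Z))"
proof -
  note [simp] = X Y Z
  have "yd_map (snd ((X \<odot>\<odot> Y) \<odot>\<odot> Z)) (snd (X \<odot>\<odot> (Y \<odot>\<odot> Z))) (assoc_map (snd X) (snd Y) (snd Z))"
    unfolding yd_tensor_simps
    by (rule assoc_yd_map) (simp_all add: tau_def aut_mult_apply aut_inv_apply aut_rules(1) A.inv_mult_group)
  then show h: "yd_hom ((X \<odot>\<odot> Y) \<odot>\<odot> Z) (X \<odot>\<odot> (Y \<odot>\<odot> Z)) (assoc_map (snd X) (snd Y) (snd Z))"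
    unfolding yd_hom_def by (simp add: tensor_in_Obj G.m_assoc del: G_mult)
  note m = assoc_mod_hom[OF same_module_refl same_module_refl same_module_refl, of "snd X" "snd Y" "snd Z"]
  have 1: "assoc_inv (snd X) (snd Y) (snd Z) t \<in> carrier (snd ((X \<odot>\<odot> Y) \<odot>\<odot> Z))"
    if "t \<in> carrier (snd (X \<odot>\<odot> (Y \<odot>\<odot> Z)))" for t
    using that mod_hom_closed[OF m(2)] by simp
  have 2: "assoc_inv (snd X) (snd Y) (snd Z) (assoc_map (snd X) (snd Y) (snd Z) t) = t"
    if "t \<in> carrier (snd ((X \<odot>\<odot> Y) \<odot>\<odot> Z))" for t
    using that by (simp add: assoc_inverse)
  have 3: "assoc_map (snd X) (snd Y) (snd Z) (assoc_inv (snd X) (snd Y) (snd Z) t) = t"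
    if "t \<in> carrier (snd (X \<odot>\<odot> (Y \<odot>\<odot> Z)))" for t
    using that by (simp add: assoc_inverse)
  show "yd_hom (X \<odot>\<odot> (Y \<odot>\<odot> Z)) ((X \<odot>\<odot> Y) \<odot>\<odot> Z) (assoc_inv (snd X) (snd Y) (snd Z))"
    "Assoc C X Y Z \<in> Iso C ((X \<odot>\<odot> Y) \<odot>\<odot> Z) (X \<odot>\<odot> (Y \<odot>\<odot> Z))"
    "Inv_arr C (Assoc C X Y Z) = yd_arrow (X \<odot>\<odot> (Y \<odot>\<odot> Z)) ((X \<odot>\<odot> Y) \<odot>\<odot> Z) (assoc_inv (snd X) (snd Y) (snd Z))"
    unfolding hat_structure by (rule yd_hom_inverse[OF h 1 2 3]; assumption)+
qed

lemma yd_hom_unit: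
  assumes [simp]: "X \<in> Obj C"
  shows "yd_hom (yd_unit K H \<odot>\<odot> X) X (lunit_map (snd X))"
    and "yd_hom (X \<odot>\<odot> yd_unit K H) X (runit_map (snd X))"
    and "LUnit C X \<in> Iso C (yd_unit K H \<odot>\<odot> X) X"
    and "RUnit C X \<in> Iso C (X \<odot>\<odot> yd_unit K H) X"
proof -
  have "yd_map (snd (yd_unit K H \<odot>\<odot> X)) (snd X) (lunit_map (snd X))"
    unfolding yd_tensor_simps
    by (rule lunit_yd_map) (simp_all add: tau_def aut_mult_apply aut_inv_apply aut_one_apply aut_rules(1))
  then show l: "yd_hom (yd_unit K H \<odot>\<odot> X) X (lunit_map (snd X))"
    unfolding yd_hom_def by (simp add: tensor_in_Obj unit_in_Obj del: G_mult)
  have "yd_map (snd (X \<odot>\<odot> yd_unit K H)) (snd X) (runit_map (snd X))"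
    unfolding yd_tensor_simps
    by (rule runit_yd_map) (simp_all add: tau_def aut_mult_apply aut_inv_apply aut_one_apply aut_rules(1))
  then show r: "yd_hom (X \<odot>\<odot> yd_unit K H) X (runit_map (snd X))"
    unfolding yd_hom_def by (simp add: tensor_in_Obj unit_in_Obj del: G_mult)
  show "LUnit C X \<in> Iso C (yd_unit K H \<odot>\<odot> X) X"
    unfolding hat_structure
    by (rule yd_hom_inverse(2)[OF l, of "tpure K (ground K) (snd X) (Scalar \<one>\<^bsub>K\<^esub>)"]) (simp_all add: unit_maps_inverse)
  show "RUnit C X \<in> Iso C (X \<odot>\<odot> yd_unit K H) X"
    unfolding hat_structure
    by (rule yd_hom_inverse(2)[OF r, of "\<lambda>m. tpure K (snd X) (ground K) m (Scalar \<one>\<^bsub>K\<^esub>)"]) (simp_all add: unit_maps_inverse)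
qed

text \<open>Each side of an equation is rewritten as a single arrow, and the functions of the two
  arrows agree by the corresponding fact about linear maps. The hypotheses of composition are met by
  naming the partial composites.\<close>

lemma hat_monoidal: "monoidal_category C"
proof (rule monoidal_category.intro[OF hat_category], rule monoidal_category_axioms.intro, unfold hat_simps(1,2))
  fix W X Y Z X' Y' Z' X'' Y'' \<phi> \<psi> \<chi> \<phi>' \<psi>'
  show "yd_unit K H \<in> Obj C" by (rule unit_in_Obj)
  show "X \<odot>\<odot> Y \<in> Obj C" if "X \<in> Obj C" "Y \<in> Obj C" using that by (rule tensor_in_Obj)
  show "\<phi> \<star>\<^bsub>C\<^esub> \<psi> \<in> Hom C (X \<odot>\<odot> Y) (X' \<odot>\<odot> Y')" if "\<phi> \<in> Hom C X X'" "\<psi> \<in> Hom C Y Y'"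
    using that unfolding Hom_iff by (auto simp: yd_hom_tensor(2) intro: yd_hom_tensor(1))
  show "Ident C X \<star>\<^bsub>C\<^esub> Ident C Y = Ident C (X \<odot>\<odot> Y)" if X: "X \<in> Obj C" and Y: "Y \<in> Obj C"
    unfolding hat_simps yd_hom_tensor(2)[OF yd_hom_id[OF X] yd_hom_id[OF Y]]
    by (rule yd_arrow_eqI) (use X Y in \<open>simp add: tensor_fun_id\<close>)
  show "(\<phi>' \<cdot>\<^bsub>C\<^esub> \<phi>) \<star>\<^bsub>C\<^esub> (\<psi>' \<cdot>\<^bsub>C\<^esub> \<psi>) = (\<phi>' \<star>\<^bsub>C\<^esub> \<psi>') \<cdot>\<^bsub>C\<^esub> (\<phi> \<star>\<^bsub>C\<^esub> \<psi>)"
    if arr: "\<phi> \<in> Hom C X X'" "\<phi>' \<in> Hom C X' X''" "\<psi> \<in> Hom C Y Y'" "\<psi>' \<in> Hom C Y' Y''"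
  proof -
    obtain f f' g g' where f: "yd_hom X X' f" "\<phi> = yd_arrow X X' f" and f': "yd_hom X' X'' f'" "\<phi>' = yd_arrow X' X'' f'"
      and g: "yd_hom Y Y' g" "\<psi> = yd_arrow Y Y' g" and g': "yd_hom Y' Y'' g'" "\<psi>' = yd_arrow Y' Y'' g'"
      using arr unfolding Hom_iff by blast
    note [simp] = yd_homD(1,2)[OF f(1)] yd_homD(1,2)[OF g(1)] yd_homD(1,2)[OF f'(1)] yd_homD(1,2)[OF g'(1)]
    show ?thesis
      unfolding f(2) f'(2) g(2) g'(2) yd_hom_compose(2)[OF f(1) f'(1)] yd_hom_compose(2)[OF g(1) g'(1)]
        yd_hom_tensor(2)[OF f(1) g(1)] yd_hom_tensor(2)[OF f'(1) g'(1)]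
        yd_hom_compose(2)[OF yd_hom_tensor(1)[OF f(1) g(1)] yd_hom_tensor(1)[OF f'(1) g'(1)]]
        yd_hom_tensor(2)[OF yd_hom_compose(1)[OF f(1) f'(1)] yd_hom_compose(1)[OF g(1) g'(1)]]
      by (rule yd_arrow_eqI, rule tensor_fun_compose[symmetric, OF yd_homD(5)[OF f(1)] yd_homD(5)[OF f'(1)]
          yd_homD(5)[OF g(1)] yd_homD(5)[OF g'(1)]]) simp_all
  qed
  show "Assoc C X Y Z \<in> Iso C ((X \<odot>\<odot> Y) \<odot>\<odot> Z) (X \<odot>\<odot> (Y \<odot>\<odot> Z))"
    if "X \<in> Obj C" "Y \<in> Obj C" "Z \<in> Obj C"
    using that by (rule yd_hom_assoc)
  show "LUnit C X \<in> Iso C (yd_unit K H \<odot>\<odot> X) X" "RUnit C X \<in> Iso C (X \<odot>\<odot> yd_unit K H) X" if "X \<in> Obj C"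
    using that by (rule yd_hom_unit)+
  show "Assoc C X' Y' Z' \<cdot>\<^bsub>C\<^esub> ((\<phi> \<star>\<^bsub>C\<^esub> \<psi>) \<star>\<^bsub>C\<^esub> \<chi>) = (\<phi> \<star>\<^bsub>C\<^esub> (\<psi> \<star>\<^bsub>C\<^esub> \<chi>)) \<cdot>\<^bsub>C\<^esub> Assoc C X Y Z"
    if arr: "\<phi> \<in> Hom C X X'" "\<psi> \<in> Hom C Y Y'" "\<chi> \<in> Hom C Z Z'"
  proof -
    obtain f g h where f: "yd_hom X X' f" "\<phi> = yd_arrow X X' f" and g: "yd_hom Y Y' g" "\<psi> = yd_arrow Y Y' g"
      and h: "yd_hom Z Z' h" "\<chi> = yd_arrow Z Z' h"
      using arr unfolding Hom_iff by blast
    note o [simp] = yd_homD(1,2)[OF f(1)] yd_homD(1,2)[OF g(1)] yd_homD(1,2)[OF h(1)]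
    note fg = yd_hom_tensor[OF f(1) g(1)] and gh = yd_hom_tensor[OF g(1) h(1)]
    note fg_h = yd_hom_tensor[OF fg(1) h(1)] and f_gh = yd_hom_tensor[OF f(1) gh(1)]
    show ?thesis
      unfolding f(2) g(2) h(2) fg(2) gh(2) fg_h(2) f_gh(2) hat_structure
        yd_hom_compose(2)[OF fg_h(1) yd_hom_assoc(1)[OF o(2,4,6)]]
        yd_hom_compose(2)[OF yd_hom_assoc(1)[OF o(1,3,5)] f_gh(1)]
      by (rule yd_arrow_eqI) (simp add: assoc_natural[OF yd_homD(5)[OF f(1)] yd_homD(5)[OF g(1)] yd_homD(5)[OF h(1)]])
  qed
  show "LUnit C Y \<cdot>\<^bsub>C\<^esub> (Ident C (yd_unit K H) \<star>\<^bsub>C\<^esub> \<phi>) = \<phi> \<cdot>\<^bsub>C\<^esub> LUnit C X"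
    "RUnit C Y \<cdot>\<^bsub>C\<^esub> (\<phi> \<star>\<^bsub>C\<^esub> Ident C (yd_unit K H)) = \<phi> \<cdot>\<^bsub>C\<^esub> RUnit C X" if \<phi>: "\<phi> \<in> Hom C X Y"
  proof -
    obtain f where f: "yd_hom X Y f" "\<phi> = yd_arrow X Y f"
      using \<phi> unfolding Hom_iff by blast
    note o [simp] = yd_homD(1,2)[OF f(1)]
    note u = yd_hom_id[OF unit_in_Obj]
    note l = yd_hom_tensor[OF u f(1)] and r = yd_hom_tensor[OF f(1) u]
    show "LUnit C Y \<cdot>\<^bsub>C\<^esub> (Ident C (yd_unit K H) \<star>\<^bsub>C\<^esub> \<phi>) = \<phi> \<cdot>\<^bsub>C\<^esub> LUnit C X"
      unfolding f(2) hat_simps hat_structure l(2) yd_hom_compose(2)[OF l(1) yd_hom_unit(1)[OF o(2)]]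
        yd_hom_compose(2)[OF yd_hom_unit(1)[OF o(1)] f(1)]
      by (rule yd_arrow_eqI) (simp add: unit_natural[OF yd_homD(5)[OF f(1)]])
    show "RUnit C Y \<cdot>\<^bsub>C\<^esub> (\<phi> \<star>\<^bsub>C\<^esub> Ident C (yd_unit K H)) = \<phi> \<cdot>\<^bsub>C\<^esub> RUnit C X"
      unfolding f(2) hat_simps hat_structure r(2) yd_hom_compose(2)[OF r(1) yd_hom_unit(2)[OF o(2)]]
        yd_hom_compose(2)[OF yd_hom_unit(2)[OF o(1)] f(1)]
      by (rule yd_arrow_eqI) (simp add: unit_natural[OF yd_homD(5)[OF f(1)]])
  qed
  show "(Ident C W \<star>\<^bsub>C\<^esub> Assoc C X Y Z) \<cdot>\<^bsub>C\<^esub> Assoc C W (X \<odot>\<odot> Y) Z \<cdot>\<^bsub>C\<^esub> (Assoc C W X Y \<star>\<^bsub>C\<^esub> Ident C Z)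
        = Assoc C W X (Y \<odot>\<odot> Z) \<cdot>\<^bsub>C\<^esub> Assoc C (W \<odot>\<odot> X) Y Z"
    if o: "W \<in> Obj C" "X \<in> Obj C" "Y \<in> Obj C" "Z \<in> Obj C"
  proof -
    note [simp] = o
    note c1 = yd_hom_tensor[OF yd_hom_assoc(1)[OF o(1-3)] yd_hom_id[OF o(4)]]
    note c2 = yd_hom_assoc(1)[OF o(1) tensor_in_Obj[OF o(2,3)] o(4)]
    note c3 = yd_hom_tensor[OF yd_hom_id[OF o(1)] yd_hom_assoc(1)[OF o(2-4)]]
    note c12 = yd_hom_compose[OF c1(1) c2] and d1 = yd_hom_assoc(1)[OF tensor_in_Obj[OF o(1,2)] o(3,4)]
    note c123 = yd_hom_compose[OF c12(1) c3(1)]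
    note d12 = yd_hom_compose[OF d1 yd_hom_assoc(1)[OF o(1,2) tensor_in_Obj[OF o(3,4)]]]
    show ?thesis
      unfolding hat_simps hat_structure c1(2) c3(2) c12(2) c123(2) d12(2)
      by (rule yd_arrow_eqI) (simp add: assoc_pentagon)
  qed
  show "(Ident C X \<star>\<^bsub>C\<^esub> LUnit C Y) \<cdot>\<^bsub>C\<^esub> Assoc C X (yd_unit K H) Y = RUnit C X \<star>\<^bsub>C\<^esub> Ident C Y"
    if o: "X \<in> Obj C" "Y \<in> Obj C"
  proof -
    note [simp] = o
    note c1 = yd_hom_tensor[OF yd_hom_id[OF o(1)] yd_hom_unit(1)[OF o(2)]]
    note c2 = yd_hom_tensor[OF yd_hom_unit(2)[OF o(1)] yd_hom_id[OF o(2)]]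
    note c3 = yd_hom_assoc(1)[OF o(1) unit_in_Obj o(2)]
    show ?thesis
      unfolding hat_simps hat_structure c1(2) c2(2) yd_hom_compose(2)[OF c3 c1(1)]
      by (rule yd_arrow_eqI) (simp add: assoc_triangle)
  qed
qed

section \<open>The crossed structure\<close>

text \<open>Strictness asks for equality of records. The module axioms make actions and coactions
  extensional, so agreement on the carriers forces equality.\<close>

lemma yd_obj_eqI:
  fixes M N :: "('k, 'x) yd_mod"
  assumes "same_module M N" "left_module K H M" "left_module K H N" "right_comodule K H M" "right_comodule K H N"
    and act: "\<And>h m. \<lbrakk>h \<in> carrier H; m \<in> carrier N\<rbrakk> \<Longrightarrow> act M h m = act N h m"
    and coact: "\<And>m. m \<in> carrier N \<Longrightarrow> coact M m = coact N m"
  shows "M = N"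
proof -
  have car: "carrier M = carrier N" using assms(1) by (simp add: same_module_def)
  have a: "act M \<in> carrier H \<rightarrow>\<^sub>E (carrier M \<rightarrow>\<^sub>E carrier M)" "act N \<in> carrier H \<rightarrow>\<^sub>E (carrier N \<rightarrow>\<^sub>E carrier N)"
    using assms(2,3) unfolding left_module_def by blast+
  have c: "coact M \<in> extensional (carrier M)" "coact N \<in> extensional (carrier N)"
    using assms(4,5) unfolding right_comodule_def by blast+
  have "act M h = act N h" for h
  proof (cases "h \<in> carrier H")
    case True
    have "act M h \<in> extensional (carrier N)" "act N h \<in> extensional (carrier N)"
      using PiE_mem[OF a(1) True] PiE_mem[OF a(2) True] car by (auto simp: PiE_def)
    then show ?thesis
      by (rule extensionalityI) (use act True in simp)
  next
    case False
    then show ?thesis using PiE_arb[OF a(1) False] PiE_arb[OF a(2) False] by simp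
  qed
  moreover have "coact M = coact N"
    using c unfolding car by (rule extensionalityI) (use coact in simp)
  ultimately show ?thesis
    using assms(1) by (intro yd_mod.equality) (simp_all add: same_module_def fun_eq_iff)
qed

text \<open>The underlying tensor space is the same on both sides. The actions agree because
  \<kappa> is a coalgebra map, the coactions because \<mu> can be moved past \<delta> and \<epsilon>
  by the two relations.\<close>

lemma conj_obj_tensor:
  fixes M N :: "('k, 'x) yd_mod"
  assumes [simp]: "left_module K H M" "left_module K H N" "right_comodule K H M" "right_comodule K H N"
    and aut [simp]: "\<kappa> \<in> carrier A" "\<mu> \<in> carrier A" "\<mu>1 \<in> carrier A" "\<mu>2 \<in> carrier A"
      "\<delta> \<in> carrier A" "\<epsilon> \<in> carrier A" "\<delta>' \<in> carrier A" "\<epsilon>' \<in> carrier A"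
    and eqs: "\<And>h. h \<in> carrier H \<Longrightarrow> \<mu> (\<delta> h) = \<delta>' (\<mu>1 h)" "\<And>h. h \<in> carrier H \<Longrightarrow> \<mu> (\<epsilon> h) = \<epsilon>' (\<mu>2 h)"
  shows "conj_obj \<kappa> \<mu> (tensor_obj \<delta> \<epsilon> M N) = tensor_obj \<delta>' \<epsilon>' (conj_obj \<kappa> \<mu>1 M) (conj_obj \<kappa> \<mu>2 N)"
    (is "?L = ?R")
proof (rule yd_obj_eqI)
  note [simp] = aut_rules[OF aut(1)] aut_rules[OF aut(2)] aut_rules[OF aut(3)] aut_rules[OF aut(4)]
    aut_rules[OF aut(5)] aut_rules[OF aut(6)] aut_rules[OF aut(7)] aut_rules[OF aut(8)]
  let ?T = "tensor K M N" and ?P = "tensor K (tensor K M N) H"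
  show "same_module ?L ?R"
    using same_module_sym[OF same_module_tensor_obj[of \<delta>' \<epsilon>' "conj_obj \<kappa> \<mu>1 M" "conj_obj \<kappa> \<mu>2 N"]] by simp
  show "act ?L h t = act ?R h t" if h: "h \<in> carrier H" and t: "t \<in> carrier ?R" for h t
  proof -
    have t: "t \<in> carrier ?T" using t by simp
    have "act (tensor_obj \<delta> \<epsilon> M N) (\<kappa> h) t = act ?R h t"
    proof (rule tensor_hom_eqI[where f = "act (tensor_obj \<delta> \<epsilon> M N) (\<kappa> h)" and g = "act ?R h" and P = ?T, OF _ _ t])
      show "act (tensor_obj \<delta> \<epsilon> M N) (\<kappa> h) (tpure K M N m n) = act ?R h (tpure K M N m n)"
        if "m \<in> carrier M" "n \<in> carrier N" for m n
        using h that by (simp add: tensor_pure_rules(1) comult_aut[OF aut(1)] bilinear_map_def)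
    qed (use h in simp_all)
    then show ?thesis using h t by simp
  qed
  show "coact ?L t = coact ?R t" if t: "t \<in> carrier ?R" for t
  proof -
    have t: "t \<in> carrier ?T" using t by simp
    have "tsum ?P (coact (tensor_obj \<delta> \<epsilon> M N) t) (\<lambda>x y. tpure K ?T H x (\<mu> y)) = coact ?R t"
    proof (rule tensor_hom_eqI[where f = "\<lambda>t. tsum ?P (coact (tensor_obj \<delta> \<epsilon> M N) t) (\<lambda>x y. tpure K ?T H x (\<mu> y))"
        and g = "coact ?R" and P = ?P, OF _ _ t])
      show "tsum ?P (coact (tensor_obj \<delta> \<epsilon> M N) (tpure K M N m n)) (\<lambda>x y. tpure K ?T H x (\<mu> y)) = coact ?R (tpure K M N m n)"
        if mn: "m \<in> carrier M" "n \<in> carrier N" for m n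
      proof -
        have "coact ?R (tpure K M N m n) = tsum ?P (coact M m) (\<lambda>m0 m1. tsum ?P (coact N n) (\<lambda>n0 n1.
            tpure K ?T H (tpure K M N m0 n0) (\<delta>' (\<mu>1 m1) \<otimes>\<^bsub>H\<^esub> \<epsilon>' (\<mu>2 n1))))"
          using mn by (simp add: tensor_pure_rules(2) tsum_coact_conj bilinear_map_def)
        then show ?thesis
          using mn by (simp add: tensor_pure_rules(3) bilinear_map_def eqs)
      qed
    qed (simp_all add: bilinear_map_def)
    then show ?thesis using t by (simp add: coact_conj)
  qed
qed simp_all

text \<open>Automorphisms preserve the counit, which gives the action, and the element 1, which is
  the only coefficient.\<close>

lemma conj_obj_unit:
  assumes aut [simp]: "\<kappa> \<in> carrier A" "\<mu> \<in> carrier A"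
  shows "conj_obj \<kappa> \<mu> unit_obj = (unit_obj :: ('k, 'x) yd_mod)"
proof (rule yd_obj_eqI)
  note [simp] = aut_rules[OF aut(1)] aut_rules[OF aut(2)]
  show "same_module (conj_obj \<kappa> \<mu> unit_obj) (unit_obj :: ('k, 'x) yd_mod)"
    using same_module_conj_obj by blast
  show "coact (conj_obj \<kappa> \<mu> unit_obj) x = coact unit_obj x" if "x \<in> carrier unit_obj" for x :: "('k, 'x) vect"
    using that by (simp add: coact_conj tsum_tpure bilinear_map_def)
qed (simp_all add: aut_rules[OF aut(1)])

text \<open>Twists of the action compose in the reverse order, because the outer one reaches h
  first; twists of the coaction compose in the given order.\<close>

lemma conj_obj_compose:
  fixes N :: "('k, 'x) yd_mod"
  assumes N [simp]: "left_module K H N" "right_comodule K H N"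
    and aut [simp]: "\<kappa> \<in> carrier A" "\<mu> \<in> carrier A" "\<kappa>' \<in> carrier A" "\<mu>' \<in> carrier A" "\<kappa>'' \<in> carrier A" "\<mu>'' \<in> carrier A"
    and eqs: "\<And>h. h \<in> carrier H \<Longrightarrow> \<kappa>'' h = \<kappa>' (\<kappa> h)" "\<And>h. h \<in> carrier H \<Longrightarrow> \<mu>'' h = \<mu> (\<mu>' h)"
  shows "conj_obj \<kappa>'' \<mu>'' N = conj_obj \<kappa> \<mu> (conj_obj \<kappa>' \<mu>' N)"
proof (rule yd_obj_eqI)
  note [simp] = aut_rules[OF aut(1)] aut_rules[OF aut(2)] aut_rules[OF aut(3)] aut_rules[OF aut(4)]
    aut_rules[OF aut(5)] aut_rules[OF aut(6)]
  show "same_module (conj_obj \<kappa>'' \<mu>'' N) (conj_obj \<kappa> \<mu> (conj_obj \<kappa>' \<mu>' N))"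
    by (simp add: same_module_sym[OF same_module_conj_obj] same_module_def conj_obj_def)
  show "coact (conj_obj \<kappa>'' \<mu>'' N) m = coact (conj_obj \<kappa> \<mu> (conj_obj \<kappa>' \<mu>' N)) m"
    if "m \<in> carrier (conj_obj \<kappa> \<mu> (conj_obj \<kappa>' \<mu>' N))" for m
  proof -
    have "tsum (tensor K N H) (coact (conj_obj \<kappa>' \<mu>' N) m) (\<lambda>x y. tpure K N H x (\<mu> y))
      = tsum (tensor K N H) (coact N m) (\<lambda>x y. tpure K N H x (\<mu>'' y))"
      using that by (simp add: tsum_coact_conj bilinear_map_def eqs)
    then show ?thesis using that by (simp add: coact_conj)
  qed
qed (simp_all add: eqs aut_rules[OF aut(1)] aut_rules[OF aut(3)])

lemma conj_obj_id:
  fixes N :: "('k, 'x) yd_mod"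
  assumes N [simp]: "left_module K H N" "right_comodule K H N"
    and aut [simp]: "\<kappa> \<in> carrier A" "\<mu> \<in> carrier A"
    and eqs: "\<And>h. h \<in> carrier H \<Longrightarrow> \<kappa> h = h" "\<And>h. h \<in> carrier H \<Longrightarrow> \<mu> h = h"
  shows "conj_obj \<kappa> \<mu> N = N"
  by (rule yd_obj_eqI) (simp_all add: same_module_conj_obj coact_conj eqs tsum_tpure_id)

section \<open>Conjugation by an index\<close>

definition kap where
  "kap a = inv\<^bsub>A\<^esub> (fst a) \<otimes>\<^bsub>A\<^esub> snd a"

text \<open>Unlike \<open>kap\<close>, this twist depends also on the index b of the object to be
  conjugated.\<close>

definition mu where
  "mu a b = inv\<^bsub>A\<^esub> (snd a) \<otimes>\<^bsub>A\<^esub> snd b \<otimes>\<^bsub>A\<^esub> fst a \<otimes>\<^bsub>A\<^esub> inv\<^bsub>A\<^esub> (snd b)"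

lemma kap_mu_closed [simp]:
  "a \<in> carrier G \<Longrightarrow> kap a \<in> carrier A" "\<lbrakk>a \<in> carrier G; b \<in> carrier G\<rbrakk> \<Longrightarrow> mu a b \<in> carrier A"
  by (simp_all add: kap_def mu_def)

abbreviation "cobj a X \<equiv> yd_conj_obj K H a X"

lemma conj_simps [simp]:
  "fst (cobj a X) = a \<otimes>\<^bsub>G\<^esub> fst X \<otimes>\<^bsub>G\<^esub> inv\<^bsub>G\<^esub> a"
  "snd (cobj a X) = conj_obj (kap a) (mu a (fst X)) (snd X)"
proof -
  obtain \<alpha> \<beta> \<gamma> \<delta> N where "a = (\<alpha>, \<beta>)" "X = ((\<gamma>, \<delta>), N)"
    by (metis surj_pair)
  then show "fst (cobj a X) = a \<otimes>\<^bsub>G\<^esub> fst X \<otimes>\<^bsub>G\<^esub> inv\<^bsub>G\<^esub> a" "snd (cobj a X) = conj_obj (kap a) (mu a (fst X)) (snd X)"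
    by (simp_all add: Let_def conj_obj_def kap_def mu_def)
qed

text \<open>Turns a word of automorphisms applied to h into nested applications, in which a map
  meeting its inverse cancels; this settles the relations between twists.\<close>

lemmas aut_word_apply = kap_def mu_def tau_def aut_mult_apply aut_inv_apply aut_one_apply aut_rules(1) A.inv_mult_group

lemma conj_in_Obj:
  assumes a: "a \<in> carrier G" and X: "X \<in> Obj C"
  shows "cobj a X \<in> Obj C"
proof -
  let ?b = "a \<otimes>\<^bsub>G\<^esub> fst X \<otimes>\<^bsub>G\<^esub> inv\<^bsub>G\<^esub> a"
  have "yd_module K H (fst ?b, snd ?b) (conj_obj (kap a) (mu a (fst X)) (snd X))"
    by (rule conj_yd_module[OF Obj_simps(4)[OF X]]) (use a X in \<open>simp_all add: aut_word_apply\<close>)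
  then show ?thesis
    using a X unfolding hat_Obj prod.collapse by simp
qed

lemma conj_tensor:
  assumes a: "a \<in> carrier G" and X: "X \<in> Obj C" and Y: "Y \<in> Obj C"
  shows "cobj a (X \<odot>\<odot> Y) = cobj a X \<odot>\<odot> cobj a Y"
proof (rule prod_eqI)
  show "fst (cobj a (X \<odot>\<odot> Y)) = fst (cobj a X \<odot>\<odot> cobj a Y)"
    using assms by (simp add: G.m_assoc group_inv_cancel[OF G_group] del: G_mult G_inv)
  show "snd (cobj a (X \<odot>\<odot> Y)) = snd (cobj a X \<odot>\<odot> cobj a Y)"
    unfolding conj_simps yd_tensor_simps
    by (rule conj_obj_tensor) (use assms in \<open>simp_all add: aut_word_apply\<close>)
qed

lemma conj_unit:
  assumes "a \<in> carrier G"
  shows "cobj a (yd_unit K H) = yd_unit K H"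
  by (rule prod_eqI) (use assms in \<open>simp_all add: conj_obj_unit del: G_mult G_inv G_one\<close>)

text \<open>In the group of automorphisms \<open>kap (a b)\<close> is \<open>kap b\<close> after
  \<open>kap a\<close>, and \<open>mu\<close> obeys a cocycle rule: \<open>mu (a b) x\<close> is
  \<open>mu a\<close> at the conjugated index b x b\<inverse> after \<open>mu b x\<close>.\<close>

lemma conj_compose:
  assumes a: "a \<in> carrier G" and b: "b \<in> carrier G" and X: "X \<in> Obj C"
  shows "cobj (a \<otimes>\<^bsub>G\<^esub> b) X = cobj a (cobj b X)"
proof (rule prod_eqI)
  show "fst (cobj (a \<otimes>\<^bsub>G\<^esub> b) X) = fst (cobj a (cobj b X))"
    using assms by (simp add: G.m_assoc G.inv_mult_group del: G_mult G_inv)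
  show "snd (cobj (a \<otimes>\<^bsub>G\<^esub> b) X) = snd (cobj a (cobj b X))"
    unfolding conj_simps
    by (rule conj_obj_compose) (use assms in \<open>simp_all add: aut_word_apply\<close>)
qed

lemma conj_one:
  assumes X: "X \<in> Obj C"
  shows "cobj \<one>\<^bsub>G\<^esub> X = X"
proof (rule prod_eqI)
  show "fst (cobj \<one>\<^bsub>G\<^esub> X) = fst X"
    using assms by (simp del: G_mult G_inv G_one)
  show "snd (cobj \<one>\<^bsub>G\<^esub> X) = snd X"
    unfolding conj_simps
    by (rule conj_obj_id) (use assms in \<open>simp_all add: aut_word_apply\<close>)
qed

text \<open>Source and target have the same index and therefore receive the same twists.\<close>

lemma yd_hom_conj:
  assumes a: "a \<in> carrier G" and f: "yd_hom X Y f"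
  shows "yd_hom (cobj a X) (cobj a Y) f"
proof -
  note [simp] = yd_homD(1,2)[OF f] a
  have "yd_map (snd (cobj a X)) (snd (cobj a Y)) f"
    unfolding conj_simps yd_homD(3)[OF f] by (rule conj_yd_map[OF yd_homD(4)[OF f]]) simp_all
  then show ?thesis
    unfolding yd_hom_def by (simp add: conj_in_Obj yd_homD(3)[OF f])
qed

lemma conj_fst: "X \<in> Obj C \<Longrightarrow> fst (yd_conj K H a) X = cobj a X"
  by (simp add: yd_conj_def)

lemma conj_snd:
  assumes f: "yd_hom X Y f"
  shows "snd (yd_conj K H a) (yd_arrow X Y f) = yd_arrow (cobj a X) (cobj a Y) f"
proof -
  have "yd_arrow X Y f \<in> Arr C"
    using f unfolding hat_Arr yd_hom_def by blast
  moreover have "yd_arrow X Y f = (fst X, snd X, snd Y, restrict f (carrier (snd X)))"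
    by (simp add: yd_arrow_def)
  moreover have "(fst X, snd Y) = Y" using yd_homD(3)[OF f] by simp
  ultimately have "snd (yd_conj K H a) (yd_arrow X Y f)
      = yd_arrow (cobj a X) (cobj a Y) (restrict f (carrier (snd X)))"
    by (simp add: yd_conj_def)
  also have "\<dots> = yd_arrow (cobj a X) (cobj a Y) f"
    by (rule yd_arrow_eqI) simp
  finally show ?thesis .
qed

lemma Arr_iff: "\<phi> \<in> Arr C \<longleftrightarrow> (\<exists>X Y f. yd_hom X Y f \<and> \<phi> = yd_arrow X Y f)"
  unfolding hat_Arr yd_hom_def by blast

text \<open>Conjugation leaves the function of an arrow unchanged, so the conditions reduce to
  equalities between sources and targets, which \<open>conj_tensor\<close> and
  \<open>conj_unit\<close> supply.\<close>

lemma conj_strict: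
  assumes a: "a \<in> carrier G"
  shows "yd_conj K H a \<in> strict_tensor_functors C"
proof -
  let ?F = "fst (yd_conj K H a)" and ?f = "snd (yd_conj K H a)"
  have c1: "?F \<in> Obj C \<rightarrow>\<^sub>E Obj C"
    using conj_in_Obj[OF a] by (auto simp: yd_conj_def)
  have c2: "?f \<in> extensional (Arr C)"
    by (simp add: yd_conj_def)
  have c3: "?f ` Hom C X Y \<subseteq> Hom C (?F X) (?F Y)" if "X \<in> Obj C" "Y \<in> Obj C" for X Y
    unfolding conj_fst[OF that(1)] conj_fst[OF that(2)]
  proof (intro image_subsetI)
    fix \<phi> assume "\<phi> \<in> Hom C X Y"
    then obtain f where f: "yd_hom X Y f" "\<phi> = yd_arrow X Y f"
      unfolding Hom_iff by blast
    show "?f \<phi> \<in> Hom C (cobj a X) (cobj a Y)"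
      unfolding f(2) conj_snd[OF f(1)] Hom_iff using yd_hom_conj[OF a f(1)] by blast
  qed
  have c4: "?f (Ident C X) = Ident C (?F X)" if "X \<in> Obj C" for X
    using that by (simp add: hat_simps conj_snd[OF yd_hom_id] conj_fst)
  have c5: "?f (\<psi> \<cdot>\<^bsub>C\<^esub> \<phi>) = ?f \<psi> \<cdot>\<^bsub>C\<^esub> ?f \<phi>" if arr: "\<phi> \<in> Arr C" "\<psi> \<in> Arr C" "Dom C \<psi> = Cod C \<phi>" for \<phi> \<psi>
  proof -
    obtain X Y f where f: "yd_hom X Y f" "\<phi> = yd_arrow X Y f"
      using arr(1) unfolding Arr_iff by blast
    obtain Y' Z g where g: "yd_hom Y' Z g" "\<psi> = yd_arrow Y' Z g"
      using arr(2) unfolding Arr_iff by blast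
    have Y: "Y' = Y" using arr(3) f g yd_homD(3)[OF f(1)] by simp
    note g = g[unfolded Y]
    show ?thesis
      unfolding f(2) g(2) yd_hom_compose(2)[OF f(1) g(1)] conj_snd[OF f(1)] conj_snd[OF g(1)]
        conj_snd[OF yd_hom_compose(1)[OF f(1) g(1)]] yd_hom_compose(2)[OF yd_hom_conj[OF a f(1)] yd_hom_conj[OF a g(1)]] ..
  qed
  have c6: "?F (UnitO C) = UnitO C"
    by (simp add: hat_simps conj_fst unit_in_Obj conj_unit[OF a])
  have c7: "?F (X \<odot>\<odot> Y) = ?F X \<odot>\<odot> ?F Y" if "X \<in> Obj C" "Y \<in> Obj C" for X Y
    using that by (simp add: conj_fst tensor_in_Obj conj_tensor[OF a])
  have c8: "?f (\<phi> \<star>\<^bsub>C\<^esub> \<psi>) = ?f \<phi> \<star>\<^bsub>C\<^esub> ?f \<psi>" if arr: "\<phi> \<in> Arr C" "\<psi> \<in> Arr C" for \<phi> \<psi>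
  proof -
    obtain X X' f where f: "yd_hom X X' f" "\<phi> = yd_arrow X X' f"
      using arr(1) unfolding Arr_iff by blast
    obtain Y Y' g where g: "yd_hom Y Y' g" "\<psi> = yd_arrow Y Y' g"
      using arr(2) unfolding Arr_iff by blast
    show ?thesis
      unfolding f(2) g(2) yd_hom_tensor(2)[OF f(1) g(1)] conj_snd[OF f(1)] conj_snd[OF g(1)]
        conj_snd[OF yd_hom_tensor(1)[OF f(1) g(1)]] yd_hom_tensor(2)[OF yd_hom_conj[OF a f(1)] yd_hom_conj[OF a g(1)]]
        conj_tensor[OF a yd_homD(1)[OF f(1)] yd_homD(1)[OF g(1)]] conj_tensor[OF a yd_homD(2)[OF f(1)] yd_homD(2)[OF g(1)]]
      by simp
  qed
  have c9: "?f (Assoc C X Y Z) = Assoc C (?F X) (?F Y) (?F Z)" if o: "X \<in> Obj C" "Y \<in> Obj C" "Z \<in> Obj C" for X Y Z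
    using o unfolding hat_structure conj_snd[OF yd_hom_assoc(1)[OF o]]
    by (simp add: conj_fst conj_tensor[OF a] tensor_in_Obj)
  have c10: "?f (LUnit C X) = LUnit C (?F X)" "?f (RUnit C X) = RUnit C (?F X)" if o: "X \<in> Obj C" for X
    using o unfolding hat_structure conj_snd[OF yd_hom_unit(1)[OF o]] conj_snd[OF yd_hom_unit(2)[OF o]]
    by (simp_all add: conj_fst conj_tensor[OF a] unit_in_Obj conj_unit[OF a])
  show ?thesis
    unfolding strict_tensor_functors_def mem_Collect_eq case_prod_unfold hat_simps(1)
    by (intro conjI ballI impI; rule c1 c2 c3 c4 c5 c6 c7 c8 c9 c10; assumption)
qed

lemma conj_functor_compose:
  assumes a: "a \<in> carrier G" and b: "b \<in> carrier G"
  shows "yd_conj K H (a \<otimes>\<^bsub>G\<^esub> b)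
    = (compose (Obj C) (fst (yd_conj K H a)) (fst (yd_conj K H b)), compose (Arr C) (snd (yd_conj K H a)) (snd (yd_conj K H b)))"
    (is "?l = (?F, ?f)")
proof (rule prod_eqI, unfold fst_conv snd_conv)
  show "fst ?l = ?F"
  proof (rule extensionalityI[of _ "Obj C"])
    show "fst ?l X = ?F X" if "X \<in> Obj C" for X
      using that by (simp add: compose_eq conj_fst conj_in_Obj[OF b] conj_compose[OF a b] del: G_mult)
  qed (simp_all add: yd_conj_def)
  show "snd ?l = ?f"
  proof (rule extensionalityI[of _ "Arr C"])
    show "snd ?l \<phi> = ?f \<phi>" if \<phi>: "\<phi> \<in> Arr C" for \<phi>
    proof -
      obtain X Y f where f: "yd_hom X Y f" "\<phi> = yd_arrow X Y f"
        using \<phi> unfolding Arr_iff by blast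
      show ?thesis
        unfolding compose_eq[OF \<phi>] unfolding f(2) conj_snd[OF f(1)] conj_snd[OF yd_hom_conj[OF b f(1)]]
          conj_compose[OF a b yd_homD(1)[OF f(1)]] conj_compose[OF a b yd_homD(2)[OF f(1)]] ..
    qed
  qed (simp_all add: yd_conj_def)
qed

lemma conj_functor_one: "yd_conj K H \<one>\<^bsub>G\<^esub> = (\<lambda>X\<in>Obj C. X, \<lambda>\<phi>\<in>Arr C. \<phi>)"
proof (rule prod_eqI)
  show "fst (yd_conj K H \<one>\<^bsub>G\<^esub>) = fst (\<lambda>X\<in>Obj C. X, \<lambda>\<phi>\<in>Arr C. \<phi>)"
    unfolding fst_conv
    by (rule extensionalityI[of _ "Obj C"]) (simp_all add: yd_conj_def conj_one)
  show "snd (yd_conj K H \<one>\<^bsub>G\<^esub>) = snd (\<lambda>X\<in>Obj C. X, \<lambda>\<phi>\<in>Arr C. \<phi>)"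
    unfolding snd_conv
  proof (rule extensionalityI[of _ "Arr C"])
    show "snd (yd_conj K H \<one>\<^bsub>G\<^esub>) \<phi> = (\<lambda>\<phi>\<in>Arr C. \<phi>) \<phi>" if \<phi>: "\<phi> \<in> Arr C" for \<phi>
    proof -
      obtain X Y f where f: "yd_hom X Y f" "\<phi> = yd_arrow X Y f"
        using \<phi> unfolding Arr_iff by blast
      show ?thesis
        unfolding restrict_apply'[OF \<phi>] unfolding f(2) conj_snd[OF f(1)]
          conj_one[OF yd_homD(1)[OF f(1)]] conj_one[OF yd_homD(2)[OF f(1)]] ..
    qed
  qed (simp_all add: yd_conj_def)
qed

text \<open>The functors have to be invertible. By multiplicativity, conjugation by the inverse
  index is a two-sided inverse.\<close>

lemma conj_hom: "yd_conj K H \<in> hom G (tensor_aut C)"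
proof -
  let ?M = "\<lparr>carrier = strict_tensor_functors C,
     mult = \<lambda>(F, f) (F', f'). (compose (Obj C) F F', compose (Arr C) f f'),
     one = (\<lambda>X\<in>Obj C. X, \<lambda>f\<in>Arr C. f)\<rparr>"
  have mult: "yd_conj K H (a \<otimes>\<^bsub>G\<^esub> b) = yd_conj K H a \<otimes>\<^bsub>?M\<^esub> yd_conj K H b" if "a \<in> carrier G" "b \<in> carrier G" for a b
    using conj_functor_compose[OF that] by (simp add: case_prod_unfold)
  have "yd_conj K H a \<in> Units ?M" if a: "a \<in> carrier G" for a
  proof -
    have "yd_conj K H (inv\<^bsub>G\<^esub> a) \<otimes>\<^bsub>?M\<^esub> yd_conj K H a = \<one>\<^bsub>?M\<^esub>" "yd_conj K H a \<otimes>\<^bsub>?M\<^esub> yd_conj K H (inv\<^bsub>G\<^esub> a) = \<one>\<^bsub>?M\<^esub>"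
      unfolding mult[OF a G.inv_closed[OF a], symmetric] mult[OF G.inv_closed[OF a] a, symmetric]
      using a by (simp_all add: conj_functor_one del: G_mult G_inv G_one)
    moreover have "yd_conj K H a \<in> carrier ?M" "yd_conj K H (inv\<^bsub>G\<^esub> a) \<in> carrier ?M"
      using conj_strict[OF a] conj_strict[OF G.inv_closed[OF a]] by simp_all
    ultimately show ?thesis
      unfolding Units_def by blast
  qed
  then show ?thesis
    using mult by (simp add: hom_def tensor_aut_def units_of_def del: G_mult)
qed

section \<open>Components and their arrows\<close>

lemma component_iff: "a \<in> carrier G \<Longrightarrow> X \<in> yd_component K H a \<longleftrightarrow> X \<in> Obj C \<and> fst X = a"
  by (cases X) (auto simp: yd_component_def hat_Obj yd_category_def)

lemma component_arr_iff:
  assumes "a \<in> carrier G"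
  shows "\<phi> \<in> Cmp_arr C (yd_component K H) a \<longleftrightarrow> (\<exists>X Y f. yd_hom X Y f \<and> \<phi> = yd_arrow X Y f \<and> fst X = a)"
proof
  assume "\<phi> \<in> Cmp_arr C (yd_component K H) a"
  then have \<phi>: "\<phi> \<in> Arr C" "Dom C \<phi> \<in> yd_component K H a" by (simp_all add: Cmp_arr_def)
  then obtain X Y f where f: "yd_hom X Y f" "\<phi> = yd_arrow X Y f"
    unfolding Arr_iff by blast
  then have "fst X = a" using \<phi>(2) by (simp add: component_iff[OF assms])
  then show "\<exists>X Y f. yd_hom X Y f \<and> \<phi> = yd_arrow X Y f \<and> fst X = a" using f by blast
next
  assume "\<exists>X Y f. yd_hom X Y f \<and> \<phi> = yd_arrow X Y f \<and> fst X = a"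
  then obtain X Y f where f: "yd_hom X Y f" "\<phi> = yd_arrow X Y f" "fst X = a" by blast
  moreover have "\<phi> \<in> Arr C" using f unfolding Arr_iff by blast
  ultimately show "\<phi> \<in> Cmp_arr C (yd_component K H) a"
    using yd_homD(1-3)[OF f(1)] by (simp add: Cmp_arr_def component_iff[OF assms])
qed

lemma conj_inverse:
  assumes a: "a \<in> carrier G" and X: "X \<in> Obj C"
  shows "cobj a (cobj (inv\<^bsub>G\<^esub> a) X) = X"
  using conj_compose[OF a G.inv_closed[OF a] X] conj_one[OF X] a by (simp del: G_mult G_inv G_one)

lemma fst_conj_inverse:
  assumes "a \<in> carrier G" "b \<in> carrier G" "fst X = b \<otimes>\<^bsub>G\<^esub> a \<otimes>\<^bsub>G\<^esub> inv\<^bsub>G\<^esub> b"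
  shows "fst (cobj (inv\<^bsub>G\<^esub> b) X) = a"
  using assms by (simp add: G.m_assoc group_inv_cancel[OF G_group] del: G_mult G_inv)

lemma hat_crossed: "crossed_category G C (yd_component K H) (yd_conj K H)"
proof (rule crossed_category.intro[OF G_group hat_monoidal], rule crossed_category_axioms.intro)
  have "X \<in> Obj C \<longleftrightarrow> (\<exists>a\<in>carrier G. X \<in> yd_component K H a)" for X
    using Obj_simps(1)[of X] component_iff[of _ X] by blast
  then show "Obj C = (\<Union>a\<in>carrier G. yd_component K H a)"
    by blast
  show "yd_component K H a \<inter> yd_component K H b = {}" if "a \<in> carrier G" "b \<in> carrier G" "a \<noteq> b" for a b
    using that by (auto simp: component_iff)
  have arr: "\<phi> \<in> Arr C \<longleftrightarrow> (\<exists>a\<in>carrier G. \<phi> \<in> Cmp_arr C (yd_component K H) a)" for \<phi>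
  proof -
    have "fst X \<in> carrier G" if "yd_hom X Y f" for X Y f using yd_homD(1)[OF that] by simp
    then show ?thesis unfolding Arr_iff using component_arr_iff by blast
  qed
  then show "Arr C = (\<Union>a\<in>carrier G. Cmp_arr C (yd_component K H) a)"
    by blast
  show "U \<boxtimes>\<^bsub>C\<^esub> V \<in> yd_component K H (a \<otimes>\<^bsub>G\<^esub> b)"
    if "a \<in> carrier G" "b \<in> carrier G" "U \<in> yd_component K H a" "V \<in> yd_component K H b" for a b U V
    using that by (simp add: component_iff hat_simps tensor_in_Obj del: G_mult)
  show "yd_conj K H \<in> hom G (tensor_aut C)" by (rule conj_hom)
  show "fst (yd_conj K H b) ` yd_component K H a = yd_component K H (b \<otimes>\<^bsub>G\<^esub> a \<otimes>\<^bsub>G\<^esub> inv\<^bsub>G\<^esub> b)"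
    if a: "a \<in> carrier G" and b: "b \<in> carrier G" for a b
  proof (intro equalityI subsetI)
    fix Y assume "Y \<in> fst (yd_conj K H b) ` yd_component K H a"
    then obtain X where X: "X \<in> Obj C" "fst X = a" "Y = cobj b X"
      using a by (auto simp: component_iff conj_fst)
    then show "Y \<in> yd_component K H (b \<otimes>\<^bsub>G\<^esub> a \<otimes>\<^bsub>G\<^esub> inv\<^bsub>G\<^esub> b)"
      using a b by (simp add: component_iff conj_in_Obj del: G_mult G_inv)
  next
    fix Y assume "Y \<in> yd_component K H (b \<otimes>\<^bsub>G\<^esub> a \<otimes>\<^bsub>G\<^esub> inv\<^bsub>G\<^esub> b)"
    then have Y: "Y \<in> Obj C" "fst Y = b \<otimes>\<^bsub>G\<^esub> a \<otimes>\<^bsub>G\<^esub> inv\<^bsub>G\<^esub> b"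
      using a b by (simp_all add: component_iff del: G_mult G_inv)
    \<comment> \<open>The preimage of Y is its conjugate by the inverse of b, whose index is
      b\<inverse> (b a b\<inverse>) b = a.\<close>
    have "cobj (inv\<^bsub>G\<^esub> b) Y \<in> Obj C" using b Y(1) by (simp add: conj_in_Obj)
    moreover have "cobj (inv\<^bsub>G\<^esub> b) Y \<in> yd_component K H a"
      unfolding component_iff[OF a] using calculation fst_conj_inverse[OF a b Y(2)] by blast
    ultimately show "Y \<in> fst (yd_conj K H b) ` yd_component K H a"
      using conj_fst[of "cobj (inv\<^bsub>G\<^esub> b) Y" b] conj_inverse[OF b Y(1)] by (metis image_eqI)
  qed
  show "snd (yd_conj K H b) ` Cmp_arr C (yd_component K H) a = Cmp_arr C (yd_component K H) (b \<otimes>\<^bsub>G\<^esub> a \<otimes>\<^bsub>G\<^esub> inv\<^bsub>G\<^esub> b)"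
    if a: "a \<in> carrier G" and b: "b \<in> carrier G" for a b
  proof -
    have bab: "b \<otimes>\<^bsub>G\<^esub> a \<otimes>\<^bsub>G\<^esub> inv\<^bsub>G\<^esub> b \<in> carrier G" using a b by simp
    show ?thesis
    proof (intro equalityI subsetI)
      fix \<psi> assume "\<psi> \<in> snd (yd_conj K H b) ` Cmp_arr C (yd_component K H) a"
      then obtain X Y f where f: "yd_hom X Y f" "fst X = a" "\<psi> = snd (yd_conj K H b) (yd_arrow X Y f)"
        unfolding image_iff component_arr_iff[OF a] Bex_def by blast
      have "fst (cobj b X) = b \<otimes>\<^bsub>G\<^esub> a \<otimes>\<^bsub>G\<^esub> inv\<^bsub>G\<^esub> b" using f(2) by simp
      then show "\<psi> \<in> Cmp_arr C (yd_component K H) (b \<otimes>\<^bsub>G\<^esub> a \<otimes>\<^bsub>G\<^esub> inv\<^bsub>G\<^esub> b)"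
        unfolding component_arr_iff[OF bab] f(3) conj_snd[OF f(1)] using yd_hom_conj[OF b f(1)] by blast
    next
      fix \<psi> assume "\<psi> \<in> Cmp_arr C (yd_component K H) (b \<otimes>\<^bsub>G\<^esub> a \<otimes>\<^bsub>G\<^esub> inv\<^bsub>G\<^esub> b)"
      then obtain X Y f where f: "yd_hom X Y f" "\<psi> = yd_arrow X Y f" "fst X = b \<otimes>\<^bsub>G\<^esub> a \<otimes>\<^bsub>G\<^esub> inv\<^bsub>G\<^esub> b"
        unfolding component_arr_iff[OF bab] by blast
      note g = yd_hom_conj[OF G.inv_closed[OF b] f(1)]
      have "yd_arrow (cobj (inv\<^bsub>G\<^esub> b) X) (cobj (inv\<^bsub>G\<^esub> b) Y) f \<in> Cmp_arr C (yd_component K H) a"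
        unfolding component_arr_iff[OF a] using g fst_conj_inverse[OF a b f(3)] by blast
      moreover have "\<psi> = snd (yd_conj K H b) (yd_arrow (cobj (inv\<^bsub>G\<^esub> b) X) (cobj (inv\<^bsub>G\<^esub> b) Y) f)"
        unfolding conj_snd[OF g] conj_inverse[OF b yd_homD(1)[OF f(1)]] conj_inverse[OF b yd_homD(2)[OF f(1)]] by (rule f(2))
      ultimately show "\<psi> \<in> snd (yd_conj K H b) ` Cmp_arr C (yd_component K H) a" by blast
    qed
  qed
qed

section \<open>The braided structure\<close>

text \<open>The sums in \<open>yd_braiding\<close> are formed in the target object with its action
  and coaction; they are sums in the tensor product of the underlying modules.\<close>

lemma braiding_eq:
  "yd_braiding K H X Y = yd_arrow (X \<odot>\<odot> Y) (cobj (fst X) Y \<odot>\<odot> X) (braid (inv\<^bsub>A\<^esub> (fst (fst X))) (snd X) (snd Y))"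
proof -
  obtain \<alpha> \<beta> M b N where XY: "X = ((\<alpha>, \<beta>), M)" "Y = (b, N)"
    by (metis surj_pair)
  have eq: "tsum (snd (cobj (\<alpha>, \<beta>) (b, N) \<odot>\<odot> ((\<alpha>, \<beta>), M))) = tsum (tensor K N M)"
    unfolding yd_tensor_simps conj_simps by (intro ext) simp
  show ?thesis
    unfolding XY yd_braiding.simps Let_def eq by (simp only: braid_def[abs_def] fst_conv snd_conv)
qed

lemma yd_hom_braid:
  assumes X: "X \<in> Obj C" and Y: "Y \<in> Obj C"
  shows "yd_hom (X \<odot>\<odot> Y) (cobj (fst X) Y \<odot>\<odot> X) (braid (inv\<^bsub>A\<^esub> (fst (fst X))) (snd X) (snd Y))"
    and "yd_braiding K H X Y \<in> Iso C (X \<odot>\<odot> Y) (cobj (fst X) Y \<odot>\<odot> X)"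
proof -
  note [simp] = X Y
  let ?a = "inv\<^bsub>A\<^esub> (fst (fst X))"
  have "yd_map (snd (X \<odot>\<odot> Y)) (snd (cobj (fst X) Y \<odot>\<odot> X)) (braid ?a (snd X) (snd Y))"
    unfolding yd_tensor_simps conj_simps
    by (rule braid_yd_map[OF Obj_simps(4)[OF X] Obj_simps(4)[OF Y]]) (simp_all add: aut_word_apply)
  \<comment> \<open>In indices: a b = (a b a\<inverse>) a.\<close>
  moreover have "fst (X \<odot>\<odot> Y) = fst (cobj (fst X) Y \<odot>\<odot> X)"
    by (simp add: G.m_assoc del: G_mult G_inv)
  ultimately show h: "yd_hom (X \<odot>\<odot> Y) (cobj (fst X) Y \<odot>\<odot> X) (braid ?a (snd X) (snd Y))"
    unfolding yd_hom_def using tensor_in_Obj[OF X Y] tensor_in_Obj[OF conj_in_Obj[OF Obj_simps(1)[OF X] Y] X] by blast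
  have a: "?a \<in> carrier A" by simp
  note b = braid_rules[OF Obj_simps(3)[OF X] Obj_simps(2)[OF Y] a same_module_refl same_module_refl]
  show "yd_braiding K H X Y \<in> Iso C (X \<odot>\<odot> Y) (cobj (fst X) Y \<odot>\<odot> X)"
    unfolding braiding_eq
    \<comment> \<open>Only a pointwise inverse is supplied; that it is a morphism follows from the
      braiding being one.\<close>
    by (rule yd_hom_inverse(2)[OF h, of "braid_inv ?a (snd X) (snd Y)"])
      (simp_all add: braid_inverse mod_hom_closed[OF b(3)])
qed

lemma hat_braiding_tensor_left:
  assumes U: "U \<in> Obj C" and V: "V \<in> Obj C" and W: "W \<in> Obj C"
  shows "yd_braiding K H (U \<odot>\<odot> V) W
    = Assoc C (cobj (fst U) (cobj (fst V) W)) U V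
      \<cdot>\<^bsub>C\<^esub> (yd_braiding K H U (cobj (fst V) W) \<star>\<^bsub>C\<^esub> Ident C V)
      \<cdot>\<^bsub>C\<^esub> Inv_arr C (Assoc C U (cobj (fst V) W) V)
      \<cdot>\<^bsub>C\<^esub> (Ident C U \<star>\<^bsub>C\<^esub> yd_braiding K H V W)
      \<cdot>\<^bsub>C\<^esub> Assoc C U V W"
proof -
  note [simp] = U V W
  note fU = Obj_simps(1)[OF U] and fV = Obj_simps(1)[OF V]
  note vW = conj_in_Obj[OF fV W]
  note uvW = conj_in_Obj[OF fU vW]
  note c1 = yd_hom_assoc(1)[OF U V W]
  note c2 = yd_hom_tensor[OF yd_hom_id[OF U] yd_hom_braid(1)[OF V W]]
  note c3 = yd_hom_assoc(2)[OF U vW V]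
  note c4 = yd_hom_tensor[OF yd_hom_braid(1)[OF U vW] yd_hom_id[OF V]]
  note c5 = yd_hom_assoc(1)[OF uvW U V]
  note d2 = yd_hom_compose[OF c1 c2(1)]
  note d3 = yd_hom_compose[OF d2(1) c3]
  note d4 = yd_hom_compose[OF d3(1) c4(1)]
  note d5 = yd_hom_compose[OF d4(1) c5]
  \<comment> \<open>The left side ends in the conjugate by a product, the right side in an iterated
    conjugate. Strictness of the action makes these the same object.\<close>
  have tgt: "cobj (fst (U \<odot>\<odot> V)) W \<odot>\<odot> (U \<odot>\<odot> V) = cobj (fst U) (cobj (fst V) W) \<odot>\<odot> (U \<odot>\<odot> V)"
    unfolding yd_tensor_simps(1) conj_compose[OF fU fV W] ..
  show ?thesis
    unfolding braiding_eq hat_simps hat_structure(3) yd_hom_assoc(4)[OF U vW V, unfolded hat_structure(3)]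
      c2(2) c4(2) d2(2) d3(2) d4(2) d5(2) tgt
  proof (rule yd_arrow_eqI)
    fix t assume "t \<in> carrier (snd ((U \<odot>\<odot> V) \<odot>\<odot> W))"
    then have t: "t \<in> carrier (tensor K (tensor K (snd U) (snd V)) (snd W))" by simp
    let ?f = "\<lambda>X. fst (fst X)"
    have "braid (inv\<^bsub>A\<^esub> (fst (fst U \<otimes>\<^bsub>G\<^esub> fst V))) (tensor_obj (snd (fst V)) (tau (fst U) (fst V)) (snd U) (snd V)) (snd W) t
      = assoc_map (snd W) (snd U) (snd V)
         (tensor_fun (tensor K (snd W) (snd U)) (snd V)
           (braid (inv\<^bsub>A\<^esub> (?f U)) (snd U) (conj_obj (kap (fst V)) (mu (fst V) (fst W)) (snd W))) (\<lambda>x. x)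
           (assoc_inv (snd U) (snd W) (snd V)
             (tensor_fun (snd U) (tensor K (snd W) (snd V)) (\<lambda>x. x) (braid (inv\<^bsub>A\<^esub> (?f V)) (snd V) (snd W))
               (assoc_map (snd U) (snd V) (snd W) t))))"
      \<comment> \<open>With indices (\<alpha>, \<beta>) of U and (\<gamma>, \<delta>) of V, the
        parameter a' inverts \<delta>\<alpha>\<delta>\<inverse>\<gamma>. Hence a' \<delta> =
        \<gamma>\<inverse>\<delta>\<alpha>\<inverse>, that is \<open>kap\<close> of V after
        \<alpha>\<inverse>, and a' \<epsilon> = \<gamma>\<inverse>.\<close>
      by (rule braid_tensor_left) (use t in \<open>simp_all add: aut_word_apply\<close>)
    then show "braid (inv\<^bsub>A\<^esub> (fst (fst (U \<odot>\<odot> V)))) (snd (U \<odot>\<odot> V)) (snd W) t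
      = assoc_map (snd (cobj (fst U) (cobj (fst V) W))) (snd U) (snd V)
         (tensor_fun (snd (cobj (fst U) (cobj (fst V) W) \<odot>\<odot> U)) (snd V)
           (braid (inv\<^bsub>A\<^esub> (?f U)) (snd U) (snd (cobj (fst V) W))) (\<lambda>x. x)
           (assoc_inv (snd U) (snd (cobj (fst V) W)) (snd V)
             (tensor_fun (snd U) (snd (cobj (fst V) W \<odot>\<odot> V)) (\<lambda>x. x) (braid (inv\<^bsub>A\<^esub> (?f V)) (snd V) (snd W))
               (assoc_map (snd U) (snd V) (snd W) t))))"
      by (simp del: G_mult)
  qed
qed

lemma hat_braiding_tensor_right:
  assumes U: "U \<in> Obj C" and V: "V \<in> Obj C" and W: "W \<in> Obj C"
  shows "yd_braiding K H U (V \<odot>\<odot> W)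
    = Inv_arr C (Assoc C (cobj (fst U) V) (cobj (fst U) W) U)
      \<cdot>\<^bsub>C\<^esub> (Ident C (cobj (fst U) V) \<star>\<^bsub>C\<^esub> yd_braiding K H U W)
      \<cdot>\<^bsub>C\<^esub> Assoc C (cobj (fst U) V) U W
      \<cdot>\<^bsub>C\<^esub> (yd_braiding K H U V \<star>\<^bsub>C\<^esub> Ident C W)
      \<cdot>\<^bsub>C\<^esub> Inv_arr C (Assoc C U V W)"
proof -
  note [simp] = U V W
  note fU = Obj_simps(1)[OF U]
  note uV = conj_in_Obj[OF fU V] and uW = conj_in_Obj[OF fU W]
  note c1 = yd_hom_assoc(2)[OF U V W]
  note c2 = yd_hom_tensor[OF yd_hom_braid(1)[OF U V] yd_hom_id[OF W]]
  note c3 = yd_hom_assoc(1)[OF uV U W]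
  note c4 = yd_hom_tensor[OF yd_hom_id[OF uV] yd_hom_braid(1)[OF U W]]
  note c5 = yd_hom_assoc(2)[OF uV uW U]
  note d2 = yd_hom_compose[OF c1 c2(1)]
  note d3 = yd_hom_compose[OF d2(1) c3]
  note d4 = yd_hom_compose[OF d3(1) c4(1)]
  note d5 = yd_hom_compose[OF d4(1) c5]
  \<comment> \<open>The targets agree because conjugation preserves tensor products
    strictly.\<close>
  have tgt: "cobj (fst U) (V \<odot>\<odot> W) \<odot>\<odot> U = (cobj (fst U) V \<odot>\<odot> cobj (fst U) W) \<odot>\<odot> U"
    unfolding conj_tensor[OF fU V W] ..
  show ?thesis
    unfolding braiding_eq hat_simps hat_structure(3) yd_hom_assoc(4)[OF U V W, unfolded hat_structure(3)]
      yd_hom_assoc(4)[OF uV uW U, unfolded hat_structure(3)] c2(2) c4(2) d2(2) d3(2) d4(2) d5(2) tgt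
    by (rule yd_arrow_eqI) (simp add: braid_tensor_right)
qed

lemma hat_braided: "braided_T_category G C (yd_component K H) (yd_conj K H) (yd_braiding K H)"
proof (rule braided_T_category.intro[OF hat_crossed], rule braided_T_category_axioms.intro, unfold hat_simps(1,2))
  note cmp = component_iff
  fix a b U V W U' V' \<phi> \<psi>
  show "yd_braiding K H U V \<in> Iso C (U \<odot>\<odot> V) (fst (yd_conj K H a) V \<odot>\<odot> U)"
    if "a \<in> carrier G" "U \<in> yd_component K H a" "V \<in> Obj C"
    using that yd_hom_braid(2)[of U V] by (simp add: cmp conj_fst)
  show "(snd (yd_conj K H a) \<psi> \<star>\<^bsub>C\<^esub> \<phi>) \<cdot>\<^bsub>C\<^esub> yd_braiding K H U V = yd_braiding K H U' V' \<cdot>\<^bsub>C\<^esub> (\<phi> \<star>\<^bsub>C\<^esub> \<psi>)"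
    if a: "a \<in> carrier G" and arr: "\<phi> \<in> Cmp_arr C (yd_component K H) a" "\<phi> \<in> Hom C U U'" "\<psi> \<in> Hom C V V'"
  proof -
    obtain f where f: "yd_hom U U' f" "\<phi> = yd_arrow U U' f"
      using arr(2) unfolding Hom_iff by blast
    obtain g where g: "yd_hom V V' g" "\<psi> = yd_arrow V V' g"
      using arr(3) unfolding Hom_iff by blast
    note o [simp] = yd_homD(1,2)[OF f(1)] yd_homD(1,2)[OF g(1)]
    \<comment> \<open>The first morphism stays inside one component, so both braidings use the same
      parameter.\<close>
    have fU: "fst U = a" "fst U' = a"
      using arr(1) yd_homD(3)[OF f(1)] by (auto simp: Cmp_arr_def f(2) cmp[OF a])
    note br = yd_hom_braid(1)[OF o(1,3), unfolded fU] yd_hom_braid(1)[OF o(2,4), unfolded fU]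
    note gc = yd_hom_conj[OF a g(1)]
    note gf = yd_hom_tensor[OF gc f(1)] and fg = yd_hom_tensor[OF f(1) g(1)]
    show ?thesis
      unfolding f(2) g(2) conj_snd[OF g(1)] braiding_eq fU gf(2) fg(2)
        yd_hom_compose(2)[OF br(1) gf(1)] yd_hom_compose(2)[OF fg(1) br(2)]
    proof (rule yd_arrow_eqI)
      fix t assume "t \<in> carrier (snd (U \<odot>\<odot> V))"
      then have t: "t \<in> carrier (tensor K (snd U) (snd V))" by simp
      show "tensor_fun (snd (cobj a V')) (snd U') g f (braid (inv\<^bsub>A\<^esub> (fst a)) (snd U) (snd V) t)
        = braid (inv\<^bsub>A\<^esub> (fst a)) (snd U') (snd V') (tensor_fun (snd U') (snd V') f g t)"
        using braid_natural[OF yd_homD(4)[OF f(1)] yd_homD(4)[OF g(1)], of "inv\<^bsub>A\<^esub> (fst a)" t] a t by simp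
    qed
  qed
  show "yd_braiding K H (U \<odot>\<odot> V) W
        = Assoc C (fst (yd_conj K H a) (fst (yd_conj K H b) W)) U V
          \<cdot>\<^bsub>C\<^esub> (yd_braiding K H U (fst (yd_conj K H b) W) \<star>\<^bsub>C\<^esub> Ident C V)
          \<cdot>\<^bsub>C\<^esub> Inv_arr C (Assoc C U (fst (yd_conj K H b) W) V)
          \<cdot>\<^bsub>C\<^esub> (Ident C U \<star>\<^bsub>C\<^esub> yd_braiding K H V W)
          \<cdot>\<^bsub>C\<^esub> Assoc C U V W"
    if "a \<in> carrier G" "b \<in> carrier G" "U \<in> yd_component K H a" "V \<in> yd_component K H b" "W \<in> Obj C"
  proof -
    have o: "U \<in> Obj C" "fst U = a" "V \<in> Obj C" "fst V = b" using that by (simp_all add: cmp)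
    show ?thesis
      unfolding conj_fst[OF that(5)] conj_fst[OF conj_in_Obj[OF that(2,5)]]
      by (rule hat_braiding_tensor_left[OF o(1,3) that(5), unfolded o(2,4)])
  qed
  show "yd_braiding K H U (V \<odot>\<odot> W)
        = Inv_arr C (Assoc C (fst (yd_conj K H a) V) (fst (yd_conj K H a) W) U)
          \<cdot>\<^bsub>C\<^esub> (Ident C (fst (yd_conj K H a) V) \<star>\<^bsub>C\<^esub> yd_braiding K H U W)
          \<cdot>\<^bsub>C\<^esub> Assoc C (fst (yd_conj K H a) V) U W
          \<cdot>\<^bsub>C\<^esub> (yd_braiding K H U V \<star>\<^bsub>C\<^esub> Ident C W)
          \<cdot>\<^bsub>C\<^esub> Inv_arr C (Assoc C U V W)"
    if "a \<in> carrier G" "U \<in> yd_component K H a" "V \<in> Obj C" "W \<in> Obj C"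
  proof -
    have o: "U \<in> Obj C" "fst U = a" using that by (simp_all add: cmp)
    show ?thesis
      unfolding conj_fst[OF that(3)] conj_fst[OF that(4)]
      by (rule hat_braiding_tensor_right[OF o(1) that(3,4), unfolded o(2)])
  qed
  show "snd (yd_conj K H a) (yd_braiding K H U V) = yd_braiding K H (fst (yd_conj K H a) U) (fst (yd_conj K H a) V)"
    if a: "a \<in> carrier G" and o: "U \<in> Obj C" "V \<in> Obj C"
  proof -
    note [simp] = a o
    note fU = Obj_simps(1)[OF o(1)]
    \<comment> \<open>Conjugating V by u and then by a is the same as conjugating it by a and then
      by a u a\<inverse>, where u is the index of U.\<close>
    have tgt: "cobj a (cobj (fst U) V \<odot>\<odot> U) = cobj (a \<otimes>\<^bsub>G\<^esub> fst U \<otimes>\<^bsub>G\<^esub> inv\<^bsub>G\<^esub> a) (cobj a V) \<odot>\<odot> cobj a U"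
    proof -
      have "cobj (a \<otimes>\<^bsub>G\<^esub> fst U \<otimes>\<^bsub>G\<^esub> inv\<^bsub>G\<^esub> a) (cobj a V) = cobj (a \<otimes>\<^bsub>G\<^esub> fst U \<otimes>\<^bsub>G\<^esub> inv\<^bsub>G\<^esub> a \<otimes>\<^bsub>G\<^esub> a) V"
        by (rule conj_compose[symmetric]) simp_all
      also have "\<dots> = cobj a (cobj (fst U) V)"
        by (simp add: G.m_assoc conj_compose del: G_mult G_inv)
      finally show ?thesis
        by (simp add: conj_tensor conj_in_Obj)
    qed
    show ?thesis
      unfolding conj_fst[OF o(1)] conj_fst[OF o(2)] braiding_eq conj_snd[OF yd_hom_braid(1)[OF o]]
        conj_tensor[OF a o] tgt conj_simps(1)[of a U]
    proof (rule yd_arrow_eqI)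
      fix t assume "t \<in> carrier (snd (cobj a U \<odot>\<odot> cobj a V))"
      then have t: "t \<in> carrier (tensor K (snd U) (snd V))" by simp
      show "braid (inv\<^bsub>A\<^esub> (fst (fst U))) (snd U) (snd V) t
        = braid (inv\<^bsub>A\<^esub> (fst (a \<otimes>\<^bsub>G\<^esub> fst U \<otimes>\<^bsub>G\<^esub> inv\<^bsub>G\<^esub> a))) (snd (cobj a U)) (snd (cobj a V)) t"
        unfolding conj_simps(2)
        \<comment> \<open>If \<gamma> is the first component of the index of U, that of its
          conjugate is \<mu>\<gamma>\<kappa>; its inverse a' satisfies \<kappa> a' \<mu> =
          \<gamma>\<inverse>.\<close>
        by (rule braid_conj[symmetric]) (use t in \<open>simp_all add: aut_word_apply\<close>)
    qed
  qed
qed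

end

theorem proposition3p8:
  fixes K :: "('k, 'r) ring_scheme" and H :: "('k, 'x, 'h) hopf_alg_scheme"
  assumes "field K" and "hopf_algebra K H"
  shows "braided_T_category (yd_group K H) (yd_hat K H) (yd_component K H)
    (yd_conj K H) (yd_braiding K H)"
  by (rule hopf_algebra.hat_braided[OF assms(2)])

end
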